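(* Let $c=m/n$ with $m,n$ coprime positive integers and let $\mu_\ell=(n-\ell,1^\ell)$. For $\ell=1,\dots,n-1$, the space $\mathrm{Hom}_{H_c}(\Delta_c(\mu_\ell),\Delta_c(\mu_{\ell-1}))$ is $1$-dimensional. Up to a nonzero scalar, the unique nonzero homomorphism $\phi_\ell:\Delta_c(\mu_\ell)\to\Delta_c(\mu_{\ell-1})$ is determined by $$\phi_\ell\big(v(0,T_{i_1<\cdots<i_\ell})\big)=v(me_{i_\ell},T_{i_1<\cdots<i_{\ell-1}})\qquad\text{for all }1<i_1<\cdots<i_\ell\le n,$$ where $e_j$ is the $j$-th standard basis vector of $\mathbb Z^n$.
   Context: $H_c=H_{1,c}(\mathcal S_n,\mathbb C^n)$ is the quotient of $\mathbb C\langle x_1,\dots,x_n,y_1,\dots,y_n\rangle\rtimes\mathcal S_n$ by $[x_i,x_j]=[y_i,y_j]=0$, $[y_i,x_j]=c\,(ij)$ for $i\ne j$, $[y_i,x_i]=1-c\sum_{j\ne i}(ij)$. $s_i=(i,i+1)$, $u_i=x_iy_i-c\sum_{j<i}(ij)$. For a partition $\mu$ of $n$ with irreducible $\mathcal S_n$-module $V_\mu$ ($V_{(n)}$ trivial), $\Delta_c(\mu)=\mathrm{Ind}_{\mathbb C[y_1,\dots,y_n]\rtimes\mathcal S_n}^{H_c}V_\mu\cong\mathbb C[x_1,\dots,x_n]\otimes V_\mu$, the $y_i$ acting by $0$ on $V_\mu$. $T_{i_1<\cdots<i_\ell}$ is the standard Young tableau of shape $\mu_\ell$ whose first column contains $1,i_1,\dots,i_\ell$;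 every standard tableau of shape $\mu_\ell$ has this form. $\mathrm{ct}_T(i)$ is the content (column minus row) of the box of $T$ labeled $i$. $V_{\mu_\ell}$ has a basis $v_T$ ($T$ standard) with $u_iv_T=-\mathrm{ct}_T(i)c\,v_T$, normalized as follows: $v_{T_{2<3<\cdots<\ell+1}}$ is any fixed nonzero vector, and whenever $T'=s_jT$ is obtained from $T$ by replacing an entry $j$ of the leg by $j+1$ (with $j\geq 2$ and $j+1$ not in the first column of $T$), one has $v_{T'}=\sigma_jv_T$, where $\sigma_j=s_j-\frac{c}{u_j-u_{j+1}}$. For $\mathbf a\in\mathbb Z_{\ge0}^n$, $g_{\mathbf a}\in\mathcal S_n$ is the minimal length permutation sorting $\mathbf a$ non-decreasingly: $g_{\mathbf a}(i)=\#\{j:a_j<a_i\}+\#\{j\le i:a_j=a_i\}$. The vectors $x^{\mathbf a}g_{\mathbf a}^{-1}v_T$ form a basis of $\Delta_c(\mu)$. For $c=m/n$ the simultaneous eigenspace of $u_1,\dots,u_n$ in $\Delta_c(\mu)$ with eigenvalues $\mathtt w_i(\mathbf a,T)=a_i-\mathrm{ct}_T(g_{\mathbf a}(i))c$ is one-dimensional, and $v(\mathbf a,T)$ denotes the vector in it in which $x^{\mathbf a}g_{\mathbf a}^{-1}v_T$ has coefficient $1$; in particular $v(0,T)=v_T$. *)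

theory Defs
  imports
    Complex_Main
    "HOL-Library.Poly_Mapping"
    "HOL-Library.FuncSet"
    "HOL-Combinatorics.Permutations"
    "HOL-Algebra.QuotRing"
    "HOL-Algebra.Generated_Groups"
    "HOL-Algebra.Free_Abelian_Groups"
    "Jordan_Normal_Form.Missing_VectorSpace"
    "Jordan_Normal_Form.VS_Connect"
begin

section \<open>The rational Cherednik algebra\<close>

datatype gen = X nat | Y nat

fun gen_act :: "(nat \<Rightarrow> nat) \<Rightarrow> gen \<Rightarrow> gen" where
  "gen_act g (X i) = X (g i)"
| "gen_act g (Y i) = Y (g i)"

lemma gen_act_id [simp]: "gen_act id = id"
proof
  show "gen_act id t = id t" for t by (cases t) auto
qed

lemma gen_act_comp: "gen_act (g \<circ> h) = gen_act g \<circ> gen_act h"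
proof
  show "gen_act (g \<circ> h) t = (gen_act g \<circ> gen_act h) t" for t by (cases t) auto
qed

text \<open>
  The semidirect product of the free monoid on the symbols \<open>x\<^sub>i, y\<^sub>i\<close> with maps of the indices,
  the element \<open>SM w g\<close> standing for the product \<open>w g\<close>. It is written additively because
  the product of \<^typ>\<open>'a \<Rightarrow>\<^sub>0 'b\<close> is the convolution over an additive monoid; thus
  the finitely supported functions on it whose indices lie in \<open>{1..n}\<close> and whose maps permute
  \<open>{1..n}\<close> are the smash product of the free algebra with the symmetric group.
\<close>

datatype smash_mon = SM "gen list" "nat \<Rightarrow> nat"

instantiation smash_mon :: monoid_add
begin

definition zero_smash_mon :: smash_mon where
  "0 = SM [] id"

fun plus_smash_mon :: "smash_mon \<Rightarrow> smash_mon \<Rightarrow> smash_mon" where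
  "SM u g + SM v h = SM (u @ map (gen_act g) v) (g \<circ> h)"

instance
proof
  fix a b c :: smash_mon
  show "a + b + c = a + (b + c)"
    by (cases a; cases b; cases c) (simp add: gen_act_comp o_assoc)
  show "0 + a = a" by (cases a) (simp add: zero_smash_mon_def)
  show "a + 0 = a" by (cases a) (simp add: zero_smash_mon_def)
qed

end

type_synonym smash = "smash_mon \<Rightarrow>\<^sub>0 complex"

definition scal :: "complex \<Rightarrow> smash" where
  "scal z = Poly_Mapping.single 0 z"

definition gx :: "nat \<Rightarrow> smash" where
  "gx i = Poly_Mapping.single (SM [X i] id) 1"

definition gy :: "nat \<Rightarrow> smash" where
  "gy i = Poly_Mapping.single (SM [Y i] id) 1"

definition perm_elt :: "(nat \<Rightarrow> nat) \<Rightarrow> smash" where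
  "perm_elt g = Poly_Mapping.single (SM [] g) 1"

definition transp :: "nat \<Rightarrow> nat \<Rightarrow> smash" where
  "transp i j = perm_elt (transpose i j)"

definition smash_ring :: "nat \<Rightarrow> smash ring" where
  "smash_ring n =
    \<lparr>carrier = {a. Poly_Mapping.keys a \<subseteq> {SM w g | w g. set w \<subseteq> X ` {1..n} \<union> Y ` {1..n} \<and> g permutes {1..n}}},
     monoid.mult = (*), one = 1, ring.zero = 0, add = (+)\<rparr>"

lemma smash_mult_closed:
  fixes a b :: smash
  assumes "a \<in> carrier (smash_ring n)" "b \<in> carrier (smash_ring n)"
  shows "a * b \<in> carrier (smash_ring n)"
proof -
  let ?S = "{SM w g | w g. set w \<subseteq> X ` {1..n} \<union> Y ` {1..n} \<and> g permutes {1..n}}"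
  have k: "Poly_Mapping.keys (a * b) \<subseteq> {x + y | x y. x \<in> Poly_Mapping.keys a \<and> y \<in> Poly_Mapping.keys b}"
    by (rule keys_mult)
  have s: "x + y \<in> ?S"
    if xy: "x \<in> ?S"
       "y \<in> ?S" for x y
  proof -
    obtain w g u h where *: "x = SM w g" "y = SM u h" "set w \<subseteq> X ` {1..n} \<union> Y ` {1..n}" "g permutes {1..n}"
      "set u \<subseteq> X ` {1..n} \<union> Y ` {1..n}" "h permutes {1..n}" using xy by blast
    have "gen_act g t \<in> X ` {1..n} \<union> Y ` {1..n}" if "t \<in> set u" for t
    proof -
      have "t \<in> X ` {1..n} \<union> Y ` {1..n}" using *(5) that by blast
      moreover have "g i \<in> {1..n}" if "i \<in> {1..n}" for i
        using permutes_in_image[OF *(4)] that by blast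
      ultimately show ?thesis by (elim UnE imageE) simp_all
    qed
    then have "set (w @ map (gen_act g) u) \<subseteq> X ` {1..n} \<union> Y ` {1..n}"
      unfolding set_append set_map using *(3) by blast
    moreover have "g \<circ> h permutes {1..n}"
      using *(6,4) by (rule permutes_compose)
    ultimately show ?thesis unfolding *(1,2) plus_smash_mon.simps by blast
  qed
  have ab: "Poly_Mapping.keys a \<subseteq> ?S" "Poly_Mapping.keys b \<subseteq> ?S"
    using assms unfolding smash_ring_def by simp_all
  have "Poly_Mapping.keys (a * b) \<subseteq> ?S"
  proof
    fix t assume "t \<in> Poly_Mapping.keys (a * b)"
    then obtain x y where t: "t = x + y" and xy: "x \<in> Poly_Mapping.keys a" "y \<in> Poly_Mapping.keys b"
      using k by blast
    show "t \<in> ?S"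
      unfolding t by (rule s[OF subsetD[OF ab(1) xy(1)] subsetD[OF ab(2) xy(2)]])
  qed
  then show ?thesis unfolding smash_ring_def by simp
qed

lemma smash_ring_ring: "ring (smash_ring n)"
proof (rule ringI)
  have add: "a + b \<in> carrier (smash_ring n)" if "a \<in> carrier (smash_ring n)" "b \<in> carrier (smash_ring n)" for a b
    using that Poly_Mapping.keys_add[of a b] unfolding smash_ring_def by (simp, blast)
  show "abelian_group (smash_ring n)"
  proof (rule abelian_groupI)
    fix x assume "x \<in> carrier (smash_ring n)"
    then show "\<exists>y\<in>carrier (smash_ring n). y \<oplus>\<^bsub>smash_ring n\<^esub> x = \<zero>\<^bsub>smash_ring n\<^esub>"
      by (intro bexI[of _ "-x"]) (auto simp: smash_ring_def in_keys_iff subset_iff)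
  qed (use add in \<open>auto simp: smash_ring_def add.assoc add.commute\<close>)
  show "Group.monoid (smash_ring n)"
  proof (rule monoidI)
    show "\<one>\<^bsub>smash_ring n\<^esub> \<in> carrier (smash_ring n)"
      by (auto simp: smash_ring_def zero_smash_mon_def)
  qed (use smash_mult_closed in \<open>auto simp: smash_ring_def mult.assoc\<close>)
qed (auto simp: smash_ring_def algebra_simps)

definition cherednik_rels :: "nat \<Rightarrow> complex \<Rightarrow> smash set" where
  "cherednik_rels n c =
     {gx i * gx j - gx j * gx i | i j. i \<in> {1..n} \<and> j \<in> {1..n}}
   \<union> {gy i * gy j - gy j * gy i | i j. i \<in> {1..n} \<and> j \<in> {1..n}}
   \<union> {gy i * gx j - gx j * gy i - scal c * transp i j | i j. i \<in> {1..n} \<and> j \<in> {1..n} \<and> i \<noteq> j}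
   \<union> {gy i * gx i - gx i * gy i - (1 - scal c * (\<Sum>j\<in>{1..n} - {i}. transp i j)) | i. i \<in> {1..n}}"

definition cherednik_ideal :: "nat \<Rightarrow> complex \<Rightarrow> smash set" where
  "cherednik_ideal n c = Idl\<^bsub>smash_ring n\<^esub> (cherednik_rels n c)"

definition cherednik :: "nat \<Rightarrow> complex \<Rightarrow> smash set ring" where
  "cherednik n c = smash_ring n Quot cherednik_ideal n c"

definition cls :: "nat \<Rightarrow> complex \<Rightarrow> smash \<Rightarrow> smash set" where
  "cls n c a = cherednik_ideal n c +>\<^bsub>smash_ring n\<^esub> a"

definition u_elt :: "complex \<Rightarrow> nat \<Rightarrow> smash" where
  "u_elt c i = gx i * gy i - scal c * (\<Sum>j\<in>{1..<i}. transp i j)"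


section \<open>Tableaux and the irreducible modules of the symmetric group\<close>

text \<open>Partitions are lists of parts, tableaux are lists of rows; rows and columns of boxes are
  numbered from \<open>0\<close>.\<close>

definition std_tableaux :: "nat list \<Rightarrow> nat list list set" where
  "std_tableaux \<mu> = {T. map length T = \<mu> \<and> distinct (concat T) \<and> set (concat T) = {1..sum_list \<mu>}
     \<and> (\<forall>R\<in>set T. sorted R)
     \<and> (\<forall>r s. Suc r < length T \<and> s < length (T ! Suc r) \<longrightarrow> T ! r ! s < T ! Suc r ! s)}"

definition box_content :: "nat list list \<Rightarrow> nat \<Rightarrow> int" where
  "box_content T k = (THE d. \<exists>r s. r < length T \<and> s < length (T ! r) \<and> T ! r ! s = k \<and> d = int s - int r)"

fun row_filling :: "nat \<Rightarrow> nat list \<Rightarrow> nat list list" where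
  "row_filling k [] = []"
| "row_filling k (p # ps) = [Suc k..<Suc (k + p)] # row_filling (k + p) ps"

definition column :: "nat list list \<Rightarrow> nat \<Rightarrow> nat set" where
  "column T s = {T ! r ! s | r. r < length T \<and> s < length (T ! r)}"

definition row_stab :: "nat \<Rightarrow> nat list list \<Rightarrow> (nat \<Rightarrow> nat) set" where
  "row_stab n T = {p. p permutes {1..n} \<and> (\<forall>R\<in>set T. p ` set R = set R)}"

definition col_stab :: "nat \<Rightarrow> nat list list \<Rightarrow> (nat \<Rightarrow> nat) set" where
  "col_stab n T = {q. q permutes {1..n} \<and> (\<forall>s. q ` column T s = column T s)}"

definition young_symmetrizer :: "nat \<Rightarrow> nat list \<Rightarrow> smash" where
  "young_symmetrizer n \<mu> =
     (\<Sum>p\<in>row_stab n (row_filling 0 \<mu>). \<Sum>q\<in>col_stab n (row_filling 0 \<mu>).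
        scal (of_int (sign q)) * perm_elt (p \<circ> q))"

definition group_algebra :: "nat \<Rightarrow> smash set" where
  "group_algebra n = {a. Poly_Mapping.keys a \<subseteq> {SM [] g | g. g permutes {1..n}}}"

text \<open>\<open>V\<^sub>\<mu>\<close> as the left ideal of the group algebra generated by the Young symmetrizer
  (row sums times signed column sums, so that \<open>V\<^bsub>(n)\<^esub>\<close> is trivial).\<close>

definition irrep :: "nat \<Rightarrow> nat list \<Rightarrow> (complex, smash) module" where
  "irrep n \<mu> =
    \<lparr>carrier = {a * young_symmetrizer n \<mu> | a. a \<in> group_algebra n},
     monoid.mult = undefined, one = undefined, ring.zero = 0, add = (+), smult = (\<lambda>z v. scal z * v)\<rparr>"


section \<open>Induced modules\<close>

text \<open>
  \<open>R \<otimes>\<^sub>B V\<close> for a ring homomorphism \<open>h : B \<rightarrow> R\<close> and a left \<open>B\<close>-module \<open>V\<close> with action \<open>act\<close>: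
  the free abelian group on the pairs, modulo biadditivity and balancing over \<open>B\<close>. The ring
  structure of \<open>B\<close> does not enter the construction, so only its carrier is a parameter.
\<close>

definition tensor_rels ::
    "'r ring \<Rightarrow> 'b set \<Rightarrow> ('b \<Rightarrow> 'r) \<Rightarrow> ('b \<Rightarrow> 'v \<Rightarrow> 'v) \<Rightarrow> (complex, 'v) module
      \<Rightarrow> ('r \<times> 'v \<Rightarrow>\<^sub>0 int) set" where
  "tensor_rels R B h act V =
     {frag_of (r \<oplus>\<^bsub>R\<^esub> r', v) - frag_of (r, v) - frag_of (r', v) | r r' v.
        r \<in> carrier R \<and> r' \<in> carrier R \<and> v \<in> carrier V}
   \<union> {frag_of (r, v \<oplus>\<^bsub>V\<^esub> v') - frag_of (r, v) - frag_of (r, v') | r v v'.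
        r \<in> carrier R \<and> v \<in> carrier V \<and> v' \<in> carrier V}
   \<union> {frag_of (r \<otimes>\<^bsub>R\<^esub> h b, v) - frag_of (r, act b v) | r b v.
        r \<in> carrier R \<and> b \<in> B \<and> v \<in> carrier V}"

definition tensor_free :: "'r ring \<Rightarrow> (complex, 'v) module \<Rightarrow> ('r \<times> 'v \<Rightarrow>\<^sub>0 int) monoid" where
  "tensor_free R V = free_Abelian_group (carrier R \<times> carrier V)"

definition tensor_kernel ::
    "'r ring \<Rightarrow> 'b set \<Rightarrow> ('b \<Rightarrow> 'r) \<Rightarrow> ('b \<Rightarrow> 'v \<Rightarrow> 'v) \<Rightarrow> (complex, 'v) module
      \<Rightarrow> ('r \<times> 'v \<Rightarrow>\<^sub>0 int) set" where
  "tensor_kernel R B h act V = generate (tensor_free R V) (tensor_rels R B h act V)"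

definition induced_module ::
    "'r ring \<Rightarrow> 'b set \<Rightarrow> ('b \<Rightarrow> 'r) \<Rightarrow> ('b \<Rightarrow> 'v \<Rightarrow> 'v) \<Rightarrow> (complex, 'v) module
      \<Rightarrow> ('r, ('r \<times> 'v \<Rightarrow>\<^sub>0 int) set) module" where
  "induced_module R B h act V =
    (let F = tensor_free R V; K = tensor_kernel R B h act V in
     \<lparr>carrier = carrier (F Mod K), monoid.mult = undefined, one = undefined,
      ring.zero = \<one>\<^bsub>F Mod K\<^esub>, add = (\<otimes>\<^bsub>F Mod K\<^esub>),
      smult = (\<lambda>r C. \<Union>f\<in>C. K #>\<^bsub>F\<^esub> frag_extend (\<lambda>(r', v). frag_of (r \<otimes>\<^bsub>R\<^esub> r', v)) f)\<rparr>)"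

definition pure_tensor ::
    "'r ring \<Rightarrow> 'b set \<Rightarrow> ('b \<Rightarrow> 'r) \<Rightarrow> ('b \<Rightarrow> 'v \<Rightarrow> 'v) \<Rightarrow> (complex, 'v) module
      \<Rightarrow> 'r \<Rightarrow> 'v \<Rightarrow> ('r \<times> 'v \<Rightarrow>\<^sub>0 int) set" where
  "pure_tensor R B h act V r v = tensor_kernel R B h act V #>\<^bsub>tensor_free R V\<^esub> frag_of (r, v)"


section \<open>Standard modules\<close>

text \<open>
  The smash product of the free algebra on the \<open>y\<^sub>i\<close> with the symmetric group. It acts on
  \<open>V\<^sub>\<mu>\<close>, and maps to the Cherednik algebra, through its quotient
  \<open>\<complex>[y\<^sub>1, \<dots>, y\<^sub>n] \<rtimes> S\<^sub>n\<close>, so tensoring over it or over that quotient is the same.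
\<close>

definition y_subalgebra :: "nat \<Rightarrow> smash set" where
  "y_subalgebra n = {b. Poly_Mapping.keys b \<subseteq> {SM w g | w g. set w \<subseteq> Y ` {1..n} \<and> g permutes {1..n}}}"

definition y_trivial_act :: "smash \<Rightarrow> smash \<Rightarrow> smash" where
  "y_trivial_act b v =
     (\<Sum>k\<in>Poly_Mapping.keys b. case k of SM w g \<Rightarrow> if w = [] then scal (Poly_Mapping.lookup b k) * perm_elt g * v else 0)"

type_synonym std_elt = "(smash set \<times> smash \<Rightarrow>\<^sub>0 int) set"

definition Delta :: "nat \<Rightarrow> complex \<Rightarrow> nat list \<Rightarrow> (smash set, std_elt) module" where
  "Delta n c \<mu> =
     induced_module (cherednik n c) (y_subalgebra n) (cls n c) y_trivial_act (irrep n \<mu>)"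

definition iota :: "nat \<Rightarrow> complex \<Rightarrow> nat list \<Rightarrow> smash \<Rightarrow> std_elt" where
  "iota n c \<mu> v =
     pure_tensor (cherednik n c) (y_subalgebra n) (cls n c) y_trivial_act (irrep n \<mu>)
       \<one>\<^bsub>cherednik n c\<^esub> v"

definition act :: "nat \<Rightarrow> complex \<Rightarrow> nat list \<Rightarrow> smash \<Rightarrow> std_elt \<Rightarrow> std_elt" where
  "act n c \<mu> a x = cls n c a \<odot>\<^bsub>Delta n c \<mu>\<^esub> x"

definition Hom_space ::
    "nat \<Rightarrow> complex \<Rightarrow> nat list \<Rightarrow> nat list \<Rightarrow> (complex, std_elt \<Rightarrow> std_elt) module" where
  "Hom_space n c \<nu> \<mu> =
    (let M = Delta n c \<nu>; N = Delta n c \<mu> in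
     \<lparr>carrier = LinearCombinations.module_hom (cherednik n c) M N \<inter> extensional (carrier M),
      monoid.mult = undefined, one = undefined,
      ring.zero = (\<lambda>x\<in>carrier M. \<zero>\<^bsub>N\<^esub>),
      add = (\<lambda>f g. \<lambda>x\<in>carrier M. f x \<oplus>\<^bsub>N\<^esub> g x),
      smult = (\<lambda>z f. \<lambda>x\<in>carrier M. act n c \<mu> (scal z) (f x))\<rparr>)"


section \<open>Eigenvectors\<close>

definition sort_perm :: "nat \<Rightarrow> (nat \<Rightarrow> nat) \<Rightarrow> nat \<Rightarrow> nat" where
  "sort_perm n a i =
     (if i \<in> {1..n}
      then card {j \<in> {1..n}. a j < a i} + card {j \<in> {1..n}. j \<le> i \<and> a j = a i}
      else i)"

definition x_monomial :: "nat \<Rightarrow> (nat \<Rightarrow> nat) \<Rightarrow> smash" where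
  "x_monomial n a =
     Poly_Mapping.single (SM (concat (map (\<lambda>i. replicate (a i) (X i)) [1..<Suc n])) id) 1"

definition exponents :: "nat \<Rightarrow> (nat \<Rightarrow> nat) set" where
  "exponents n = {a. \<forall>i. i \<notin> {1..n} \<longrightarrow> a i = 0}"

definition e_vec :: "nat \<Rightarrow> nat \<Rightarrow> nat" where
  "e_vec j = (\<lambda>i. if i = j then 1 else 0)"

definition monomial_vec ::
    "nat \<Rightarrow> complex \<Rightarrow> nat list \<Rightarrow> (nat list list \<Rightarrow> smash) \<Rightarrow> (nat \<Rightarrow> nat) \<Rightarrow> nat list list \<Rightarrow> std_elt" where
  "monomial_vec n c \<mu> v a T =
     act n c \<mu> (x_monomial n a * perm_elt (inv_into UNIV (sort_perm n a))) (iota n c \<mu> (v T))"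

definition weight :: "nat \<Rightarrow> complex \<Rightarrow> (nat \<Rightarrow> nat) \<Rightarrow> nat list list \<Rightarrow> nat \<Rightarrow> complex" where
  "weight n c a T i = of_nat (a i) - of_int (box_content T (sort_perm n a i)) * c"

definition has_coeff_one ::
    "nat \<Rightarrow> complex \<Rightarrow> nat list \<Rightarrow> (nat list list \<Rightarrow> smash) \<Rightarrow> (nat \<Rightarrow> nat) \<Rightarrow> nat list list
      \<Rightarrow> std_elt \<Rightarrow> bool" where
  "has_coeff_one n c \<mu> v a T w \<longleftrightarrow>
     (\<exists>F f. finite F \<and> F \<subseteq> exponents n \<times> std_tableaux \<mu> \<and> (a, T) \<in> F \<and> f (a, T) = 1 \<and>
        w = finsum (Delta n c \<mu>) (\<lambda>(b, S). act n c \<mu> (scal (f (b, S))) (monomial_vec n c \<mu> v b S)) F)"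

text \<open>The vector \<open>v(a, T)\<close>; here \<open>v\<close> is the family of the \<open>v\<^sub>T\<close>.\<close>

definition eigenvec ::
    "nat \<Rightarrow> complex \<Rightarrow> nat list \<Rightarrow> (nat list list \<Rightarrow> smash) \<Rightarrow> (nat \<Rightarrow> nat) \<Rightarrow> nat list list \<Rightarrow> std_elt" where
  "eigenvec n c \<mu> v a T =
     (THE w. w \<in> carrier (Delta n c \<mu>)
        \<and> (\<forall>i\<in>{1..n}. act n c \<mu> (u_elt c i) w = act n c \<mu> (scal (weight n c a T i)) w)
        \<and> has_coeff_one n c \<mu> v a T w)"


section \<open>Hooks\<close>

definition hook :: "nat \<Rightarrow> nat \<Rightarrow> nat list" where
  "hook n l = (n - l) # replicate l 1"

definition hook_tableau :: "nat \<Rightarrow> nat list \<Rightarrow> nat list list" where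
  "hook_tableau n is = (1 # filter (\<lambda>k. k \<notin> set is) [2..<Suc n]) # map (\<lambda>i. [i]) is"

definition legs :: "nat \<Rightarrow> nat \<Rightarrow> nat list set" where
  "legs n l = {is. length is = l \<and> sorted_wrt (<) is \<and> set is \<subseteq> {2..n}}"

text \<open>
  The normalized basis \<open>v\<^sub>T\<close> of \<open>V\<^sub>\<mu>\<close> for a hook \<open>\<mu>\<close>, the elements \<open>u\<^sub>i\<close> and \<open>s\<^sub>j\<close> acting inside
  the standard module. On \<open>v\<^sub>T\<close> the operator \<open>u\<^sub>j - u\<^bsub>j+1\<^esub>\<close> is the scalar
  \<open>- ct\<^sub>T(j) c + ct\<^sub>T(j+1) c\<close>, which is inverted in \<open>\<sigma>\<^sub>j v\<^sub>T\<close>.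
\<close>

definition hook_basis :: "nat \<Rightarrow> complex \<Rightarrow> nat \<Rightarrow> (nat list list \<Rightarrow> smash) \<Rightarrow> bool" where
  "hook_basis n c l v \<longleftrightarrow>
    (let \<mu> = hook n l; ev = (\<lambda>T i. - of_int (box_content T i) * c) in
     inj_on v (std_tableaux \<mu>)
   \<and> vectorspace.basis class_ring (irrep n \<mu>) (v ` std_tableaux \<mu>)
   \<and> (\<forall>T\<in>std_tableaux \<mu>. \<forall>i\<in>{1..n}.
        act n c \<mu> (u_elt c i) (iota n c \<mu> (v T)) = act n c \<mu> (scal (ev T i)) (iota n c \<mu> (v T)))
   \<and> (\<forall>T\<in>std_tableaux \<mu>. \<forall>j\<in>{2..<n}. j \<in> column T 0 \<and> Suc j \<notin> column T 0 \<longrightarrow>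
        iota n c \<mu> (v (map (map (transpose j (Suc j))) T)) =
        act n c \<mu> (transp j (Suc j)) (iota n c \<mu> (v T))
          \<ominus>\<^bsub>Delta n c \<mu>\<^esub> act n c \<mu> (scal (c / (ev T j - ev T (Suc j)))) (iota n c \<mu> (v T))))"

end

theory Submission
  imports Defs
begin

text \<open>
  Through Dunkl operators \<open>\<Delta>\<^sub>c(\<mu>)\<close> becomes the space of polynomials with values in \<open>V\<^sub>\<mu>\<close>, on which the
  \<open>u\<^sub>i\<close> are triangular. For a hook the contents are \<open>n\<close> consecutive integers, so coprimality of \<open>m\<close> and \<open>n\<close>
  makes the joint spectrum simple. If \<open>L\<close> is the leg of a tableau of shape \<open>\<mu>\<^sub>\<ell>\<close> and \<open>p = max L\<close>, then
  \<open>w\<^sub>L = v(m e\<^sub>p, L - {p})\<close> in \<open>\<Delta>\<^sub>c(\<mu>\<^bsub>\<ell>-1\<^esub>)\<close> has the same eigenvalues as \<open>v\<^sub>L\<close>. Hence a homomorphism sends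
  \<open>v\<^sub>L\<close> to a multiple of \<open>w\<^sub>L\<close>, and the intertwiners \<open>\<sigma>\<^sub>j\<close> force a common scalar. Conversely,
  \<open>v\<^sub>L \<mapsto> w\<^sub>L\<close> commutes with each \<open>s\<^sub>j\<close>: either \<open>\<sigma>\<^sub>j\<close> permutes the \<open>w\<^sub>L\<close> up to scalars, as top coefficients
  show, or \<open>s\<^sub>j\<close> turns the eigenvalues of \<open>w\<^sub>L\<close> into ones outside the spectrum, or \<open>p = j + 1\<close> and
  \<open>w\<^sub>L = (s\<^sub>j - 1) v(m e\<^sub>j, L - {p})\<close>. Finally \<open>u\<^sub>1 w\<^sub>L = 0\<close> gives
  \<open>y\<^sub>1 w\<^sub>L = 0\<close>, and by equivariance every \<open>y\<^sub>i\<close> annihilates the span of the \<open>w\<^sub>L\<close>.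
\<close>

section \<open>Finitely supported functions and additive maps\<close>

text \<open>The exponent \<open>m e_p\<close> has a simple origin. Sorting it moves \<open>p\<close>
  to place \<open>n\<close>, and in the tableau of the smaller hook with leg \<open>L - {p}\<close>
  the entry \<open>n\<close> ends the arm, with content \<open>n - l\<close>. As
  \<open>m = c n\<close>, the eigenvalue there is \<open>m - (n - l) c = l c\<close>, that of the
  foot of the leg of the larger hook, whose content is \<open>-l\<close>. The obstacle is that
  \<open>Delta\<close> is a quotient of a free abelian group and \<open>eigenvec\<close> a definite
  description, so neither a basis nor an eigenvector is given. The Dunkl operators satisfy the
  relations, which yields a map from \<open>Delta\<close> to polynomials, and it is injective
  because monomials in the \<open>x_i\<close> span. An eigenvector arises by applying to a leading
  term a product of factors \<open>u_i - \<kappa>\<close> that annihilates the finitely many lower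
  exponents and rescales the leading coefficient by a nonzero number. The normalization describes
  \<open>s_j\<close> only where \<open>j\<close> is in the leg and \<open>j + 1\<close> in the arm.
  When both are in one row or column, the action on \<open>v_L\<close> is recovered from the
  spectrum, just as for \<open>w_L\<close>.\<close>

lemma poly_mapping_decomp:
  "f = (\<Sum>k\<in>Poly_Mapping.keys f. Poly_Mapping.single k (Poly_Mapping.lookup f k))"
  by (rule poly_mapping_eqI)
    (simp add: lookup_sum lookup_single when_def sum.delta' in_keys_iff)

text \<open>The single-term case covers only the terms of \<open>f\<close> itself, so that
  restrictions on the keys of \<open>f\<close> stay available in an induction over its
  monomials.\<close>

lemma poly_mapping_sum_induct:
  fixes f :: "'a \<Rightarrow>\<^sub>0 'b::comm_monoid_add"
  assumes "P 0"
    and "\<And>k. k \<in> Poly_Mapping.keys f \<Longrightarrow> P (Poly_Mapping.single k (Poly_Mapping.lookup f k))"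
    and "\<And>g h. P g \<Longrightarrow> P h \<Longrightarrow> P (g + h)"
  shows "P f"
proof -
  have "P (\<Sum>k\<in>A. Poly_Mapping.single k (Poly_Mapping.lookup f k))"
    if "finite A" "A \<subseteq> Poly_Mapping.keys f" for A
    using that by (induction A) (auto intro: assms)
  from this[of "Poly_Mapping.keys f"] show ?thesis
    using poly_mapping_decomp[of f] by simp
qed

lemma additive_poly_mapping_eqI:
  fixes f :: "'a \<Rightarrow>\<^sub>0 'b::ab_group_add"
  assumes "additive h" "additive k"
    and "\<And>a. a \<in> Poly_Mapping.keys f \<Longrightarrow>
      h (Poly_Mapping.single a (Poly_Mapping.lookup f a)) = k (Poly_Mapping.single a (Poly_Mapping.lookup f a))"
  shows "h f = k f"
  by (rule poly_mapping_sum_induct[where f = f])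
    (use assms in \<open>auto simp: additive.zero additive.add\<close>)

lemma additive_id: "additive (\<lambda>x. x)"
  by unfold_locales simp

lemma additive_const_zero: "additive (\<lambda>x. 0 :: 'a::ab_group_add)"
  by unfold_locales simp

lemma additive_compose: "additive f \<Longrightarrow> additive g \<Longrightarrow> additive (\<lambda>x. f (g x))"
  by (simp add: additive_def)

lemma additive_plus: "additive f \<Longrightarrow> additive g \<Longrightarrow> additive (\<lambda>x. f x + g x)"
  by (simp add: additive_def algebra_simps)

lemma additive_minus: "additive f \<Longrightarrow> additive g \<Longrightarrow> additive (\<lambda>x. f x - g x)"
  by (simp add: additive_def algebra_simps)

lemma additive_uminus: "additive f \<Longrightarrow> additive (\<lambda>x. - f x)"
  by (simp add: additive_def algebra_simps)

lemma additive_sum: "(\<And>i. i \<in> A \<Longrightarrow> additive (f i)) \<Longrightarrow> additive (\<lambda>x. \<Sum>i\<in>A. f i x)"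
  by (simp add: additive_def sum.distrib)

lemma additive_mult: "additive (\<lambda>x :: 'a::ring. a * x)"
  by unfold_locales (simp add: algebra_simps)

lemma additive_mult_right: "additive (\<lambda>x :: 'a::ring. x * a)"
  by unfold_locales (simp add: algebra_simps)

lemma additive_single: "additive (Poly_Mapping.single a)"
  by unfold_locales (simp add: single_add)

lemmas additive_intros = additive_id additive_const_zero additive_plus additive_minus
  additive_uminus additive_sum

text \<open>Extension of a map on terms by additivity. The sum runs over the keys only; it is
  additive in \<open>f\<close> as soon as each \<open>F a\<close> is additive, since then
  \<open>F a 0 = 0\<close>.\<close>

definition lin :: "('a \<Rightarrow> 'b \<Rightarrow> 'c) \<Rightarrow> ('a \<Rightarrow>\<^sub>0 'b::zero) \<Rightarrow> 'c::comm_monoid_add" where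
  "lin F f = (\<Sum>a\<in>Poly_Mapping.keys f. F a (Poly_Mapping.lookup f a))"

lemma additive_lin:
  assumes "\<And>a. additive (F a)"
  shows "additive (lin F)"
proof
  fix f g :: "'a \<Rightarrow>\<^sub>0 'b"
  let ?U = "Poly_Mapping.keys f \<union> Poly_Mapping.keys g"
  have *: "lin F h = (\<Sum>a\<in>?U. F a (Poly_Mapping.lookup h a))" if "Poly_Mapping.keys h \<subseteq> ?U" for h
    unfolding lin_def using that
    by (intro sum.mono_neutral_left) (auto simp: in_keys_iff additive.zero[OF assms])
  show "lin F (f + g) = lin F f + lin F g"
    by (subst (1 2 3) *)
      (use keys_add[of f g] in \<open>auto simp: lookup_add additive.add[OF assms] sum.distrib\<close>)
qed

lemma lin_single:
  assumes "additive (F a)"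
  shows "lin F (Poly_Mapping.single a v) = F a v"
  by (cases "v = 0") (simp_all add: lin_def additive.zero[OF assms])

section \<open>Dunkl operators on vector-valued polynomials\<close>

lemma scal_0 [simp]: "scal 0 = 0" by (simp add: scal_def)
lemma scal_1 [simp]: "scal 1 = 1" by (simp add: scal_def)
lemma scal_mult: "scal (z * w) = scal z * scal w" by (simp add: scal_def mult_single)
lemma scal_add: "scal (z + w) = scal z + scal w" by (simp add: scal_def single_add)
lemma scal_minus: "scal (- z) = - scal z" by (simp add: scal_def single_uminus)
lemma scal_diff: "scal (z - w) = scal z - scal w" by (simp add: scal_def single_diff)

text \<open>Scalars are supported at the neutral element of \<open>smash_mon\<close> and therefore
  central.\<close>

lemma scal_commute: "a * scal z = scal z * a"
  by (rule additive_poly_mapping_eqI[OF additive_mult_right additive_mult])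
    (simp add: scal_def mult_single mult.commute)

lemma scal_left_commute: "a * (scal z * b) = scal z * (a * b)"
  by (metis mult.assoc scal_commute)

lemma perm_elt_scal: "perm_elt g * (scal z * b) = scal z * (perm_elt g * b)"
  by (rule scal_left_commute)

lemma transp_scal: "transp i j * (scal z * b) = scal z * (transp i j * b)"
  by (rule scal_left_commute)

lemma scal_scal: "scal z * (scal w * b) = scal (z * w) * b"
  by (simp add: scal_mult mult.assoc)

lemma perm_elt_mult: "perm_elt g * perm_elt h = perm_elt (g \<circ> h)"
  by (simp add: perm_elt_def mult_single)

lemma perm_elt_id [simp]: "perm_elt id = 1"
  by (simp add: perm_elt_def zero_smash_mon_def[symmetric])

text \<open>Elements of \<open>pol\<close> stand for polynomials in the \<open>x\<^sub>i\<close> with coefficients in a space on which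
  the group acts, a monomial being given by its exponents. All spaces that occur lie in the group
  algebra, so coefficients are taken in \<^typ>\<open>smash\<close>.\<close>

type_synonym pol = "(nat \<Rightarrow> nat) \<Rightarrow>\<^sub>0 smash"

abbreviation mon :: "(nat \<Rightarrow> nat) \<Rightarrow> smash \<Rightarrow> pol" where
  "mon \<equiv> Poly_Mapping.single"

abbreviation coef :: "pol \<Rightarrow> (nat \<Rightarrow> nat) \<Rightarrow> smash" where
  "coef \<equiv> Poly_Mapping.lookup"

definition sop :: "complex \<Rightarrow> pol \<Rightarrow> pol" where
  "sop z = lin (\<lambda>a v. mon a (scal z * v))"

definition xop :: "nat \<Rightarrow> pol \<Rightarrow> pol" where
  "xop k = lin (\<lambda>a v. mon (a(k := Suc (a k))) v)"

text \<open>\<open>g\<close> sends \<open>x_i\<close> to \<open>x_(g i)\<close>, so exponents are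
  pulled back along the inverse of \<open>g\<close>.\<close>

definition exp_act :: "(nat \<Rightarrow> nat) \<Rightarrow> (nat \<Rightarrow> nat) \<Rightarrow> nat \<Rightarrow> nat" where
  "exp_act g a = a \<circ> inv_into UNIV g"

definition pop :: "(nat \<Rightarrow> nat) \<Rightarrow> pol \<Rightarrow> pol" where
  "pop g = lin (\<lambda>a v. mon (exp_act g a) (perm_elt g * v))"

text \<open>The divided difference \<open>(x\<^sup>a - s\<^sub>i\<^sub>j x\<^sup>a) / (x\<^sub>i - x\<^sub>j)\<close> with coefficient \<open>v\<close>; by truncated
  subtraction at most one of the two sums is nonempty.\<close>

definition ddiff :: "nat \<Rightarrow> nat \<Rightarrow> (nat \<Rightarrow> nat) \<Rightarrow> smash \<Rightarrow> pol" where
  "ddiff i j a v =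
     (\<Sum>t<a i - a j. mon (a(i := a i - 1 - t, j := a j + t)) v)
     - (\<Sum>t<a j - a i. mon (a(i := a j - 1 - t, j := a i + t)) v)"

text \<open>The Dunkl operator: the derivative in \<open>x_i\<close>, minus \<open>c\<close> times
  the sum over \<open>j\<close> of \<open>(1 - s_ij) / (x_i - x_j)\<close> on the monomial combined
  with \<open>s_ij\<close> on the coefficient. The truncated exponent \<open>a i - 1\<close> does no
  harm at \<open>a i = 0\<close>, where the factor \<open>a i\<close> vanishes.\<close>

definition ymon :: "nat \<Rightarrow> complex \<Rightarrow> nat \<Rightarrow> (nat \<Rightarrow> nat) \<Rightarrow> smash \<Rightarrow> pol" where
  "ymon n c i a v = mon (a(i := a i - 1)) (scal (of_nat (a i)) * v)
     - sop c (\<Sum>j\<in>{1..n} - {i}. ddiff i j a (transp i j * v))"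

definition yop :: "nat \<Rightarrow> complex \<Rightarrow> nat \<Rightarrow> pol \<Rightarrow> pol" where
  "yop n c i = lin (ymon n c i)"

section \<open>Additivity of the operators and their values on monomials\<close>

lemma additive_mon_compose: "additive h \<Longrightarrow> additive (\<lambda>v. mon a (h v))"
  using additive_compose[OF additive_single] .

lemma additive_sop: "additive (sop z)"
  unfolding sop_def by (intro additive_lin additive_mon_compose additive_mult)

lemma additive_xop: "additive (xop k)"
  unfolding xop_def by (intro additive_lin additive_single)

lemma additive_pop: "additive (pop g)"
  unfolding pop_def by (intro additive_lin additive_mon_compose additive_mult)

lemma additive_ddiff: "additive (ddiff i j a)"
  unfolding ddiff_def by (intro additive_intros additive_single)

lemma additive_ymon: "additive (ymon n c i a)"
  unfolding ymon_def
  by (intro additive_minus additive_mon_compose additive_mult additive_compose[OF additive_sop]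
      additive_sum additive_compose[OF additive_ddiff])

lemma additive_yop: "additive (yop n c i)"
  unfolding yop_def by (intro additive_lin additive_ymon)

lemma sop_mon [simp]: "sop z (mon a v) = mon a (scal z * v)"
  unfolding sop_def by (rule lin_single) (intro additive_mon_compose additive_mult)

lemma xop_mon [simp]: "xop k (mon a v) = mon (a(k := Suc (a k))) v"
  unfolding xop_def by (rule lin_single) (rule additive_single)

lemma pop_mon [simp]: "pop g (mon a v) = mon (exp_act g a) (perm_elt g * v)"
  unfolding pop_def by (rule lin_single) (intro additive_mon_compose additive_mult)

lemma yop_mon [simp]: "yop n c i (mon a v) = ymon n c i a v"
  unfolding yop_def by (rule lin_single) (rule additive_ymon)

lemmas sop_simps = additive.zero[OF additive_sop] additive.add[OF additive_sop]
  additive.diff[OF additive_sop] additive.minus[OF additive_sop]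
lemmas sop_sum = additive.sum[OF additive_sop]
lemmas xop_simps = additive.zero[OF additive_xop] additive.add[OF additive_xop]
  additive.diff[OF additive_xop] additive.minus[OF additive_xop]
lemmas xop_sum = additive.sum[OF additive_xop]
lemmas pop_simps = additive.zero[OF additive_pop] additive.add[OF additive_pop]
  additive.diff[OF additive_pop] additive.minus[OF additive_pop]
lemmas pop_sum = additive.sum[OF additive_pop]
lemmas yop_simps = additive.zero[OF additive_yop] additive.add[OF additive_yop]
  additive.diff[OF additive_yop] additive.minus[OF additive_yop]
lemmas yop_sum = additive.sum[OF additive_yop]

lemmas op_simps = sop_simps xop_simps pop_simps yop_simps
lemmas op_sum = sop_sum xop_sum pop_sum yop_sum

lemma coef_sop: "coef (sop z f) a = scal z * coef f a"
  by (rule additive_poly_mapping_eqI[where h = "\<lambda>f. coef (sop z f) a" and k = "\<lambda>f. scal z * coef f a"])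
    (auto simp: additive_def sop_simps lookup_add algebra_simps lookup_single when_def)

lemma sop_sop: "sop z (sop w f) = sop (z * w) f"
  by (rule poly_mapping_eqI) (simp add: coef_sop scal_mult mult.assoc)

lemma sop_1 [simp]: "sop 1 f = f"
  by (rule poly_mapping_eqI) (simp add: coef_sop)

lemma sop_0 [simp]: "sop 0 f = 0"
  by (rule poly_mapping_eqI) (simp add: coef_sop)

lemma sop_plus: "sop (z + w) f = sop z f + sop w f"
  by (rule poly_mapping_eqI) (simp add: coef_sop scal_add lookup_add algebra_simps)

lemma sop_minus: "sop (z - w) f = sop z f - sop w f"
  by (rule poly_mapping_eqI) (simp add: coef_sop scal_diff lookup_minus algebra_simps)

lemma sop_uminus: "sop (- z) f = - sop z f"
  by (rule poly_mapping_eqI) (simp add: coef_sop scal_minus)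

lemma xop_sop: "xop k (sop z f) = sop z (xop k f)"
  by (rule additive_poly_mapping_eqI[where h = "\<lambda>f. xop k (sop z f)" and k = "\<lambda>f. sop z (xop k f)"]) (simp_all add: additive_def op_simps)

lemma pop_sop: "pop g (sop z f) = sop z (pop g f)"
  by (rule additive_poly_mapping_eqI[where h = "\<lambda>f. pop g (sop z f)" and k = "\<lambda>f. sop z (pop g f)"])
    (simp_all add: additive_def op_simps perm_elt_scal)

lemma ddiff_scal: "ddiff i j a (scal z * v) = sop z (ddiff i j a v)"
  by (simp add: ddiff_def op_simps op_sum)

lemma ymon_scal: "ymon n c i a (scal z * v) = sop z (ymon n c i a v)"
  by (simp add: ymon_def op_simps transp_scal scal_scal ddiff_scal sop_sop sop_sum mult.commute)

lemma yop_sop: "yop n c i (sop z f) = sop z (yop n c i f)"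
  by (rule additive_poly_mapping_eqI[where h = "\<lambda>f. yop n c i (sop z f)" and k = "\<lambda>f. sop z (yop n c i f)"])
    (simp_all add: additive_def op_simps ymon_scal)

lemma xop_commute: "xop i (xop j f) = xop j (xop i f)"
proof (cases "i = j")
  case False
  then have "xop i (xop j (mon a v)) = xop j (xop i (mon a v))" for a v
    by (simp add: fun_upd_twist[OF False])
  then show ?thesis
    by (rule additive_poly_mapping_eqI[OF additive_compose additive_compose, OF additive_xop additive_xop additive_xop additive_xop])
qed simp

lemma exp_act_upd: "bij g \<Longrightarrow> exp_act g (a(i := x)) = (exp_act g a)(g i := x)"
  by (auto simp: exp_act_def fun_eq_iff bij_is_inj bij_is_surj surj_f_inv_f)

lemma exp_act_apply: "bij g \<Longrightarrow> exp_act g a (g i) = a i"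
  by (simp add: exp_act_def bij_is_inj)

lemma exp_act_comp: "bij g \<Longrightarrow> bij h \<Longrightarrow> exp_act g (exp_act h a) = exp_act (g \<circ> h) a"
  by (simp add: exp_act_def o_inv_distrib o_assoc)

lemma exp_act_transpose: "exp_act (transpose i j) a = a \<circ> transpose i j"
  by (simp add: exp_act_def)

lemma pop_pop: "bij g \<Longrightarrow> bij h \<Longrightarrow> pop g (pop h f) = pop (g \<circ> h) f"
  by (rule additive_poly_mapping_eqI[where h = "\<lambda>f. pop g (pop h f)" and k = "\<lambda>f. pop (g \<circ> h) f"])
    (simp_all add: additive_def op_simps exp_act_comp mult.assoc[symmetric] perm_elt_mult)

lemma pop_id [simp]: "pop id f = f"
  by (rule additive_poly_mapping_eqI[OF additive_pop additive_id]) (simp add: exp_act_def inv_id)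

lemma pop_xop: "bij g \<Longrightarrow> pop g (xop i f) = xop (g i) (pop g f)"
  by (rule additive_poly_mapping_eqI[where h = "\<lambda>f. pop g (xop i f)" and k = "\<lambda>f. xop (g i) (pop g f)"])
    (simp_all add: additive_def op_simps exp_act_upd exp_act_apply)

lemma comp_transpose_upd: "a \<circ> transpose i j = a(i := a j, j := a i)"
  by (auto simp: fun_eq_iff transpose_def)

text \<open>Leibniz rule: with \<open>s = s_ij\<close>, divide
  \<open>x_i f - s (x_i f) = x_i (f - s f) + (x_i - x_j) s f\<close> by
  \<open>x_i - x_j\<close>.\<close>

lemma ddiff_upd_first:
  assumes "i \<noteq> j"
  shows "ddiff i j (a(i := Suc (a i))) v = xop i (ddiff i j a v) + mon (a \<circ> transpose i j) v"
proof (cases "a j \<le> a i")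
  case True
  have "ddiff i j (a(i := Suc (a i))) v =
      (\<Sum>t<Suc (a i - a j). mon (a(i := a i - t, j := a j + t)) v)"
    using True assms by (simp add: ddiff_def Suc_diff_le fun_upd_twist)
  also have "\<dots> = (\<Sum>t<a i - a j. mon (a(i := a i - t, j := a j + t)) v) + mon (a \<circ> transpose i j) v"
    using True by (simp add: comp_transpose_upd)
  also have "(\<Sum>t<a i - a j. mon (a(i := a i - t, j := a j + t)) v) = xop i (ddiff i j a v)"
  proof -
    have "Suc (a i - 1 - t) = a i - t" if "t < a i - a j" for t
      using that by auto
    then show ?thesis
      using True assms by (simp add: ddiff_def op_simps op_sum fun_upd_twist)
  qed
  finally show ?thesis .
next
  case False
  \<comment> \<open>Here the second sum of \<open>ddiff\<close> is the nonempty one. Multiplication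
    by \<open>x_i\<close> turns its first term into the swapped monomial, and the other
    \<open>d\<close> terms are those belonging to the raised exponent.\<close>
  define d where "d = a j - a i - 1"
  have d: "a j - a i = Suc d" "a j - Suc (a i) = d" "a i - a j = 0" "Suc (a i) - a j = 0"
    using False by (auto simp: d_def)
  have "xop i (ddiff i j a v) =
      - (\<Sum>t<Suc d. mon (a(i := Suc (a j - 1 - t), j := a i + t)) v)"
    using assms by (simp add: ddiff_def d op_simps op_sum fun_upd_twist del: sum.lessThan_Suc)
  also have "\<dots> = - mon (a(i := a j, j := a i)) v - (\<Sum>t<d. mon (a(i := Suc (a j - 1 - Suc t), j := a i + Suc t)) v)"
    using False by (simp add: sum.lessThan_Suc_shift del: sum.lessThan_Suc)
  also have "(\<Sum>t<d. mon (a(i := Suc (a j - 1 - Suc t), j := a i + Suc t)) v)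
     = - ddiff i j (a(i := Suc (a i))) v"
  proof -
    have "Suc (a j - 1 - Suc t) = a j - 1 - t" if "t < d" for t
      using that False by (auto simp: d_def)
    then show ?thesis using assms by (simp add: ddiff_def d)
  qed
  finally have *: "xop i (ddiff i j a v) =
    - mon (a(i := a j, j := a i)) v - - ddiff i j (a(i := Suc (a i))) v" .
  have "d = x + y" if "x = - y - - d" for d x y :: pol using that by simp
  from this[OF *] show ?thesis unfolding comp_transpose_upd .
qed

text \<open>Exchanging \<open>i\<close> and \<open>j\<close> keeps the numerator and negates the
  denominator; on the expanded sums it reverses the order of summation.\<close>

lemma ddiff_swap: "i \<noteq> j \<Longrightarrow> ddiff i j a v = - ddiff j i a v"
proof -
  assume ij: "i \<noteq> j"
  have rev: "(\<Sum>t<p - q. mon (a(i := p - 1 - t, j := q + t)) v) = (\<Sum>t<p - q. mon (a(j := p - 1 - t, i := q + t)) v)"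
    for p q :: nat
  proof (rule sum.reindex_bij_witness[where i = "\<lambda>t. p - q - 1 - t" and j = "\<lambda>t. p - q - 1 - t"])
    fix t assume t: "t \<in> {..<p - q}"
    then have "q + (p - q - 1 - t) = p - 1 - t" "p - 1 - (p - q - 1 - t) = q + t" by auto
    then show "mon (a(j := p - 1 - (p - q - 1 - t), i := q + (p - q - 1 - t))) v =
      mon (a(i := p - 1 - t, j := q + t)) v"
      using ij by (simp add: fun_upd_twist)
  qed auto
  show ?thesis unfolding ddiff_def rev by simp
qed

lemma ddiff_upd_second:
  assumes "i \<noteq> j"
  shows "ddiff i j (a(j := Suc (a j))) v = xop j (ddiff i j a v) - mon (a \<circ> transpose i j) v"
  using ddiff_upd_first[of j i a v] assms
  by (simp add: ddiff_swap[of i j] op_simps transpose_commute[of j i])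

lemma ddiff_upd_other:
  assumes "i \<noteq> j" "k \<noteq> i" "k \<noteq> j"
  shows "ddiff i j (a(k := Suc (a k))) v = xop k (ddiff i j a v)"
proof -
  have "a(k := z, i := x, j := y) = a(i := x, j := y, k := z)" for x y z
    using assms by (auto simp: fun_eq_iff)
  then show ?thesis using assms by (simp add: ddiff_def op_simps op_sum)
qed

section \<open>Equivariance and commutation relations of the Dunkl operators\<close>

lemma pop_ddiff:
  assumes "bij g"
  shows "pop g (ddiff i j a v) = ddiff (g i) (g j) (exp_act g a) (perm_elt g * v)"
  using assms by (simp add: ddiff_def op_simps op_sum exp_act_upd exp_act_apply)

lemma perm_elt_transp:
  assumes "bij g"
  shows "perm_elt g * transp i j = transp (g i) (g j) * perm_elt g"
  using assms by (simp add: transp_def perm_elt_mult transpose_comp_eq bij_is_inj)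

lemma pop_yop:
  assumes "g permutes {1..n}"
  shows "pop g (yop n c i f) = yop n c (g i) (pop g f)"
proof (rule additive_poly_mapping_eqI[where h = "\<lambda>f. pop g (yop n c i f)" and k = "\<lambda>f. yop n c (g i) (pop g f)"])
  have b: "bij g" using assms by (rule permutes_bij)
  fix a
  let ?v = "coef f a"
  have "(\<Sum>j\<in>{1..n} - {i}. ddiff (g i) (g j) (exp_act g a) (perm_elt g * (transp i j * ?v)))
    = (\<Sum>j\<in>{1..n} - {i}. ddiff (g i) (g j) (exp_act g a) (transp (g i) (g j) * (perm_elt g * ?v)))"
    by (simp add: mult.assoc[symmetric] perm_elt_transp[OF b])
  also have "\<dots> = (\<Sum>j\<in>{1..n} - {g i}. ddiff (g i) j (exp_act g a) (transp (g i) j * (perm_elt g * ?v)))"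
  proof (rule sum.reindex_bij_betw)
    have "bij_betw g ({1..n} - {i}) (g ` ({1..n} - {i}))"
      using b by (auto simp: bij_betw_def bij_is_inj intro: inj_on_subset)
    moreover have "g ` ({1..n} - {i}) = {1..n} - {g i}"
      using b permutes_image[OF assms] by (simp add: image_set_diff bij_is_inj)
    ultimately show "bij_betw g ({1..n} - {i}) ({1..n} - {g i})" by simp
  qed
  finally show "pop g (yop n c i (mon a ?v)) = yop n c (g i) (pop g (mon a ?v))"
    using b by (simp add: ymon_def op_simps pop_sum exp_act_upd exp_act_apply pop_sop pop_ddiff perm_elt_scal del: One_nat_def)
qed (simp_all add: additive_def op_simps)

text \<open>Of the divided differences in \<open>y_i\<close> only the one at \<open>j\<close> fails
  to commute with \<open>x_j\<close>. The Leibniz rule in the second variable leaves minus the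
  swapped monomial there, which the factor \<open>-c\<close> turns into
  \<open>c s_ij\<close>.\<close>

lemma yop_xop:
  assumes "i \<in> {1..n}" "j \<in> {1..n}" "i \<noteq> j"
  shows "yop n c i (xop j f) = xop j (yop n c i f) + sop c (pop (transpose i j) f)"
proof (rule additive_poly_mapping_eqI[where h = "\<lambda>f. yop n c i (xop j f)"
      and k = "\<lambda>f. xop j (yop n c i f) + sop c (pop (transpose i j) f)"])
  fix a
  let ?v = "coef f a"
  let ?A = "{1..n} - {i} - {j}"
  have A: "{1..n} - {i} = insert j ?A" "j \<notin> ?A" "finite ?A" using assms by auto
  have S: "sum F ({1..n} - {i}) = F j + sum F ?A" for F :: "nat \<Rightarrow> pol"
    by (subst A(1)) (rule sum.insert[OF A(3,2)])
  let ?a = "a(j := Suc (a j))"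
  have "(\<Sum>k\<in>?A. ddiff i k ?a (transp i k * ?v)) = (\<Sum>k\<in>?A. xop j (ddiff i k a (transp i k * ?v)))"
    using assms by (intro sum.cong refl ddiff_upd_other) auto
  then have S1: "(\<Sum>k\<in>{1..n} - {i}. ddiff i k ?a (transp i k * ?v)) =
      xop j (\<Sum>k\<in>{1..n} - {i}. ddiff i k a (transp i k * ?v)) - mon (a \<circ> transpose i j) (transp i j * ?v)"
    using assms by (simp add: S op_sum op_simps ddiff_upd_second del: One_nat_def)
  have "?a(i := a i - 1) = a(i := a i - 1, j := Suc (a j))"
    using assms by (simp add: fun_upd_twist)
  then show "yop n c i (xop j (mon a ?v)) = xop j (yop n c i (mon a ?v)) + sop c (pop (transpose i j) (mon a ?v))"
    using assms by (simp add: ymon_def S1 op_simps xop_sop exp_act_transpose transp_def[symmetric] del: One_nat_def)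
qed (simp_all add: additive_def op_simps sum.distrib algebra_simps)

text \<open>The derivative contributes \<open>f\<close>, and every divided difference contributes
  \<open>s_ij f\<close> by the Leibniz rule in the first variable.\<close>

lemma yop_xop_same:
  assumes "i \<in> {1..n}"
  shows "yop n c i (xop i f) = xop i (yop n c i f) + f - sop c (\<Sum>j\<in>{1..n}-{i}. pop (transpose i j) f)"
proof (rule additive_poly_mapping_eqI[where h = "\<lambda>f. yop n c i (xop i f)"
      and k = "\<lambda>f. xop i (yop n c i f) + f - sop c (\<Sum>j\<in>{1..n}-{i}. pop (transpose i j) f)"])
  fix a
  let ?v = "coef f a"
  have S1: "(\<Sum>j\<in>{1..n} - {i}. ddiff i j (a(i := Suc (a i))) (transp i j * ?v)) =
    xop i (\<Sum>j\<in>{1..n} - {i}. ddiff i j a (transp i j * ?v)) + (\<Sum>j\<in>{1..n} - {i}. pop (transpose i j) (mon a ?v))"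
    unfolding xop_sum sum.distrib[symmetric] pop_mon exp_act_transpose transp_def[symmetric]
    by (intro sum.cong refl ddiff_upd_first) auto
  have M: "mon a (scal (of_nat (Suc (a i))) * ?v) = xop i (mon (a(i := a i - 1)) (scal (of_nat (a i)) * ?v)) + mon a ?v"
  proof -
    have "mon a (scal (of_nat (Suc (a i))) * ?v) = mon a (scal (of_nat (a i)) * ?v) + mon a ?v"
      by (simp add: scal_add algebra_simps single_add)
    also have "mon a (scal (of_nat (a i)) * ?v) = xop i (mon (a(i := a i - 1)) (scal (of_nat (a i)) * ?v))"
      by (cases "a i") (simp_all add: op_simps fun_upd_idem)
    finally show ?thesis .
  qed
  show "yop n c i (xop i (mon a ?v)) = xop i (yop n c i (mon a ?v)) + mon a ?v
     - sop c (\<Sum>j\<in>{1..n}-{i}. pop (transpose i j) (mon a ?v))"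
    by (simp add: ymon_def M S1 op_simps xop_sop del: xop_mon pop_mon sop_mon One_nat_def of_nat_Suc, simp add: ymon_def M S1 op_simps xop_sop del: pop_mon sop_mon One_nat_def of_nat_Suc)
qed (simp_all add: additive_def op_simps sum.distrib algebra_simps)

lemma yop_mon_zero [simp]: "yop n c i (mon (\<lambda>_. 0) v) = 0"
  by (simp add: ymon_def ddiff_def op_simps)

text \<open>Induction on the degree; it reduces statements on monomials to constants and to
  multiplication by a single variable.\<close>

lemma exponents_induct [consumes 1, case_names zero Suc]:
  assumes a: "a \<in> exponents n"
    and z: "P (\<lambda>_. 0)"
    and s: "\<And>b k. b \<in> exponents n \<Longrightarrow> k \<in> {1..n} \<Longrightarrow> P b \<Longrightarrow> P (b(k := Suc (b k)))"
  shows "P a"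
  using a
proof (induction "\<Sum>i\<in>{1..n}. a i" arbitrary: a)
  case 0
  then have "a = (\<lambda>_. 0)" by (auto simp: exponents_def fun_eq_iff)
  then show ?case using z by simp
next
  case (Suc d)
  then obtain k where k: "k \<in> {1..n}" "a k \<noteq> 0" by (metis sum.neutral nat.distinct(1))
  define b where "b = a(k := a k - 1)"
  have "sum a {1..n} = a k + sum a ({1..n} - {k})" using k by (simp add: sum.remove)
  moreover have "sum b {1..n} = b k + sum b ({1..n} - {k})" using k by (simp add: sum.remove)
  moreover have "sum b ({1..n} - {k}) = sum a ({1..n} - {k})"
    by (intro sum.cong) (auto simp: b_def)
  ultimately have "d = sum b {1..n}" using Suc(2) k by (simp add: b_def)
  moreover have "b \<in> exponents n" using Suc.prems by (auto simp: b_def exponents_def)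
  ultimately have "P (b(k := Suc (b k)))" using Suc(1) s k by blast
  moreover have "b(k := Suc (b k)) = a" using k by (auto simp: b_def)
  ultimately show ?case by simp
qed

text \<open>By the Jacobi identity the commutator of two Dunkl operators commutes with every \<open>x\<^sub>k\<close>, and
  it annihilates the constants.\<close>

lemma yop_commute:
  assumes "i \<in> {1..n}" "j \<in> {1..n}" "Poly_Mapping.keys f \<subseteq> exponents n"
  shows "yop n c i (yop n c j f) = yop n c j (yop n c i f)"
proof (cases "i = j")
  case False
  define B where "B f = yop n c i (yop n c j f) - yop n c j (yop n c i f)" for f
  have addB: "additive B" by (simp add: additive_def B_def op_simps)
  have tr: "pop (transpose p q) (yop n c r f) = yop n c (transpose p q r) (pop (transpose p q) f)"
    if "p \<in> {1..n}" "q \<in> {1..n}" for p q r f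
    using that by (intro pop_yop permutes_swap_id)
  have B: "B (xop k f) = xop k (B f)" if k: "k \<in> {1..n}" for k f
  proof -
    \<comment> \<open>Stated for an ordered pair so that it serves both \<open>k = i\<close> and
      \<open>k = j\<close>. In the sums over \<open>t\<close> the term \<open>t = p\<close>
      interchanges \<open>y_p\<close> and \<open>y_q\<close>; the other transpositions fix
      \<open>p\<close> and commute with \<open>y_p\<close>.\<close>
    have same: "yop n c p (yop n c q (xop q f)) - yop n c q (yop n c p (xop q f))
       = xop q (yop n c p (yop n c q f) - yop n c q (yop n c p f))"
      if pq: "p \<in> {1..n}" "q \<in> {1..n}" "p \<noteq> q" for p q f
    proof -
      let ?S = "\<Sum>t\<in>{1..n}-{q}. pop (transpose q t) f"
      let ?S' = "\<Sum>t\<in>{1..n}-{q}. pop (transpose q t) (yop n c p f)"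
      let ?R = "\<Sum>t\<in>{1..n}-{q}-{p}. yop n c p (pop (transpose q t) f)"
      have A: "sum F ({1..n} - {q}) = F p + sum F ({1..n} - {q} - {p})" for F :: "nat \<Rightarrow> pol"
        using pq by (intro sum.remove) auto
      have e1: "yop n c p ?S = yop n c p (pop (transpose p q) f) + ?R"
        unfolding A op_simps yop_sum by (simp add: transpose_commute)
      have "pop (transpose q t) (yop n c p f) = yop n c p (pop (transpose q t) f)"
        if "t \<in> {1..n} - {q} - {p}" for t
        using that pq by (simp add: tr)
      moreover have "pop (transpose q p) (yop n c p f) = yop n c q (pop (transpose p q) f)"
        using pq by (simp add: tr transpose_commute)
      ultimately have e2: "?S' = yop n c q (pop (transpose p q) f) + ?R"
        unfolding A by simp
      have e3: "pop (transpose p q) (yop n c q f) = yop n c p (pop (transpose p q) f)"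
        using pq by (simp add: tr)
      show ?thesis using pq
        by (simp add: yop_xop yop_xop_same op_simps yop_sop e1 e2 e3 del: One_nat_def)
    qed
    consider "k = i" | "k = j" | "k \<noteq> i" "k \<noteq> j" by blast
    then show ?thesis
    proof cases
      case 1
      then show ?thesis using same[of j i f] assms False by (simp add: B_def op_simps algebra_simps)
    next
      case 2
      then show ?thesis using same[of i j f] assms False by (simp add: B_def)
    next
      case 3
      then show ?thesis using assms k False by (simp add: B_def yop_xop op_simps yop_sop tr)
    qed
  qed
  have "B (mon a v) = 0" if "a \<in> exponents n" for a v
    using that
  proof (induction rule: exponents_induct)
    case zero
    show ?case by (simp add: B_def op_simps del: yop_mon)
  next
    case (Suc b k)
    then show ?case using B[of k "mon b v"] by (simp add: op_simps fun_upd_def)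
  qed
  then have "B f = 0"
    using assms(3) by (intro poly_mapping_sum_induct[where P = "\<lambda>f. B f = 0" and f = f])
      (auto simp: additive.zero[OF addB] additive.add[OF addB])
  then show ?thesis by (simp add: B_def)
qed simp

section \<open>The polynomial representation\<close>

text \<open>Complex subspaces stable under left multiplication by permutations. The extreme case
  \<open>UNIV\<close> serves for statements that concern only the exponents.\<close>

definition sn_space :: "nat \<Rightarrow> smash set \<Rightarrow> bool" where
  "sn_space n V \<longleftrightarrow> 0 \<in> V \<and> (\<forall>v\<in>V. \<forall>w\<in>V. v + w \<in> V) \<and> (\<forall>z. \<forall>v\<in>V. scal z * v \<in> V)
     \<and> (\<forall>g v. g permutes {1..n} \<longrightarrow> v \<in> V \<longrightarrow> perm_elt g * v \<in> V)"

lemma sn_space_UNIV [simp]: "sn_space n UNIV"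
  by (simp add: sn_space_def)

text \<open>The condition on the keys confines exponents, which are functions on all of
  \<open>nat\<close>, to the variables \<open>x_1, ..., x_n\<close>.\<close>

definition pols :: "nat \<Rightarrow> smash set \<Rightarrow> pol set" where
  "pols n V = {f. Poly_Mapping.keys f \<subseteq> exponents n \<and> (\<forall>a. coef f a \<in> V)}"

lemma sn_spaceD:
  assumes "sn_space n V"
  shows "0 \<in> V" "v \<in> V \<Longrightarrow> w \<in> V \<Longrightarrow> v + w \<in> V" "v \<in> V \<Longrightarrow> scal z * v \<in> V"
    "g permutes {1..n} \<Longrightarrow> v \<in> V \<Longrightarrow> perm_elt g * v \<in> V"
    "v \<in> V \<Longrightarrow> - v \<in> V" "v \<in> V \<Longrightarrow> w \<in> V \<Longrightarrow> v - w \<in> V"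
proof -
  note * = assms[unfolded sn_space_def]
  show "0 \<in> V" "v \<in> V \<Longrightarrow> w \<in> V \<Longrightarrow> v + w \<in> V" "v \<in> V \<Longrightarrow> scal z * v \<in> V"
    "g permutes {1..n} \<Longrightarrow> v \<in> V \<Longrightarrow> perm_elt g * v \<in> V" using * by auto
  have m: "- v \<in> V" if "v \<in> V" for v
    using *[THEN conjunct2, THEN conjunct2, THEN conjunct1, rule_format, of v "-1"] that
    by (simp add: scal_minus)
  show "v \<in> V \<Longrightarrow> - v \<in> V" by (rule m)
  show "v \<in> V \<Longrightarrow> w \<in> V \<Longrightarrow> v - w \<in> V" using *[THEN conjunct2, THEN conjunct1] m by force
qed

lemma sn_space_sum:
  assumes "sn_space n V" "\<And>i. i \<in> A \<Longrightarrow> f i \<in> V"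
  shows "sum f A \<in> V"
  using assms(2) by (induction A rule: infinite_finite_induct) (auto intro: sn_spaceD[OF assms(1)])

lemma sn_space_transp:
  "sn_space n V \<Longrightarrow> i \<in> {1..n} \<Longrightarrow> j \<in> {1..n} \<Longrightarrow> v \<in> V \<Longrightarrow> transp i j * v \<in> V"
  unfolding transp_def by (rule sn_spaceD(4)[OF _ permutes_swap_id])

lemma pols_UNIV: "f \<in> pols n V \<Longrightarrow> f \<in> pols n UNIV"
  by (simp add: pols_def)

lemma coef_pols: "f \<in> pols n V \<Longrightarrow> coef f a \<in> V"
  by (simp add: pols_def)

lemma exp_act_exponents:
  assumes "g permutes {1..n}" "a \<in> exponents n"
  shows "exp_act g a \<in> exponents n"
  using assms(2) permutes_not_in[OF permutes_inv[OF assms(1)]]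
  by (auto simp: exponents_def exp_act_def)

context
  fixes n V
  assumes V: "sn_space n V"
begin

lemma pols_0: "0 \<in> pols n V"
  by (simp add: pols_def sn_spaceD[OF V])

lemma pols_add: "f \<in> pols n V \<Longrightarrow> g \<in> pols n V \<Longrightarrow> f + g \<in> pols n V"
  using keys_add[of f g] by (fastforce simp: pols_def lookup_add intro: sn_spaceD[OF V])

lemma pols_uminus: "f \<in> pols n V \<Longrightarrow> - f \<in> pols n V"
  by (auto simp: pols_def in_keys_iff subset_iff intro: sn_spaceD[OF V])

lemma pols_diff: "f \<in> pols n V \<Longrightarrow> g \<in> pols n V \<Longrightarrow> f - g \<in> pols n V"
  using pols_add[OF _ pols_uminus, of f g] by simp

lemma pols_sum: "(\<And>i. i \<in> A \<Longrightarrow> f i \<in> pols n V) \<Longrightarrow> sum f A \<in> pols n V"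
  by (induction A rule: infinite_finite_induct) (auto intro: pols_0 pols_add)

lemma pols_mon: "a \<in> exponents n \<Longrightarrow> v \<in> V \<Longrightarrow> mon a v \<in> pols n V"
  by (auto simp: pols_def lookup_single when_def sn_spaceD[OF V])

lemma pols_lin:
  assumes "f \<in> pols n V" "\<And>a v. a \<in> exponents n \<Longrightarrow> v \<in> V \<Longrightarrow> F a v \<in> pols n V"
  shows "lin F f \<in> pols n V"
  unfolding lin_def using assms by (intro pols_sum) (auto simp: pols_def)

lemma pols_sop: "f \<in> pols n V \<Longrightarrow> sop z f \<in> pols n V"
  unfolding sop_def by (erule pols_lin) (auto intro: pols_mon sn_spaceD[OF V])

lemma pols_xop: "k \<in> {1..n} \<Longrightarrow> f \<in> pols n V \<Longrightarrow> xop k f \<in> pols n V"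
  unfolding xop_def by (erule pols_lin, rule pols_mon) (auto simp: exponents_def)

lemma pols_pop: "g permutes {1..n} \<Longrightarrow> f \<in> pols n V \<Longrightarrow> pop g f \<in> pols n V"
  unfolding pop_def
  by (erule pols_lin, rule pols_mon) (auto intro: sn_spaceD[OF V] exp_act_exponents simp del: One_nat_def)

lemma pols_yop:
  assumes "i \<in> {1..n}" "f \<in> pols n V"
  shows "yop n c i f \<in> pols n V"
  unfolding yop_def
proof (rule pols_lin[OF assms(2)])
  fix a v assume a: "a \<in> exponents n" and v: "v \<in> V"
  have e: "a(p := x, q := y) \<in> exponents n" if "p \<in> {1..n}" "q \<in> {1..n}" for p q x y
    using a that by (auto simp: exponents_def)
  have "a(i := a i - 1) \<in> exponents n"
    using e[OF assms(1) assms(1), of "a i" "a i - 1"] by simp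
  then show "ymon n c i a v \<in> pols n V"
    unfolding ymon_def ddiff_def using assms(1) e v
    by (intro pols_diff pols_sop pols_sum pols_mon sn_space_transp[OF V] sn_spaceD(3)[OF V])
      (auto simp del: One_nat_def)
qed

end

section \<open>The carrier of the smash ring\<close>

definition smash_mons :: "nat \<Rightarrow> smash_mon set" where
  "smash_mons n = {SM w g | w g. set w \<subseteq> X ` {1..n} \<union> Y ` {1..n} \<and> g permutes {1..n}}"

lemma smash_carrier: "carrier (smash_ring n) = {a. Poly_Mapping.keys a \<subseteq> smash_mons n}"
  by (simp add: smash_ring_def smash_mons_def)

lemma smash_ring_ops [simp]:
  "monoid.mult (smash_ring n) = (*)" "ring.add (smash_ring n) = (+)" "monoid.one (smash_ring n) = 1" "ring.zero (smash_ring n) = 0"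
  by (simp_all add: smash_ring_def)

lemma smash_carrier_0 [simp]: "0 \<in> carrier (smash_ring n)"
  by (simp add: smash_carrier)

lemma smash_carrier_add: "a \<in> carrier (smash_ring n) \<Longrightarrow> b \<in> carrier (smash_ring n) \<Longrightarrow> a + b \<in> carrier (smash_ring n)"
  using keys_add[of a b] by (auto simp: smash_carrier)

lemma smash_carrier_uminus: "a \<in> carrier (smash_ring n) \<Longrightarrow> - a \<in> carrier (smash_ring n)"
  by (auto simp: smash_carrier in_keys_iff subset_iff)

lemma smash_carrier_diff: "a \<in> carrier (smash_ring n) \<Longrightarrow> b \<in> carrier (smash_ring n) \<Longrightarrow> a - b \<in> carrier (smash_ring n)"
  using smash_carrier_add[OF _ smash_carrier_uminus, of a n b] by simp

lemma smash_carrier_sum: "(\<And>i. i \<in> A \<Longrightarrow> f i \<in> carrier (smash_ring n)) \<Longrightarrow> sum f A \<in> carrier (smash_ring n)"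
  by (induction A rule: infinite_finite_induct) (auto intro: smash_carrier_add)

lemma smash_carrier_single: "k \<in> smash_mons n \<Longrightarrow> Poly_Mapping.single k z \<in> carrier (smash_ring n)"
  by (simp add: smash_carrier)

lemma smash_carrier_perm: "g permutes {1..n} \<Longrightarrow> perm_elt g \<in> carrier (smash_ring n)"
  unfolding perm_elt_def by (rule smash_carrier_single) (auto simp: smash_mons_def)

lemma smash_carrier_transp: "i \<in> {1..n} \<Longrightarrow> j \<in> {1..n} \<Longrightarrow> transp i j \<in> carrier (smash_ring n)"
  unfolding transp_def by (intro smash_carrier_perm permutes_swap_id)

lemma smash_carrier_scal: "scal z \<in> carrier (smash_ring n)"
  unfolding scal_def by (rule smash_carrier_single) (auto simp: smash_mons_def zero_smash_mon_def permutes_id)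

lemma smash_carrier_1: "1 \<in> carrier (smash_ring n)"
  using smash_carrier_scal[of 1] by simp

lemma smash_carrier_gx: "i \<in> {1..n} \<Longrightarrow> gx i \<in> carrier (smash_ring n)"
  unfolding gx_def by (rule smash_carrier_single) (auto simp: smash_mons_def permutes_id)

lemma smash_carrier_gy: "i \<in> {1..n} \<Longrightarrow> gy i \<in> carrier (smash_ring n)"
  unfolding gy_def by (rule smash_carrier_single) (auto simp: smash_mons_def permutes_id)

lemmas smash_carrier_intros = smash_carrier_0 smash_carrier_add smash_carrier_uminus smash_carrier_diff
  smash_carrier_sum smash_carrier_perm smash_carrier_transp smash_carrier_scal smash_carrier_1
  smash_carrier_gx smash_carrier_gy smash_mult_closed

section \<open>The action of the smash product on polynomials\<close>

fun genop :: "nat \<Rightarrow> complex \<Rightarrow> gen \<Rightarrow> pol \<Rightarrow> pol" where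
  "genop n c (X i) = xop i"
| "genop n c (Y i) = yop n c i"

fun mop :: "nat \<Rightarrow> complex \<Rightarrow> smash_mon \<Rightarrow> pol \<Rightarrow> pol" where
  "mop n c (SM w g) f = foldr (genop n c) w (pop g f)"

definition rep :: "nat \<Rightarrow> complex \<Rightarrow> smash \<Rightarrow> pol \<Rightarrow> pol" where
  "rep n c a f = lin (\<lambda>k z. sop z (mop n c k f)) a"

lemma genop_add: "genop n c t (f + g) = genop n c t f + genop n c t g"
  by (cases t) (simp_all add: op_simps)

lemma genop_sop: "genop n c t (sop z f) = sop z (genop n c t f)"
  by (cases t) (simp_all add: xop_sop yop_sop)

lemma foldr_genop_add: "foldr (genop n c) w (f + g) = foldr (genop n c) w f + foldr (genop n c) w g"
  by (induction w) (simp_all add: genop_add)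

lemma foldr_genop_sop: "foldr (genop n c) w (sop z f) = sop z (foldr (genop n c) w f)"
  by (induction w) (simp_all add: genop_sop)

lemma mop_add: "mop n c k (f + g) = mop n c k f + mop n c k g"
  by (cases k) (simp add: op_simps foldr_genop_add)

lemma mop_sop: "mop n c k (sop z f) = sop z (mop n c k f)"
  by (cases k) (simp add: pop_sop foldr_genop_sop)

text \<open>Addition in \<open>smash_mon\<close> renames the letters of the second word by
  \<open>g\<close>. On operators this is the equivariance of \<open>x_i\<close> and
  \<open>y_i\<close>, which for \<open>y_i\<close> requires that \<open>g\<close> permutes the index
  set.\<close>

lemma mop_plus:
  assumes "k \<in> smash_mons n" "k' \<in> smash_mons n"
  shows "mop n c (k + k') f = mop n c k (mop n c k' f)"
proof -
  obtain w g w' g' where k: "k = SM w g" "k' = SM w' g'" "g permutes {1..n}" "g' permutes {1..n}"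
    using assms by (auto simp: smash_mons_def)
  have t: "pop g (genop n c t f) = genop n c (gen_act g t) (pop g f)" for t f
    using k(3) by (cases t) (simp_all add: pop_yop pop_xop permutes_bij)
  have "pop g (foldr (genop n c) w' f) = foldr (genop n c) (map (gen_act g) w') (pop g f)" for f
    by (induction w') (simp_all add: t)
  then show ?thesis using k by (simp add: pop_pop permutes_bij)
qed

lemma additive_rep_coeff: "additive (\<lambda>z. sop z f)"
  by unfold_locales (rule sop_plus)

lemma rep_add_left: "rep n c (a + b) f = rep n c a f + rep n c b f"
  unfolding rep_def by (rule additive.add[OF additive_lin]) (rule additive_rep_coeff)

lemma rep_single: "rep n c (Poly_Mapping.single k z) f = sop z (mop n c k f)"
  unfolding rep_def by (rule lin_single) (rule additive_rep_coeff)

lemma additive_rep_left: "additive (\<lambda>a. rep n c a f)"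
  by unfold_locales (rule rep_add_left)

lemma additive_rep: "additive (rep n c a)"
  by unfold_locales (simp add: rep_def lin_def mop_add op_simps sum.distrib)

lemmas rep_left_simps = additive.zero[OF additive_rep_left] additive.add[OF additive_rep_left]
  additive.diff[OF additive_rep_left] additive.minus[OF additive_rep_left] additive.sum[OF additive_rep_left]
lemmas rep_simps = additive.zero[OF additive_rep] additive.add[OF additive_rep]
  additive.diff[OF additive_rep] additive.minus[OF additive_rep] additive.sum[OF additive_rep]

lemma rep_sop: "rep n c a (sop z f) = sop z (rep n c a f)"
  by (simp add: rep_def lin_def mop_sop sop_sum sop_sop mult.commute)

lemma rep_scal [simp]: "rep n c (scal z) f = sop z f"
  by (simp add: scal_def rep_single zero_smash_mon_def)

lemma rep_1 [simp]: "rep n c 1 f = f"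
  using rep_scal[of n c 1 f] by simp

lemma rep_gx [simp]: "rep n c (gx i) f = xop i f"
  by (simp add: gx_def rep_single)

lemma rep_gy [simp]: "rep n c (gy i) f = yop n c i f"
  by (simp add: gy_def rep_single)

lemma rep_perm [simp]: "rep n c (perm_elt g) f = pop g f"
  by (simp add: perm_elt_def rep_single)

lemma rep_transp [simp]: "rep n c (transp i j) f = pop (transpose i j) f"
  by (simp add: transp_def)

lemma rep_mult:
  assumes "a \<in> carrier (smash_ring n)" "b \<in> carrier (smash_ring n)"
  shows "rep n c (a * b) f = rep n c a (rep n c b f)"
proof (rule poly_mapping_sum_induct[where f = a and P = "\<lambda>a. rep n c (a * b) f = rep n c a (rep n c b f)"])
  fix k assume "k \<in> Poly_Mapping.keys a"
  then have k: "k \<in> smash_mons n" using assms by (auto simp: smash_carrier)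
  let ?s = "Poly_Mapping.single k (Poly_Mapping.lookup a k)"
  show "rep n c (?s * b) f = rep n c ?s (rep n c b f)"
  proof (rule poly_mapping_sum_induct[where f = b and P = "\<lambda>b. rep n c (?s * b) f = rep n c ?s (rep n c b f)"])
    fix k' assume "k' \<in> Poly_Mapping.keys b"
    then have k': "k' \<in> smash_mons n" using assms by (auto simp: smash_carrier)
    show "rep n c (?s * Poly_Mapping.single k' (Poly_Mapping.lookup b k')) f =
      rep n c ?s (rep n c (Poly_Mapping.single k' (Poly_Mapping.lookup b k')) f)"
      by (simp add: mult_single rep_single mop_plus[OF k k'] mop_sop sop_sop)
  qed (simp_all add: rep_left_simps rep_simps algebra_simps)
qed (simp_all add: rep_left_simps rep_simps algebra_simps)

lemma pols_rep:
  assumes "sn_space n V" "a \<in> carrier (smash_ring n)" "f \<in> pols n V"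
  shows "rep n c a f \<in> pols n V"
proof -
  have "mop n c k f \<in> pols n V" if "k \<in> smash_mons n" for k
  proof -
    obtain w g where k: "k = SM w g" "set w \<subseteq> X ` {1..n} \<union> Y ` {1..n}" "g permutes {1..n}"
      using \<open>k \<in> smash_mons n\<close> by (auto simp: smash_mons_def)
    have "genop n c t h \<in> pols n V" if "t \<in> X ` {1..n} \<union> Y ` {1..n}" "h \<in> pols n V" for t h
      using that pols_xop[OF assms(1)] pols_yop[OF assms(1)] by auto
    then have "foldr (genop n c) w h \<in> pols n V" if "h \<in> pols n V" for h
      using k(2) that by (induction w) auto
    then show ?thesis using k pols_pop[OF assms(1) _ assms(3)] by simp
  qed
  then show ?thesis
    unfolding rep_def lin_def using assms(2)
    by (intro pols_sum[OF assms(1)] pols_sop[OF assms(1)]) (auto simp: smash_carrier)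
qed

lemma cherednik_rels_carrier: "cherednik_rels n c \<subseteq> carrier (smash_ring n)"
  unfolding cherednik_rels_def
  by (intro Un_least subsetI; elim CollectE exE conjE; hypsubst)
    (intro smash_carrier_intros; simp)+

text \<open>The restriction on \<open>f\<close> enters through the relation between
  \<open>y_i\<close> and \<open>y_j\<close>: the Dunkl operators were shown to commute on
  polynomials in the \<open>n\<close> variables.\<close>

lemma rep_cherednik_rels:
  assumes "r \<in> cherednik_rels n c" "f \<in> pols n UNIV"
  shows "rep n c r f = 0"
proof -
  have "Poly_Mapping.keys f \<subseteq> exponents n" using assms(2) by (simp add: pols_def)
  then have y: "yop n c i (yop n c j f) = yop n c j (yop n c i f)" if "i \<in> {1..n}" "j \<in> {1..n}" for i j
    using that by (intro yop_commute)
  from assms(1) show ?thesis unfolding cherednik_rels_def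
  proof (elim UnE CollectE exE conjE)
    fix i j assume "r = gx i * gx j - gx j * gx i" "i \<in> {1..n}" "j \<in> {1..n}"
    then show ?thesis by (simp add: rep_left_simps rep_mult smash_carrier_gx xop_commute[of i j] del: One_nat_def)
  next
    fix i j assume "r = gy i * gy j - gy j * gy i" "i \<in> {1..n}" "j \<in> {1..n}"
    then show ?thesis using y[of i j] by (simp add: rep_left_simps rep_mult smash_carrier_gy del: One_nat_def)
  next
    fix i j assume "r = gy i * gx j - gx j * gy i - scal c * transp i j" "i \<in> {1..n}" "j \<in> {1..n}" "i \<noteq> j"
    then show ?thesis
      by (simp add: rep_left_simps rep_mult smash_carrier_intros yop_xop del: One_nat_def)
  next
    fix i assume r: "r = gy i * gx i - gx i * gy i - (1 - scal c * (\<Sum>j\<in>{1..n} - {i}. transp i j))"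
      and i: "i \<in> {1..n}"
    have "(\<Sum>j\<in>{1..n} - {i}. transp i j) \<in> carrier (smash_ring n)"
      using i by (intro smash_carrier_sum smash_carrier_transp) auto
    then show ?thesis using r i
      by (simp add: rep_left_simps rep_mult smash_carrier_intros yop_xop_same del: One_nat_def)
  qed
qed

lemma cherednik_ideal: "ideal (cherednik_ideal n c) (smash_ring n)"
  unfolding cherednik_ideal_def
  by (rule ring.genideal_ideal[OF smash_ring_ring cherednik_rels_carrier])

lemma cherednik_rels_ideal: "cherednik_rels n c \<subseteq> cherednik_ideal n c"
  unfolding cherednik_ideal_def
  by (rule ring.genideal_self[OF smash_ring_ring cherednik_rels_carrier])

lemma rep_cherednik_ideal:
  assumes "a \<in> cherednik_ideal n c" "f \<in> pols n UNIV"
  shows "rep n c a f = 0"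
proof -
  \<comment> \<open>The annihilator of the polynomials is a two-sided ideal containing the
    relations; closure under right multiplication uses that polynomials are stable under the
    action.\<close>
  let ?N = "{a \<in> carrier (smash_ring n). \<forall>f\<in>pols n UNIV. rep n c a f = 0}"
  have "ideal ?N (smash_ring n)"
  proof (rule idealI)
    show "subgroup ?N (add_monoid (smash_ring n))"
    proof (rule group.subgroupI)
      show "group (add_monoid (smash_ring n))"
        by (rule abelian_group.a_group[OF ring.is_abelian_group[OF smash_ring_ring]])
      show "?N \<noteq> {}" by (auto intro!: exI[of _ 0] simp: rep_left_simps)
      fix a assume a: "a \<in> ?N"
      have "inv\<^bsub>add_monoid (smash_ring n)\<^esub> a = - a"
        using a smash_ring_ring[of n, THEN ring.is_abelian_group, THEN abelian_group.minus_equality, of "- a" a]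
        by (simp add: a_inv_def smash_carrier_uminus)
      then show "inv\<^bsub>add_monoid (smash_ring n)\<^esub> a \<in> ?N"
        using a by (simp add: smash_carrier_uminus rep_left_simps)
    qed (auto simp: rep_left_simps smash_carrier_add)
  qed (auto simp: smash_ring_ring smash_mult_closed rep_mult rep_simps pols_rep)
  then have "cherednik_ideal n c \<subseteq> ?N"
    unfolding cherednik_ideal_def
    by (rule ring.genideal_minimal[OF smash_ring_ring])
      (use cherednik_rels_carrier rep_cherednik_rels in blast)
  then show ?thesis using assms by auto
qed

section \<open>The Cherednik algebra and standard modules as quotients\<close>

lemma cherednik_ideal_closed:
  shows "cherednik_ideal n c \<subseteq> carrier (smash_ring n)" "0 \<in> cherednik_ideal n c"
    "a \<in> cherednik_ideal n c \<Longrightarrow> b \<in> cherednik_ideal n c \<Longrightarrow> a + b \<in> cherednik_ideal n c"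
    "a \<in> cherednik_ideal n c \<Longrightarrow> - a \<in> cherednik_ideal n c"
    "a \<in> cherednik_ideal n c \<Longrightarrow> x \<in> carrier (smash_ring n) \<Longrightarrow> x * a \<in> cherednik_ideal n c"
    "a \<in> cherednik_ideal n c \<Longrightarrow> x \<in> carrier (smash_ring n) \<Longrightarrow> a * x \<in> cherednik_ideal n c"
proof -
  interpret ideal "cherednik_ideal n c" "smash_ring n" by (rule cherednik_ideal)
  show "cherednik_ideal n c \<subseteq> carrier (smash_ring n)" by (rule a_subset)
  show "0 \<in> cherednik_ideal n c" using additive_subgroup.zero_closed[OF is_additive_subgroup] by simp
  show "a \<in> cherednik_ideal n c \<Longrightarrow> b \<in> cherednik_ideal n c \<Longrightarrow> a + b \<in> cherednik_ideal n c"
    using additive_subgroup.a_closed[OF is_additive_subgroup, of a b] by simp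
  show l: "a \<in> cherednik_ideal n c \<Longrightarrow> x \<in> carrier (smash_ring n) \<Longrightarrow> x * a \<in> cherednik_ideal n c" for a x
    using I_l_closed[of a x] by simp
  show "a \<in> cherednik_ideal n c \<Longrightarrow> x \<in> carrier (smash_ring n) \<Longrightarrow> a * x \<in> cherednik_ideal n c"
    using I_r_closed[of a x] by simp
  show "a \<in> cherednik_ideal n c \<Longrightarrow> - a \<in> cherednik_ideal n c"
    using l[of a "- 1"] smash_carrier_uminus[OF smash_carrier_1] by simp
qed

lemma cls_def2: "cls n c a = {i + a | i. i \<in> cherednik_ideal n c}"
  by (auto simp: cls_def a_r_coset_def')

lemma cls_eq_iff: "cls n c a = cls n c b \<longleftrightarrow> a - b \<in> cherednik_ideal n c"
proof
  assume "cls n c a = cls n c b"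
  moreover have "a \<in> cls n c a" using cherednik_ideal_closed(2) by (force simp: cls_def2)
  ultimately show "a - b \<in> cherednik_ideal n c" by (auto simp: cls_def2)
next
  assume *: "a - b \<in> cherednik_ideal n c"
  have "cls n c a \<subseteq> cls n c b" if "a - b \<in> cherednik_ideal n c" for a b
  proof
    fix x assume "x \<in> cls n c a"
    then obtain i where "i \<in> cherednik_ideal n c" "x = (i + (a - b)) + b" by (auto simp: cls_def2)
    then show "x \<in> cls n c b" using cherednik_ideal_closed(3)[OF _ that, of i] unfolding cls_def2 by blast
  qed
  from this[OF *] this[of b a] show "cls n c a = cls n c b"
    using cherednik_ideal_closed(4)[OF *] by auto
qed

lemma cls_self: "a \<in> cls n c a"
  using cherednik_ideal_closed(2) by (force simp: cls_def2)

lemma cherednik_carrier: "carrier (cherednik n c) = cls n c ` carrier (smash_ring n)"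
  by (auto simp: cherednik_def FactRing_def A_RCOSETS_def' cls_def)

lemma cls_hom: "cls n c \<in> Ring.ring_hom (smash_ring n) (cherednik n c)"
  using ideal.rcos_ring_hom[OF cherednik_ideal, of n c] by (simp add: cherednik_def cls_def[abs_def])

lemma cls_mult:
  "a \<in> carrier (smash_ring n) \<Longrightarrow> b \<in> carrier (smash_ring n) \<Longrightarrow>
    cls n c a \<otimes>\<^bsub>cherednik n c\<^esub> cls n c b = cls n c (a * b)"
  using Ring.ring_hom_mult[OF cls_hom] by simp

lemma cls_add:
  "a \<in> carrier (smash_ring n) \<Longrightarrow> b \<in> carrier (smash_ring n) \<Longrightarrow>
    cls n c a \<oplus>\<^bsub>cherednik n c\<^esub> cls n c b = cls n c (a + b)"
  using Ring.ring_hom_add[OF cls_hom] by simp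

lemma cls_one: "\<one>\<^bsub>cherednik n c\<^esub> = cls n c 1"
  using Ring.ring_hom_one[OF cls_hom] by simp

section \<open>The group algebra, the module \<open>irrep\<close>, and the subalgebra generated by
  the group and the \<open>y_i\<close>\<close>

lemma group_algebra_mult:
  assumes "a \<in> group_algebra n" "b \<in> group_algebra n"
  shows "a * b \<in> group_algebra n"
  unfolding group_algebra_def
proof (rule CollectI, rule subsetI)
  fix k assume "k \<in> Poly_Mapping.keys (a * b)"
  then obtain x y where k: "k = x + y" "x \<in> Poly_Mapping.keys a" "y \<in> Poly_Mapping.keys b"
    using keys_mult[of a b] by blast
  obtain g h where "x = SM [] g" "y = SM [] h" "g permutes {1..n}" "h permutes {1..n}"
    using k assms unfolding group_algebra_def by blast
  then show "k \<in> {SM [] g |g. g permutes {1..n}}" using k by (auto simp: permutes_compose)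
qed

lemma perm_elt_group_algebra: "g permutes {1..n} \<Longrightarrow> perm_elt g \<in> group_algebra n"
  by (auto simp: group_algebra_def perm_elt_def)

lemma scal_group_algebra: "scal z \<in> group_algebra n"
  by (auto simp: group_algebra_def scal_def zero_smash_mon_def permutes_id)

lemma sn_space_irrep: "sn_space n (carrier (irrep n \<mu>))"
  unfolding sn_space_def
proof (intro conjI ballI allI impI)
  show "0 \<in> carrier (irrep n \<mu>)"
    by (auto simp: irrep_def group_algebra_def intro!: exI[of _ 0])
  fix v assume "v \<in> carrier (irrep n \<mu>)"
  then obtain a where a: "v = a * young_symmetrizer n \<mu>" "a \<in> group_algebra n"
    by (auto simp: irrep_def)
  show "scal z * v \<in> carrier (irrep n \<mu>)" for z
    using a group_algebra_mult[OF scal_group_algebra, of a n z] by (auto simp: irrep_def mult.assoc intro!: exI[of _ "scal z * a"])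
  show "perm_elt g * v \<in> carrier (irrep n \<mu>)" if "g permutes {1..n}" for g
    using a group_algebra_mult[OF perm_elt_group_algebra[OF that], of a] by (auto simp: irrep_def mult.assoc intro!: exI[of _ "perm_elt g * a"])
  fix w assume "w \<in> carrier (irrep n \<mu>)"
  then obtain b where b: "w = b * young_symmetrizer n \<mu>" "b \<in> group_algebra n"
    by (auto simp: irrep_def)
  show "v + w \<in> carrier (irrep n \<mu>)"
  proof -
    have "a + b \<in> group_algebra n" using a b keys_add[of a b] unfolding group_algebra_def by blast
    then show ?thesis using a b by (auto simp: irrep_def distrib_right intro!: exI[of _ "a + b"])
  qed
qed

lemma irrep_ops [simp]: "ring.add (irrep n \<mu>) = (+)" "ring.zero (irrep n \<mu>) = 0"
  "module.smult (irrep n \<mu>) = (\<lambda>z v. scal z * v)"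
  by (simp_all add: irrep_def)

lemma y_subalgebra_carrier: "b \<in> y_subalgebra n \<Longrightarrow> b \<in> carrier (smash_ring n)"
  by (fastforce simp: y_subalgebra_def smash_carrier smash_mons_def)

lemma y_trivial_act_closed:
  assumes "sn_space n V" "b \<in> y_subalgebra n" "v \<in> V"
  shows "y_trivial_act b v \<in> V"
  unfolding y_trivial_act_def
proof (rule sn_space_sum[OF assms(1)])
  fix k assume "k \<in> Poly_Mapping.keys b"
  then obtain w g where "k = SM w g" "g permutes {1..n}" using assms(2) by (auto simp: y_subalgebra_def)
  then show "(case k of SM w g \<Rightarrow> if w = [] then scal (Poly_Mapping.lookup b k) * perm_elt g * v else 0) \<in> V"
    using sn_spaceD[OF assms(1)] assms(3) by (auto simp: mult.assoc)
qed

lemma perm_elt_y_subalgebra: "g permutes {1..n} \<Longrightarrow> perm_elt g \<in> y_subalgebra n"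
  by (auto simp: perm_elt_def y_subalgebra_def)

lemma scal_y_subalgebra: "scal z \<in> y_subalgebra n"
  by (auto simp: scal_def y_subalgebra_def zero_smash_mon_def permutes_id)

lemma gy_y_subalgebra: "i \<in> {1..n} \<Longrightarrow> gy i \<in> y_subalgebra n"
  by (auto simp: gy_def y_subalgebra_def permutes_id)

section \<open>The induced module as a quotient of a free abelian group\<close>

type_synonym frag = "smash set \<times> smash \<Rightarrow>\<^sub>0 int"

definition tfree :: "nat \<Rightarrow> complex \<Rightarrow> nat list \<Rightarrow> frag set" where
  "tfree n c \<mu> = {f. Poly_Mapping.keys f \<subseteq> carrier (cherednik n c) \<times> carrier (irrep n \<mu>)}"

definition trels :: "nat \<Rightarrow> complex \<Rightarrow> nat list \<Rightarrow> frag set" where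
  "trels n c \<mu> = tensor_rels (cherednik n c) (y_subalgebra n) (cls n c) y_trivial_act (irrep n \<mu>)"

definition tker :: "nat \<Rightarrow> complex \<Rightarrow> nat list \<Rightarrow> frag set" where
  "tker n c \<mu> = tensor_kernel (cherednik n c) (y_subalgebra n) (cls n c) y_trivial_act (irrep n \<mu>)"

definition tcls :: "nat \<Rightarrow> complex \<Rightarrow> nat list \<Rightarrow> frag \<Rightarrow> std_elt" where
  "tcls n c \<mu> f = tker n c \<mu> #>\<^bsub>tensor_free (cherednik n c) (irrep n \<mu>)\<^esub> f"

definition tmul :: "nat \<Rightarrow> complex \<Rightarrow> smash set \<Rightarrow> frag \<Rightarrow> frag" where
  "tmul n c r = frag_extend (\<lambda>(r', v). frag_of (r \<otimes>\<^bsub>cherednik n c\<^esub> r', v))"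

lemma tfree_carrier: "carrier (tensor_free (cherednik n c) (irrep n \<mu>)) = tfree n c \<mu>"
  by (auto simp: tensor_free_def tfree_def)

lemma frag_of_tfree: "a \<in> carrier (smash_ring n) \<Longrightarrow> v \<in> carrier (irrep n \<mu>) \<Longrightarrow> frag_of (cls n c a, v) \<in> tfree n c \<mu>"
  by (auto simp: tfree_def cherednik_carrier)

lemma tfree_closed:
  shows "0 \<in> tfree n c \<mu>" "f \<in> tfree n c \<mu> \<Longrightarrow> g \<in> tfree n c \<mu> \<Longrightarrow> f + g \<in> tfree n c \<mu>"
    "f \<in> tfree n c \<mu> \<Longrightarrow> - f \<in> tfree n c \<mu>"
    "f \<in> tfree n c \<mu> \<Longrightarrow> g \<in> tfree n c \<mu> \<Longrightarrow> f - g \<in> tfree n c \<mu>"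
  unfolding tfree_def using keys_add[of f g] keys_diff[of f g] by fastforce+

lemma tfree_induct [consumes 1, case_names zero frag diff]:
  assumes "f \<in> tfree n c \<mu>" "P 0"
    and "\<And>a v. a \<in> carrier (smash_ring n) \<Longrightarrow> v \<in> carrier (irrep n \<mu>) \<Longrightarrow> P (frag_of (cls n c a, v))"
    and "\<And>f g. f \<in> tfree n c \<mu> \<Longrightarrow> g \<in> tfree n c \<mu> \<Longrightarrow> P f \<Longrightarrow> P g \<Longrightarrow> P (f - g)"
  shows "P f"
  by (rule free_Abelian_group_induct[of f "carrier (cherednik n c) \<times> carrier (irrep n \<mu>)"])
    (use assms in \<open>auto simp: tfree_def cherednik_carrier\<close>)

text \<open>The relations of the tensor product, with elements of the quotient ring replaced by
  representatives in the smash ring.\<close>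

lemma trels_cases:
  assumes "x \<in> trels n c \<mu>"
  obtains (ladd) a b v where "a \<in> carrier (smash_ring n)" "b \<in> carrier (smash_ring n)" "v \<in> carrier (irrep n \<mu>)"
      "x = frag_of (cls n c (a + b), v) - frag_of (cls n c a, v) - frag_of (cls n c b, v)"
  | (radd) a v w where "a \<in> carrier (smash_ring n)" "v \<in> carrier (irrep n \<mu>)" "w \<in> carrier (irrep n \<mu>)"
      "x = frag_of (cls n c a, v + w) - frag_of (cls n c a, v) - frag_of (cls n c a, w)"
  | (bal) a b v where "a \<in> carrier (smash_ring n)" "b \<in> y_subalgebra n" "v \<in> carrier (irrep n \<mu>)"
      "x = frag_of (cls n c (a * b), v) - frag_of (cls n c a, y_trivial_act b v)"
  using assms unfolding trels_def tensor_rels_def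
proof (elim UnE CollectE exE conjE)
  fix r r' v assume "x = frag_of (r \<oplus>\<^bsub>cherednik n c\<^esub> r', v) - frag_of (r, v) - frag_of (r', v)"
    "r \<in> carrier (cherednik n c)" "r' \<in> carrier (cherednik n c)" "v \<in> carrier (irrep n \<mu>)"
  then show thesis by (auto simp: cherednik_carrier cls_add intro: ladd)
next
  fix r v v' assume "x = frag_of (r, v \<oplus>\<^bsub>irrep n \<mu>\<^esub> v') - frag_of (r, v) - frag_of (r, v')"
    "r \<in> carrier (cherednik n c)" "v \<in> carrier (irrep n \<mu>)" "v' \<in> carrier (irrep n \<mu>)"
  then show thesis by (auto simp: cherednik_carrier intro: radd)
next
  fix r b v assume "x = frag_of (r \<otimes>\<^bsub>cherednik n c\<^esub> cls n c b, v) - frag_of (r, y_trivial_act b v)"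
    "r \<in> carrier (cherednik n c)" "b \<in> y_subalgebra n" "v \<in> carrier (irrep n \<mu>)"
  then show thesis by (auto simp: cherednik_carrier cls_mult y_subalgebra_carrier intro: bal)
qed

lemma trels_intros:
  assumes "a \<in> carrier (smash_ring n)" "v \<in> carrier (irrep n \<mu>)"
  shows "b \<in> carrier (smash_ring n) \<Longrightarrow>
      frag_of (cls n c (a + b), v) - frag_of (cls n c a, v) - frag_of (cls n c b, v) \<in> trels n c \<mu>"
    "w \<in> carrier (irrep n \<mu>) \<Longrightarrow>
      frag_of (cls n c a, v + w) - frag_of (cls n c a, v) - frag_of (cls n c a, w) \<in> trels n c \<mu>"
    "b \<in> y_subalgebra n \<Longrightarrow>
      frag_of (cls n c (a * b), v) - frag_of (cls n c a, y_trivial_act b v) \<in> trels n c \<mu>"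
proof -
  have a: "cls n c a \<in> carrier (cherednik n c)" using assms by (auto simp: cherednik_carrier)
  show "frag_of (cls n c (a + b), v) - frag_of (cls n c a, v) - frag_of (cls n c b, v) \<in> trels n c \<mu>"
    if "b \<in> carrier (smash_ring n)"
  proof -
    have b: "cls n c b \<in> carrier (cherednik n c)" using that by (auto simp: cherednik_carrier)
    show ?thesis unfolding trels_def tensor_rels_def cls_add[OF assms(1) that, symmetric]
      by (rule UnI1, rule UnI1, intro CollectI exI conjI, rule refl) (use a b assms in auto)
  qed
  show "frag_of (cls n c a, v + w) - frag_of (cls n c a, v) - frag_of (cls n c a, w) \<in> trels n c \<mu>"
    if "w \<in> carrier (irrep n \<mu>)"
    unfolding trels_def tensor_rels_def irrep_ops
    by (rule UnI1, rule UnI2, intro CollectI exI conjI, rule refl) (use a assms that in auto)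
  show "frag_of (cls n c (a * b), v) - frag_of (cls n c a, y_trivial_act b v) \<in> trels n c \<mu>"
    if "b \<in> y_subalgebra n"
    unfolding trels_def tensor_rels_def cls_mult[OF assms(1) y_subalgebra_carrier[OF that], symmetric]
    by (rule UnI2, intro CollectI exI conjI, rule refl) (use a assms that in auto)
qed

lemma trels_tfree: "trels n c \<mu> \<subseteq> tfree n c \<mu>"
proof
  fix x assume "x \<in> trels n c \<mu>"
  then show "x \<in> tfree n c \<mu>"
  proof (cases rule: trels_cases)
    case (ladd a b v)
    then show ?thesis by (auto intro!: tfree_closed frag_of_tfree smash_carrier_add)
  next
    case (radd a v w)
    then show ?thesis by (auto intro!: tfree_closed frag_of_tfree sn_spaceD[OF sn_space_irrep])
  next
    case (bal a b v)
    then show ?thesis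
      using smash_mult_closed[OF _ y_subalgebra_carrier, of a n b]
      by (auto intro!: tfree_closed frag_of_tfree y_trivial_act_closed[OF sn_space_irrep])
  qed
qed

lemma tker_induct [consumes 1, case_names zero rel uminus add]:
  assumes "x \<in> tker n c \<mu>" "P 0" "\<And>x. x \<in> trels n c \<mu> \<Longrightarrow> P x" "\<And>x. x \<in> trels n c \<mu> \<Longrightarrow> P x \<Longrightarrow> P (- x)"
    "\<And>x y. P x \<Longrightarrow> P y \<Longrightarrow> P (x + y)"
  shows "P x"
  using assms(1) unfolding tker_def tensor_kernel_def trels_def[symmetric]
proof (induction rule: generate.induct)
  case (inv h)
  then have "Poly_Mapping.keys h \<subseteq> carrier (cherednik n c) \<times> carrier (irrep n \<mu>)"
    using trels_tfree[of n c \<mu>] by (auto simp: tfree_def)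
  then show ?case using inv assms by (simp add: tensor_free_def)
qed (use assms in \<open>auto simp: tensor_free_def\<close>)

lemma tker_closed:
  shows "0 \<in> tker n c \<mu>" "x \<in> trels n c \<mu> \<Longrightarrow> x \<in> tker n c \<mu>"
    "x \<in> tker n c \<mu> \<Longrightarrow> y \<in> tker n c \<mu> \<Longrightarrow> x + y \<in> tker n c \<mu>"
    "x \<in> tker n c \<mu> \<Longrightarrow> - x \<in> tker n c \<mu>"
    "x \<in> tker n c \<mu> \<Longrightarrow> y \<in> tker n c \<mu> \<Longrightarrow> x - y \<in> tker n c \<mu>"
    "x \<in> tker n c \<mu> \<Longrightarrow> x \<in> tfree n c \<mu>"
proof -
  let ?F = "tensor_free (cherednik n c) (irrep n \<mu>)"
  have G: "tker n c \<mu> = generate ?F (trels n c \<mu>)"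
    by (simp add: tker_def tensor_kernel_def trels_def)
  have "group ?F" by (simp add: tensor_free_def)
  then have S: "subgroup (tker n c \<mu>) ?F"
    unfolding G by (rule group.generate_is_subgroup) (simp add: tfree_carrier trels_tfree)
  show z: "0 \<in> tker n c \<mu>" using subgroup.one_closed[OF S] by (simp add: tensor_free_def)
  show "x \<in> trels n c \<mu> \<Longrightarrow> x \<in> tker n c \<mu>" unfolding G by (rule generate.incl)
  show p: "x \<in> tker n c \<mu> \<Longrightarrow> y \<in> tker n c \<mu> \<Longrightarrow> x + y \<in> tker n c \<mu>" for x y
    using subgroup.m_closed[OF S, of x y] by (simp add: tensor_free_def)
  show f: "x \<in> tker n c \<mu> \<Longrightarrow> x \<in> tfree n c \<mu>" for x
    using subgroup.subset[OF S] by (auto simp: tfree_carrier)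
  show u: "x \<in> tker n c \<mu> \<Longrightarrow> - x \<in> tker n c \<mu>" for x
    using subgroup.m_inv_closed[OF S, of x] f[of x] by (simp add: tensor_free_def tfree_def)
  show "x \<in> tker n c \<mu> \<Longrightarrow> y \<in> tker n c \<mu> \<Longrightarrow> x - y \<in> tker n c \<mu>"
    using p[OF _ u, of x y] by simp
qed

lemma tker_subgroup: "subgroup (tker n c \<mu>) (tensor_free (cherednik n c) (irrep n \<mu>))"
  using tker_closed trels_tfree unfolding tker_def tensor_kernel_def trels_def[symmetric]
  by (intro group.generate_is_subgroup) (auto simp: tensor_free_def tfree_def)

lemma tcls_def2: "tcls n c \<mu> f = {k + f | k. k \<in> tker n c \<mu>}"
  by (auto simp: tcls_def r_coset_def tensor_free_def)

lemma tcls_eq_iff: "tcls n c \<mu> f = tcls n c \<mu> g \<longleftrightarrow> f - g \<in> tker n c \<mu>"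
proof
  assume "tcls n c \<mu> f = tcls n c \<mu> g"
  moreover have "f \<in> tcls n c \<mu> f" using tker_closed(1) by (force simp: tcls_def2)
  ultimately show "f - g \<in> tker n c \<mu>" by (auto simp: tcls_def2)
next
  assume *: "f - g \<in> tker n c \<mu>"
  have "tcls n c \<mu> a \<subseteq> tcls n c \<mu> b" if "a - b \<in> tker n c \<mu>" for a b
  proof
    fix x assume "x \<in> tcls n c \<mu> a"
    then obtain i where "i \<in> tker n c \<mu>" "x = (i + (a - b)) + b" by (auto simp: tcls_def2)
    then show "x \<in> tcls n c \<mu> b" using tker_closed(3)[OF _ that, of i] unfolding tcls_def2 by blast
  qed
  from this[OF *] this[of g f] show "tcls n c \<mu> f = tcls n c \<mu> g"
    using tker_closed(4)[OF *] by auto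
qed

lemma tmul_simps:
  "tmul n c r (f + g) = tmul n c r f + tmul n c r g" "tmul n c r (f - g) = tmul n c r f - tmul n c r g"
  "tmul n c r (- f) = - tmul n c r f" "tmul n c r 0 = 0"
  by (simp_all add: tmul_def frag_extend_add frag_extend_diff frag_extend_minus)

lemma tmul_frag_of:
  "a \<in> carrier (smash_ring n) \<Longrightarrow> b \<in> carrier (smash_ring n) \<Longrightarrow>
    tmul n c (cls n c a) (frag_of (cls n c b, v)) = frag_of (cls n c (a * b), v)"
  by (simp add: tmul_def cls_mult)

lemma tmul_tfree:
  assumes "a \<in> carrier (smash_ring n)" "f \<in> tfree n c \<mu>"
  shows "tmul n c (cls n c a) f \<in> tfree n c \<mu>"
  using assms(2)
  by (induction rule: tfree_induct)
    (auto simp: tmul_simps tmul_frag_of assms intro: tfree_closed frag_of_tfree smash_mult_closed assms)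

text \<open>Left multiplication maps each relation to a relation of the same kind, so it descends to
  the quotient.\<close>

lemma tmul_tker:
  assumes a: "a \<in> carrier (smash_ring n)" and "f \<in> tker n c \<mu>"
  shows "tmul n c (cls n c a) f \<in> tker n c \<mu>"
  using assms(2)
proof (induction rule: tker_induct)
  case (rel x)
  then show ?case
  proof (cases rule: trels_cases)
    case (ladd b b' v)
    then show ?thesis
      using trels_intros(1)[of "a * b" n v \<mu> "a * b'" c] a
      by (auto simp: tmul_simps tmul_frag_of smash_carrier_add smash_mult_closed distrib_left intro!: tker_closed(2))
  next
    case (radd b v w)
    then show ?thesis
      using trels_intros(2)[of "a * b" n v \<mu> w c] a
      by (auto simp: tmul_simps tmul_frag_of smash_mult_closed intro!: tker_closed(2))
  next
    case (bal b b' v)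
    then show ?thesis
      using trels_intros(3)[of "a * b" n v \<mu> b' c] a
      by (auto simp: tmul_simps tmul_frag_of smash_mult_closed y_subalgebra_carrier mult.assoc intro!: tker_closed(2))
  qed
qed (auto simp: tmul_simps intro: tker_closed)

lemma Delta_carrier: "carrier (Delta n c \<mu>) = tcls n c \<mu> ` tfree n c \<mu>"
  by (auto simp: Delta_def induced_module_def Let_def FactGroup_def RCOSETS_def tcls_def tker_def
      simp flip: tfree_carrier)

lemma Delta_add:
  assumes "f \<in> tfree n c \<mu>" "g \<in> tfree n c \<mu>"
  shows "tcls n c \<mu> f \<oplus>\<^bsub>Delta n c \<mu>\<^esub> tcls n c \<mu> g = tcls n c \<mu> (f + g)"
proof -
  let ?F = "tensor_free (cherednik n c) (irrep n \<mu>)"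
  have "comm_group ?F" by (simp add: tensor_free_def abelian_free_Abelian_group)
  then have "normal (tker n c \<mu>) ?F"
    using tker_subgroup by (rule comm_group.normal_iff_subgroup[THEN iffD2])
  from normal.rcos_sum[OF this, of f g] show ?thesis
    using assms by (simp add: Delta_def induced_module_def Let_def FactGroup_def tcls_def tker_def tfree_carrier)
      (simp add: tensor_free_def)
qed

lemma Delta_zero: "\<zero>\<^bsub>Delta n c \<mu>\<^esub> = tcls n c \<mu> 0"
  by (auto simp: Delta_def induced_module_def Let_def FactGroup_def tcls_def2 tker_def)

text \<open>The scalar action of \<open>induced_module\<close> is a union over all representatives
  of the coset. As \<open>tmul\<close> preserves the kernel, the members of this union
  coincide.\<close>

lemma Delta_act:
  assumes "a \<in> carrier (smash_ring n)"
  shows "act n c \<mu> a (tcls n c \<mu> f) = tcls n c \<mu> (tmul n c (cls n c a) f)"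
proof -
  have "act n c \<mu> a (tcls n c \<mu> f) = (\<Union>g\<in>tcls n c \<mu> f. tcls n c \<mu> (tmul n c (cls n c a) g))"
    by (simp add: act_def Delta_def induced_module_def Let_def tcls_def tker_def tmul_def)
  also have "\<dots> = tcls n c \<mu> (tmul n c (cls n c a) f)"
  proof (rule SUP_eq_const)
    show "tcls n c \<mu> f \<noteq> {}" using tker_closed(1) by (force simp: tcls_def2)
    fix g assume "g \<in> tcls n c \<mu> f"
    then have "g - f \<in> tker n c \<mu>" by (auto simp: tcls_def2)
    then show "tcls n c \<mu> (tmul n c (cls n c a) g) = tcls n c \<mu> (tmul n c (cls n c a) f)"
      using tmul_tker[OF assms] by (simp add: tcls_eq_iff flip: tmul_simps)
  qed
  finally show ?thesis .
qed

lemma iota_tcls: "iota n c \<mu> v = tcls n c \<mu> (frag_of (cls n c 1, v))"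
  by (simp add: iota_def pure_tensor_def tcls_def tker_def cls_one)

lemma iota_carrier: "v \<in> carrier (irrep n \<mu>) \<Longrightarrow> iota n c \<mu> v \<in> carrier (Delta n c \<mu>)"
  by (auto simp: iota_tcls Delta_carrier intro: frag_of_tfree smash_carrier_1)

lemma act_iota:
  "a \<in> carrier (smash_ring n) \<Longrightarrow> act n c \<mu> a (iota n c \<mu> v) = tcls n c \<mu> (frag_of (cls n c a, v))"
  by (simp add: iota_tcls Delta_act tmul_frag_of smash_carrier_1)

section \<open>Standard modules as polynomials\<close>

text \<open>The map \<open>r \<otimes> v \<mapsto> r \<theta>(v)\<close> on formal sums. The
  representative of the coset \<open>r\<close> is picked by \<open>SOME\<close>, which is harmless
  on polynomials because the ideal annihilates them.\<close>

definition fext :: "nat \<Rightarrow> complex \<Rightarrow> (smash \<Rightarrow> pol) \<Rightarrow> frag \<Rightarrow> pol" where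
  "fext n c \<theta> = lin (\<lambda>(r, v) k. sop (of_int k) (rep n c (SOME a. a \<in> r) (\<theta> v)))"

definition dext :: "nat \<Rightarrow> complex \<Rightarrow> (smash \<Rightarrow> pol) \<Rightarrow> std_elt \<Rightarrow> pol" where
  "dext n c \<theta> C = fext n c \<theta> (SOME f. f \<in> C)"

lemma additive_fext: "additive (fext n c \<theta>)"
  unfolding fext_def
proof (rule additive_lin)
  fix x :: "smash set \<times> smash"
  show "additive ((\<lambda>(r, v) k. sop (of_int k) (rep n c (SOME a. a \<in> r) (\<theta> v))) x)"
    by (cases x) (simp add: additive_def sop_plus)
qed

lemmas fext_simps = additive.zero[OF additive_fext] additive.add[OF additive_fext]
  additive.diff[OF additive_fext] additive.minus[OF additive_fext] additive.sum[OF additive_fext]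

lemma rep_cong_cls:
  assumes "cls n c a = cls n c b" "f \<in> pols n UNIV"
  shows "rep n c a f = rep n c b f"
  using rep_cherednik_ideal[of "a - b" n c f] assms by (simp add: cls_eq_iff rep_left_simps)

lemma fext_frag_of:
  assumes "\<theta> v \<in> pols n UNIV"
  shows "fext n c \<theta> (frag_of (cls n c a, v)) = rep n c a (\<theta> v)"
proof -
  let ?b = "SOME b. b \<in> cls n c a"
  have "?b \<in> cls n c a" by (rule someI, rule cls_self)
  then have "cls n c ?b = cls n c a" unfolding cls_eq_iff by (auto simp: cls_def2)
  then have "rep n c ?b (\<theta> v) = rep n c a (\<theta> v)" by (rule rep_cong_cls[OF _ assms])
  moreover have "fext n c \<theta> (frag_of (cls n c a, v)) = rep n c ?b (\<theta> v)"
    unfolding fext_def by (subst lin_single) (auto simp: additive_def sop_plus)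
  ultimately show ?thesis by (rule trans[rotated])
qed

text \<open>The data for the universal property of an induced module: an equivariant map from
  \<open>irrep n \<mu>\<close> into polynomials killed by all \<open>y_i\<close>. It is used for the
  constants, which gives the passage from \<open>Delta\<close> to polynomials, and for the candidate
  homomorphism.\<close>

locale singular_map =
  fixes n :: nat and c :: complex and \<mu> :: "nat list" and W :: "smash set" and \<theta> :: "smash \<Rightarrow> pol"
  assumes W: "sn_space n W"
    and \<theta>_pols: "v \<in> carrier (irrep n \<mu>) \<Longrightarrow> \<theta> v \<in> pols n W"
    and \<theta>_add: "v \<in> carrier (irrep n \<mu>) \<Longrightarrow> w \<in> carrier (irrep n \<mu>) \<Longrightarrow> \<theta> (v + w) = \<theta> v + \<theta> w"
    and \<theta>_scal: "v \<in> carrier (irrep n \<mu>) \<Longrightarrow> \<theta> (scal z * v) = sop z (\<theta> v)"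
    and \<theta>_perm: "v \<in> carrier (irrep n \<mu>) \<Longrightarrow> g permutes {1..n} \<Longrightarrow> \<theta> (perm_elt g * v) = pop g (\<theta> v)"
    and \<theta>_y: "v \<in> carrier (irrep n \<mu>) \<Longrightarrow> i \<in> {1..n} \<Longrightarrow> yop n c i (\<theta> v) = 0"
begin

lemma \<theta>_0: "\<theta> 0 = 0"
  using \<theta>_scal[of 0 0] sn_spaceD(1)[OF sn_space_irrep] by simp

lemma \<theta>_sum: "(\<And>i. i \<in> A \<Longrightarrow> f i \<in> carrier (irrep n \<mu>)) \<Longrightarrow> \<theta> (sum f A) = (\<Sum>i\<in>A. \<theta> (f i))"
  by (induction A rule: infinite_finite_induct)
    (auto simp: \<theta>_0 \<theta>_add sn_space_sum[OF sn_space_irrep])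

lemma rep_y_subalgebra:
  assumes "b \<in> y_subalgebra n" "v \<in> carrier (irrep n \<mu>)"
  shows "rep n c b (\<theta> v) = \<theta> (y_trivial_act b v)"
proof -
  let ?V = "carrier (irrep n \<mu>)"
  let ?t = "\<lambda>k. case k of SM w g \<Rightarrow> if w = [] then scal (Poly_Mapping.lookup b k) * perm_elt g * v else 0"
  have k: "?t k \<in> ?V \<and> \<theta> (?t k) = sop (Poly_Mapping.lookup b k) (mop n c k (\<theta> v))"
    if kb: "k \<in> Poly_Mapping.keys b" for k
  proof -
    obtain w g where k: "k = SM w g" "set w \<subseteq> Y ` {1..n}" "g permutes {1..n}"
      using kb assms unfolding y_subalgebra_def by blast
    have g: "perm_elt g * v \<in> ?V" using sn_spaceD(4)[OF sn_space_irrep] k assms by blast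
    show ?thesis
    proof (cases w rule: rev_cases)
      case Nil
      then show ?thesis using k g assms sn_spaceD(3)[OF sn_space_irrep g]
        by (simp add: mult.assoc \<theta>_scal \<theta>_perm)
    next
      \<comment> \<open>Words act from the right: the last letter \<open>t\<close> is the first to
        meet a singular vector and, being some \<open>y_i\<close>, kills it. This agrees with
        \<open>y_trivial_act\<close>, which drops nonempty words.\<close>
      case (snoc w' t)
      then obtain i where t: "t = Y i" "i \<in> {1..n}" using k by auto
      have "foldr (genop n c) w' 0 = 0"
        using foldr_genop_sop[of n c w' 0 0] by simp
      then have "mop n c k (\<theta> v) = 0"
        using k snoc t \<theta>_y[OF g t(2)] \<theta>_perm[OF assms(2) k(3)] by simp
      then show ?thesis using k snoc by (simp add: \<theta>_0 sn_spaceD(1)[OF sn_space_irrep] op_simps)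
    qed
  qed
  have "\<theta> (y_trivial_act b v) = (\<Sum>k\<in>Poly_Mapping.keys b. \<theta> (?t k))"
    unfolding y_trivial_act_def using k by (intro \<theta>_sum) auto
  also have "\<dots> = rep n c b (\<theta> v)"
    unfolding rep_def lin_def using k by (intro sum.cong) auto
  finally show ?thesis by simp
qed

lemma fext_frag: "a \<in> carrier (smash_ring n) \<Longrightarrow> v \<in> carrier (irrep n \<mu>) \<Longrightarrow>
    fext n c \<theta> (frag_of (cls n c a, v)) = rep n c a (\<theta> v)"
  using \<theta>_pols by (intro fext_frag_of) (auto dest: pols_UNIV)

lemma fext_tker: "x \<in> tker n c \<mu> \<Longrightarrow> fext n c \<theta> x = 0"
proof (induction rule: tker_induct)
  case (rel x)
  then show ?case
  proof (cases rule: trels_cases)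
    case (ladd a b v)
    then show ?thesis by (simp add: fext_simps fext_frag smash_carrier_add rep_left_simps)
  next
    case (radd a v w)
    then show ?thesis
      by (simp add: fext_simps fext_frag \<theta>_add rep_simps sn_spaceD(2)[OF sn_space_irrep])
  next
    case (bal a b v)
    then show ?thesis
      by (simp add: fext_simps fext_frag smash_mult_closed y_subalgebra_carrier rep_mult
          rep_y_subalgebra y_trivial_act_closed[OF sn_space_irrep])
  qed
qed (simp_all add: fext_simps)

lemma dext_tcls:
  assumes "f \<in> tfree n c \<mu>"
  shows "dext n c \<theta> (tcls n c \<mu> f) = fext n c \<theta> f"
proof -
  let ?g = "SOME g. g \<in> tcls n c \<mu> f"
  have "f \<in> tcls n c \<mu> f" using tker_closed(1) by (force simp: tcls_def2)
  then have "?g \<in> tcls n c \<mu> f" by (rule someI)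
  then have "?g - f \<in> tker n c \<mu>" by (auto simp: tcls_def2)
  then show ?thesis using fext_tker[of "?g - f"] by (simp add: dext_def fext_simps)
qed

lemma fext_tmul:
  assumes "a \<in> carrier (smash_ring n)" "f \<in> tfree n c \<mu>"
  shows "fext n c \<theta> (tmul n c (cls n c a) f) = rep n c a (fext n c \<theta> f)"
  using assms(2)
  by (induction rule: tfree_induct)
    (simp_all add: fext_simps tmul_simps rep_simps tmul_frag_of fext_frag rep_mult smash_mult_closed assms)

lemma dext_pols: "x \<in> carrier (Delta n c \<mu>) \<Longrightarrow> dext n c \<theta> x \<in> pols n W"
proof -
  have "fext n c \<theta> f \<in> pols n W" if "f \<in> tfree n c \<mu>" for f
    using that
    by (induction rule: tfree_induct)
      (auto simp: fext_simps fext_frag \<theta>_pols intro: pols_0[OF W] pols_diff[OF W] pols_rep[OF W])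
  then show "x \<in> carrier (Delta n c \<mu>) \<Longrightarrow> dext n c \<theta> x \<in> pols n W"
    by (auto simp: Delta_carrier dext_tcls)
qed

lemma dext_add:
  "x \<in> carrier (Delta n c \<mu>) \<Longrightarrow> y \<in> carrier (Delta n c \<mu>) \<Longrightarrow>
    dext n c \<theta> (x \<oplus>\<^bsub>Delta n c \<mu>\<^esub> y) = dext n c \<theta> x + dext n c \<theta> y"
  by (auto simp: Delta_carrier dext_tcls Delta_add tfree_closed fext_simps)

lemma dext_act:
  "x \<in> carrier (Delta n c \<mu>) \<Longrightarrow> a \<in> carrier (smash_ring n) \<Longrightarrow>
    dext n c \<theta> (act n c \<mu> a x) = rep n c a (dext n c \<theta> x)"
  by (auto simp: Delta_carrier dext_tcls Delta_act tmul_tfree fext_tmul)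

lemma dext_zero: "dext n c \<theta> \<zero>\<^bsub>Delta n c \<mu>\<^esub> = 0"
  by (simp add: Delta_zero dext_tcls tfree_closed fext_simps)

lemma dext_iota: "v \<in> carrier (irrep n \<mu>) \<Longrightarrow> dext n c \<theta> (iota n c \<mu> v) = \<theta> v"
  by (simp add: iota_tcls dext_tcls frag_of_tfree smash_carrier_1 fext_frag)

end

lemma Delta_closed:
  shows "x \<in> carrier (Delta n c \<mu>) \<Longrightarrow> y \<in> carrier (Delta n c \<mu>) \<Longrightarrow> x \<oplus>\<^bsub>Delta n c \<mu>\<^esub> y \<in> carrier (Delta n c \<mu>)"
    "x \<in> carrier (Delta n c \<mu>) \<Longrightarrow> a \<in> carrier (smash_ring n) \<Longrightarrow> act n c \<mu> a x \<in> carrier (Delta n c \<mu>)"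
    "\<zero>\<^bsub>Delta n c \<mu>\<^esub> \<in> carrier (Delta n c \<mu>)"
  by (auto simp: Delta_carrier Delta_add Delta_act Delta_zero intro: tfree_closed tmul_tfree)

section \<open>Monomials in the \<open>x_i\<close> modulo the Cherednik relations\<close>

definition wd :: "gen list \<Rightarrow> smash" where
  "wd w = Poly_Mapping.single (SM w id) 1"

lemma wd_append: "wd (u @ w) = wd u * wd w"
  by (simp add: wd_def mult_single)

lemma wd_Nil [simp]: "wd [] = 1"
  by (simp add: wd_def flip: zero_smash_mon_def)

lemma wd_X: "wd [X k] = gx k"
  by (simp add: wd_def gx_def)

lemma wd_carrier: "set w \<subseteq> X ` {1..n} \<union> Y ` {1..n} \<Longrightarrow> wd w \<in> carrier (smash_ring n)"
  unfolding wd_def by (rule smash_carrier_single) (auto simp: smash_mons_def permutes_id)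

lemma cls_cong_mult:
  assumes "cls n c a = cls n c b" "x \<in> carrier (smash_ring n)"
  shows "cls n c (x * a) = cls n c (x * b)" "cls n c (a * x) = cls n c (b * x)"
  using assms cherednik_ideal_closed(5,6)[of "a - b" n c x]
  by (simp_all add: cls_eq_iff algebra_simps)

lemma cls_rel: "r - s \<in> cherednik_rels n c \<Longrightarrow> cls n c r = cls n c s"
  using cherednik_rels_ideal by (auto simp: cls_eq_iff)

lemma cherednik_rels_intros:
  assumes "i \<in> {1..n}" "j \<in> {1..n}"
  shows "gx i * gx j - gx j * gx i \<in> cherednik_rels n c"
    "i \<noteq> j \<Longrightarrow> gy i * gx j - gx j * gy i - scal c * transp i j \<in> cherednik_rels n c"
    "gy i * gx i - gx i * gy i - (1 - scal c * (\<Sum>j\<in>{1..n} - {i}. transp i j)) \<in> cherednik_rels n c"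
proof -
  show "gx i * gx j - gx j * gx i \<in> cherednik_rels n c"
    unfolding cherednik_rels_def
    by (rule UnI1, rule UnI1, rule UnI1) (rule CollectI, rule exI[of _ i], rule exI[of _ j], use assms in simp)
  show "gy i * gx j - gx j * gy i - scal c * transp i j \<in> cherednik_rels n c" if "i \<noteq> j"
    unfolding cherednik_rels_def
    by (rule UnI1, rule UnI2) (rule CollectI, rule exI[of _ i], rule exI[of _ j], use assms that in simp)
  show "gy i * gx i - gx i * gy i - (1 - scal c * (\<Sum>j\<in>{1..n} - {i}. transp i j)) \<in> cherednik_rels n c"
    unfolding cherednik_rels_def
    by (rule UnI2) (rule CollectI, rule exI[of _ i], use assms in simp)
qed

lemma cls_wd_move:
  assumes "set u \<subseteq> X ` {1..n}" "k \<in> {1..n}"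
  shows "cls n c (wd (X k # u)) = cls n c (wd (u @ [X k]))"
  using assms(1)
proof (induction u)
  case (Cons t u)
  then obtain j where t: "t = X j" "j \<in> {1..n}" by auto
  have u: "wd u \<in> carrier (smash_ring n)" using Cons.prems by (intro wd_carrier) auto
  have "cls n c (gx k * gx j) = cls n c (gx j * gx k)"
    using t assms by (intro cls_rel cherednik_rels_intros)
  from cls_cong_mult(2)[OF this u]
  have "cls n c (wd (X k # t # u)) = cls n c (gx j * wd (X k # u))"
    using wd_append[of "[X k]" "t # u"] wd_append[of "[t]" u] wd_append[of "[X k]" u] t
    by (simp add: wd_X mult.assoc)
  also have "\<dots> = cls n c (gx j * wd (u @ [X k]))"
    using Cons t by (intro cls_cong_mult smash_carrier_gx) auto
  also have "gx j * wd (u @ [X k]) = wd ((t # u) @ [X k])"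
    using wd_append[of "[t]" "u @ [X k]"] t by (simp add: wd_X)
  finally show ?case .
qed simp

text \<open>Modulo the relations the \<open>x_i\<close> commute, so a word in them is determined by
  its letter counts.\<close>

lemma cls_wd_mset:
  assumes "mset w = mset w'" "set w \<subseteq> X ` {1..n}"
  shows "cls n c (wd w) = cls n c (wd w')"
  using assms
proof (induction w arbitrary: w')
  case (Cons t w)
  then obtain k where t: "t = X k" "k \<in> {1..n}" by auto
  have "t \<in> set w'" using Cons.prems(1) by (metis list.set_intros(1) set_mset_mset)
  then obtain u1 u2 where w': "w' = u1 @ t # u2" by (meson split_list)
  have m: "mset w = mset (u1 @ u2)" using Cons.prems(1) w' by simp
  then have s: "set (u1 @ u2) \<subseteq> X ` {1..n}" using Cons.prems(2) by (metis insert_subset list.simps(15) mset_eq_setD)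
  have "wd (t # w) = gx k * wd w" using wd_append[of "[t]" w] t by (simp add: wd_X)
  also have "cls n c (gx k * wd w) = cls n c (gx k * wd (u1 @ u2))"
    using Cons.IH[OF m] Cons.prems t by (intro cls_cong_mult smash_carrier_gx) auto
  also have "gx k * wd (u1 @ u2) = wd (X k # u1) * wd u2"
    using wd_append[of "[X k]" u1] by (simp add: wd_X wd_append mult.assoc)
  also have "cls n c (wd (X k # u1) * wd u2) = cls n c (wd (u1 @ [X k]) * wd u2)"
    using s t by (intro cls_cong_mult cls_wd_move wd_carrier) auto
  also have "wd (u1 @ [X k]) * wd u2 = wd w'" using w' t by (simp flip: wd_append)
  finally show ?case .
qed simp

definition xword :: "nat \<Rightarrow> (nat \<Rightarrow> nat) \<Rightarrow> gen list" where
  "xword n a = concat (map (\<lambda>i. replicate (a i) (X i)) [1..<Suc n])"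

lemma x_monomial_wd: "x_monomial n a = wd (xword n a)"
  by (simp add: x_monomial_def wd_def xword_def)

lemma set_xword: "set (xword n a) \<subseteq> X ` {1..n}"
  by (auto simp: xword_def)

lemma x_monomial_carrier: "x_monomial n a \<in> carrier (smash_ring n)"
  unfolding x_monomial_wd using set_xword by (intro wd_carrier) blast

lemma count_xword: "a \<in> exponents n \<Longrightarrow> count (mset (xword n a)) (X k) = a k"
proof -
  assume a: "a \<in> exponents n"
  have "count (mset (concat (map (\<lambda>i. replicate (a i) (X i)) xs))) (X k) = (\<Sum>i\<leftarrow>xs. if i = k then a i else 0)" for xs
    by (induction xs) auto
  then have "count (mset (xword n a)) (X k) = (\<Sum>i\<in>{1..<Suc n}. if i = k then a i else 0)"
    by (simp only: xword_def interv_sum_list_conv_sum_set_nat set_upt)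
  then show ?thesis using a by (auto simp: exponents_def)
qed

lemma xword_cong_mset:
  assumes "set w \<subseteq> X ` {1..n}" "a \<in> exponents n" "\<And>k. count (mset w) (X k) = a k"
  shows "cls n c (wd w) = cls n c (x_monomial n a)"
  unfolding x_monomial_wd
proof (rule cls_wd_mset[OF _ assms(1)])
  show "mset w = mset (xword n a)"
  proof (rule multiset_eqI)
    fix t
    show "count (mset w) t = count (mset (xword n a)) t"
    proof (cases t)
      case (X k)
      then show ?thesis using assms count_xword by simp
    next
      case (Y k)
      then have "t \<notin> set w" "t \<notin> set (xword n a)" using assms(1) set_xword by blast+
      then show ?thesis by (metis count_mset_0_iff)
    qed
  qed
qed

lemma cls_gx_x_monomial:
  assumes "a \<in> exponents n" "k \<in> {1..n}"
  shows "cls n c (gx k * x_monomial n a) = cls n c (x_monomial n (a(k := Suc (a k))))"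
proof -
  have "gx k * x_monomial n a = wd (X k # xword n a)"
    using wd_append[of "[X k]" "xword n a"] by (simp add: wd_X x_monomial_wd)
  moreover have "cls n c (wd (X k # xword n a)) = cls n c (x_monomial n (a(k := Suc (a k))))"
    using assms set_xword[of n a] by (intro xword_cong_mset) (auto simp: exponents_def count_xword)
  ultimately show ?thesis by simp
qed

text \<open>Renaming letters by \<open>g\<close> need not give the ordered word behind
  \<open>x_monomial\<close>, but it gives one with the same letter counts.\<close>

lemma cls_perm_x_monomial:
  assumes "a \<in> exponents n" "g permutes {1..n}"
  shows "cls n c (perm_elt g * x_monomial n a) = cls n c (x_monomial n (exp_act g a) * perm_elt g)"
proof -
  let ?w = "map (gen_act g) (xword n a)"
  have b: "bij g" using assms permutes_bij by blast
  have "perm_elt g * x_monomial n a = wd ?w * perm_elt g"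
    by (simp add: x_monomial_wd wd_def perm_elt_def mult_single)
  moreover have "cls n c (wd ?w) = cls n c (x_monomial n (exp_act g a))"
  proof (rule xword_cong_mset)
    show "set ?w \<subseteq> X ` {1..n}"
    proof
      fix t assume "t \<in> set ?w"
      then obtain k where "t = X (g k)" "k \<in> {1..n}" using set_xword[of n a] by fastforce
      then show "t \<in> X ` {1..n}" using permutes_in_image[OF assms(2), of k] by blast
    qed
    show "exp_act g a \<in> exponents n" by (rule exp_act_exponents[OF assms(2,1)])
    fix k
    have i: "inj (gen_act g)"
    proof (rule injI)
      fix s t assume "gen_act g s = gen_act g t"
      then show "s = t" using b by (cases s; cases t) (auto simp: bij_is_inj inj_eq)
    qed
    have count_image_inj: "count (image_mset (gen_act g) M) (gen_act g t) = count M t" for M t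
      by (induction M) (auto simp: inj_eq[OF i])
    have "X k = gen_act g (X (inv_into UNIV g k))" using b by (simp add: bij_is_surj surj_f_inv_f)
    then have "count (mset ?w) (X k) = count (mset (xword n a)) (X (inv_into UNIV g k))"
      using count_image_inj[of "mset (xword n a)" "X (inv_into UNIV g k)"] by simp
    then show "count (mset ?w) (X k) = exp_act g a k" using assms by (simp add: count_xword exp_act_def)
  qed
  ultimately show ?thesis using cls_cong_mult(2) smash_carrier_perm[OF assms(2)] by metis
qed

lemma exp_act_id [simp]: "exp_act id a = a"
  by (simp add: exp_act_def)

lemma rep_x_monomial:
  assumes "a \<in> exponents n"
  shows "rep n c (x_monomial n a) (mon (\<lambda>_. 0) v) = mon a v"
proof -
  have "foldr (genop n c) w (mon b v) = mon (\<lambda>k. b k + count (mset w) (X k)) v"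
    if "set w \<subseteq> range X" for w b
    using that
  proof (induction w)
    case (Cons t w)
    then obtain j where t: "t = X j" "set w \<subseteq> range X" by auto
    have "(\<lambda>k. b k + count (mset w) (X k))(j := Suc (b j + count (mset w) (X j))) = (\<lambda>k. b k + count (mset (t # w)) (X k))"
      using t by (auto simp: fun_eq_iff)
    then show ?case using Cons t by simp
  qed simp
  from this[of "xword n a" "\<lambda>_. 0"] set_xword[of n a] show ?thesis
    using assms by (auto simp: x_monomial_wd wd_def rep_single count_xword)
qed

text \<open>The span of the \<open>x\<^sup>a \<otimes> v\<close>, which turns out to be everything.\<close>

inductive_set xspan :: "nat \<Rightarrow> complex \<Rightarrow> nat list \<Rightarrow> frag set" for n c \<mu> where
  ker: "f \<in> tker n c \<mu> \<Longrightarrow> f \<in> xspan n c \<mu>"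
| mon: "a \<in> exponents n \<Longrightarrow> v \<in> carrier (irrep n \<mu>) \<Longrightarrow> frag_of (cls n c (x_monomial n a), v) \<in> xspan n c \<mu>"
| diff: "f \<in> xspan n c \<mu> \<Longrightarrow> g \<in> xspan n c \<mu> \<Longrightarrow> f - g \<in> xspan n c \<mu>"

lemma xspan_add: "f \<in> xspan n c \<mu> \<Longrightarrow> g \<in> xspan n c \<mu> \<Longrightarrow> f + g \<in> xspan n c \<mu>"
  using xspan.diff[of f n c \<mu> "0 - g"] xspan.diff[of 0 n c \<mu> g] xspan.ker[OF tker_closed(1)] by simp

lemma xspan_cong: "f - g \<in> tker n c \<mu> \<Longrightarrow> g \<in> xspan n c \<mu> \<Longrightarrow> f \<in> xspan n c \<mu>"
  using xspan_add[of "f - g" n c \<mu> g] xspan.ker by simp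

lemma xspan_tfree: "f \<in> xspan n c \<mu> \<Longrightarrow> f \<in> tfree n c \<mu>"
  by (induction rule: xspan.induct)
    (auto intro: tker_closed tfree_closed frag_of_tfree x_monomial_carrier)

lemma tmul_tmul:
  assumes "a \<in> carrier (smash_ring n)" "b \<in> carrier (smash_ring n)" "f \<in> tfree n c \<mu>"
  shows "tmul n c (cls n c a) (tmul n c (cls n c b) f) = tmul n c (cls n c (a * b)) f"
  using assms(3)
  by (induction rule: tfree_induct)
    (simp_all add: tmul_simps tmul_frag_of assms smash_mult_closed mult.assoc)

text \<open>Additivity in the multiplier is claimed only modulo the kernel: distinct cosets give
  independent generators of the free group.\<close>

lemma tmul_plus:
  assumes "a \<in> carrier (smash_ring n)" "b \<in> carrier (smash_ring n)" "f \<in> tfree n c \<mu>"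
  shows "tmul n c (cls n c (a + b)) f - (tmul n c (cls n c a) f + tmul n c (cls n c b) f) \<in> tker n c \<mu>"
  using assms(3)
proof (induction rule: tfree_induct)
  case (frag e v)
  then show ?case
    using trels_intros(1)[of "a * e" n v \<mu> "b * e" c] assms
    by (simp add: tmul_frag_of smash_carrier_add smash_mult_closed distrib_right tker_closed(2) diff_diff_eq)
next
  case (diff f g)
  then show ?case
    using tker_closed(5)[OF diff(3,4)] by (simp add: tmul_simps algebra_simps)
qed (simp add: tmul_simps tker_closed)

context
  fixes n :: nat and c :: complex and \<mu> :: "nat list"
begin

text \<open>Such elements are closed under sums and products, so that it suffices to treat the
  generators of the smash ring.\<close>

definition good :: "smash \<Rightarrow> bool" where
  "good a \<longleftrightarrow> a \<in> carrier (smash_ring n) \<and> (\<forall>f\<in>xspan n c \<mu>. tmul n c (cls n c a) f \<in> xspan n c \<mu>)"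

lemma goodI:
  assumes a: "a \<in> carrier (smash_ring n)"
    and "\<And>b v. b \<in> exponents n \<Longrightarrow> v \<in> carrier (irrep n \<mu>) \<Longrightarrow>
      frag_of (cls n c (a * x_monomial n b), v) \<in> xspan n c \<mu>"
  shows "good a"
proof -
  have "tmul n c (cls n c a) f \<in> xspan n c \<mu>" if "f \<in> xspan n c \<mu>" for f
    using that
    by induction (use assms in \<open>auto simp: tmul_simps tmul_frag_of x_monomial_carrier intro: xspan.intros tmul_tker\<close>)
  then show ?thesis using a by (simp add: good_def)
qed

lemma good_frag:
  "good a \<Longrightarrow> b \<in> carrier (smash_ring n) \<Longrightarrow> frag_of (cls n c b, v) \<in> xspan n c \<mu> \<Longrightarrow> frag_of (cls n c (a * b), v) \<in> xspan n c \<mu>"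
  using tmul_frag_of[of a n b c v] by (auto simp: good_def)

lemma good_mult: "good a \<Longrightarrow> good b \<Longrightarrow> good (a * b)"
  by (simp add: good_def smash_mult_closed xspan_tfree flip: tmul_tmul[of a n b _ c \<mu>])

lemma good_add: "good a \<Longrightarrow> good b \<Longrightarrow> good (a + b)"
  using tmul_plus[of a n b _ c \<mu>]
  by (auto simp: good_def smash_carrier_add xspan_tfree intro!: xspan_cong[OF tmul_plus] xspan_add)

text \<open>Balancing moves \<open>h\<close> across the tensor sign onto \<open>v\<close>.\<close>

lemma frag_of_perm_xspan:
  assumes "b \<in> exponents n" "v \<in> carrier (irrep n \<mu>)" "h \<in> y_subalgebra n"
  shows "frag_of (cls n c (x_monomial n b * h), v) \<in> xspan n c \<mu>"
  by (rule xspan_cong[OF tker_closed(2)[OF trels_intros(3)] xspan.mon])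
    (use assms in \<open>auto intro: x_monomial_carrier y_trivial_act_closed[OF sn_space_irrep]\<close>)

lemma good_gx: "k \<in> {1..n} \<Longrightarrow> good (gx k)"
  by (rule goodI[OF smash_carrier_gx])
    (auto simp: cls_gx_x_monomial exponents_def intro!: xspan.mon)

lemma good_perm: "g permutes {1..n} \<Longrightarrow> good (perm_elt g)"
  by (rule goodI[OF smash_carrier_perm])
    (auto simp: cls_perm_x_monomial intro!: frag_of_perm_xspan exp_act_exponents perm_elt_y_subalgebra simp del: One_nat_def)

lemma good_scal: "good (scal z)"
  by (rule goodI[OF smash_carrier_scal])
    (auto simp: scal_commute[symmetric] intro!: frag_of_perm_xspan scal_y_subalgebra)

lemma good_transp: "i \<in> {1..n} \<Longrightarrow> j \<in> {1..n} \<Longrightarrow> good (transp i j)"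
  unfolding transp_def by (intro good_perm permutes_swap_id)

lemma good_0: "good 0" using good_scal[of 0] by simp

lemma good_sum: "(\<And>i. i \<in> A \<Longrightarrow> good (f i)) \<Longrightarrow> good (sum f A)"
  by (induction A rule: infinite_finite_induct) (auto intro: good_add good_0)

lemma good_uminus: "good a \<Longrightarrow> good (- a)"
  using good_mult[OF good_scal, of a "- 1"] by (simp add: scal_minus)

lemma x_monomial_zero: "x_monomial n (\<lambda>_. 0) = 1"
proof -
  have "concat (map (\<lambda>i. []) xs) = ([] :: gen list)" for xs :: "nat list" by (induction xs) auto
  then show ?thesis by (simp only: x_monomial_wd xword_def replicate_0 wd_Nil)
qed

text \<open>\<open>y_i\<close> is moved to the right through one variable at a time. Each step
  leaves a commutator \<open>r\<close> in the group algebra, which is good; once \<open>y_i\<close>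
  stands next to \<open>v\<close>, balancing applies.\<close>

lemma good_gy: assumes i: "i \<in> {1..n}" shows "good (gy i)"
proof (rule goodI[OF smash_carrier_gy[OF i]])
  fix b v assume b: "b \<in> exponents n" and v: "v \<in> carrier (irrep n \<mu>)"
  show "frag_of (cls n c (gy i * x_monomial n b), v) \<in> xspan n c \<mu>"
    using b
  proof (induction rule: exponents_induct)
    case zero
    have "frag_of (cls n c (x_monomial n (\<lambda>_. 0) * gy i), v) \<in> xspan n c \<mu>"
      using v by (intro frag_of_perm_xspan gy_y_subalgebra i) (auto simp: exponents_def)
    then show ?case by (simp add: x_monomial_zero)
  next
    case (Suc b k)
    define r where "r = (if i = k then 1 + scal c * - (\<Sum>j\<in>{1..n} - {i}. transp i j) else scal c * transp i k)"
    have "good (1 + scal c * - (\<Sum>j\<in>{1..n} - {i}. transp i j))"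
      using i good_scal[of 1]
      by (intro good_add good_mult good_scal good_uminus good_sum good_transp) auto
    moreover have "good (scal c * transp i k)" using i Suc(2) by (intro good_mult good_scal good_transp)
    ultimately have r: "good r" by (cases "i = k") (auto simp only: r_def simp_thms if_True if_False)
    have "gy i * gx k - (gx k * gy i + r) \<in> cherednik_rels n c"
      using cherednik_rels_intros(2)[OF i Suc(2)] cherednik_rels_intros(3)[OF i i, of c]
      by (auto simp: r_def diff_diff_eq)
    then have "cls n c (gy i * gx k) = cls n c (gx k * gy i + r)" by (rule cls_rel)
    from cls_cong_mult(2)[OF this x_monomial_carrier[of n b]]
    have e: "cls n c (gy i * (gx k * x_monomial n b)) = cls n c (gx k * (gy i * x_monomial n b) + r * x_monomial n b)"
      by (simp add: algebra_simps)
    have "cls n c (gy i * x_monomial n (b(k := Suc (b k)))) = cls n c (gy i * (gx k * x_monomial n b))"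
      using cls_gx_x_monomial[OF Suc(1,2), of c] by (intro cls_cong_mult smash_carrier_gy i) simp
    note e = this[unfolded e]
    have x: "frag_of (cls n c (gx k * (gy i * x_monomial n b)), v) \<in> xspan n c \<mu>"
      by (rule good_frag[OF good_gx[OF Suc(2)] smash_mult_closed[OF smash_carrier_gy[OF i] x_monomial_carrier] Suc(3)])
    have y: "frag_of (cls n c (r * x_monomial n b), v) \<in> xspan n c \<mu>"
      using r Suc(1) v by (intro good_frag x_monomial_carrier xspan.mon)
    have "frag_of (cls n c (gx k * (gy i * x_monomial n b) + r * x_monomial n b), v) \<in> xspan n c \<mu>"
      using trels_intros(1)[of "gx k * (gy i * x_monomial n b)" n v \<mu> "r * x_monomial n b" c] v i Suc(2) r
      by (intro xspan_cong[OF _ xspan_add[OF x y]] tker_closed(2))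
        (simp add: diff_diff_eq good_def smash_carrier_intros x_monomial_carrier)
    then show ?case unfolding e .
  qed
qed

lemma good_carrier: "a \<in> carrier (smash_ring n) \<Longrightarrow> good a"
proof (rule poly_mapping_sum_induct[where P = good])
  fix k assume a: "a \<in> carrier (smash_ring n)" and "k \<in> Poly_Mapping.keys a"
  then obtain w g where k: "k = SM w g" "set w \<subseteq> X ` {1..n} \<union> Y ` {1..n}" "g permutes {1..n}"
    unfolding smash_carrier smash_mons_def by blast
  have "good (wd w)" using k(2)
  proof (induction w)
    case Nil
    then show ?case using good_scal[of 1] by simp
  next
    case (Cons t w)
    then have "good (wd [t])" using good_gx good_gy by (auto simp: wd_def gx_def gy_def)
    then show ?case using Cons good_mult wd_append[of "[t]" w] by simp
  qed
  then have "good (scal (Poly_Mapping.lookup a k) * (wd w * perm_elt g))"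
    using k by (intro good_mult good_scal good_perm)
  then show "good (Poly_Mapping.single k (Poly_Mapping.lookup a k))"
    using k by (simp add: scal_def wd_def perm_elt_def mult_single)
qed (auto intro: good_0 good_add)

lemma tfree_xspan: "f \<in> tfree n c \<mu> \<Longrightarrow> f \<in> xspan n c \<mu>"
proof (induction rule: tfree_induct)
  case zero
  then show ?case by (intro xspan.ker tker_closed)
next
  case (frag a v)
  have "frag_of (cls n c (x_monomial n (\<lambda>_. 0)), v) \<in> xspan n c \<mu>"
    using frag by (intro xspan.mon) (auto simp: exponents_def)
  then show ?case using good_frag[OF good_carrier[OF frag(1)] smash_carrier_1, of v]
    by (simp add: x_monomial_zero)
qed (rule xspan.diff)

end

section \<open>Polynomials as normal forms for the standard module\<close>

lemma frag_of_diff_tker: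
  assumes "a \<in> carrier (smash_ring n)" "v \<in> carrier (irrep n \<mu>)" "w \<in> carrier (irrep n \<mu>)"
  shows "frag_of (cls n c a, v - w) - (frag_of (cls n c a, v) - frag_of (cls n c a, w)) \<in> tker n c \<mu>"
proof -
  have "v - w \<in> carrier (irrep n \<mu>)" using assms sn_spaceD(6)[OF sn_space_irrep] by blast
  from tker_closed(4)[OF tker_closed(2)[OF trels_intros(2)[OF assms(1) this assms(3), of c]]]
  show ?thesis by (simp add: algebra_simps)
qed

lemma frag_of_zero_tker:
  assumes "a \<in> carrier (smash_ring n)"
  shows "frag_of (cls n c a, 0) \<in> tker n c \<mu>"
  using frag_of_diff_tker[OF assms, of 0 \<mu> 0 c] sn_spaceD(1)[OF sn_space_irrep] by simp

text \<open>The candidate inverse of the passage to polynomials, additive only modulo the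
  kernel.\<close>

definition pol_frag :: "nat \<Rightarrow> complex \<Rightarrow> pol \<Rightarrow> frag" where
  "pol_frag n c h = (\<Sum>a\<in>Poly_Mapping.keys h. frag_of (cls n c (x_monomial n a), coef h a))"

lemma tker_sum: "(\<And>i. i \<in> A \<Longrightarrow> f i \<in> tker n c \<mu>) \<Longrightarrow> sum f A \<in> tker n c \<mu>"
  by (induction A rule: infinite_finite_induct) (auto intro: tker_closed)

lemma pol_frag_diff:
  assumes "h \<in> pols n (carrier (irrep n \<mu>))" "h' \<in> pols n (carrier (irrep n \<mu>))"
  shows "pol_frag n c (h - h') - (pol_frag n c h - pol_frag n c h') \<in> tker n c \<mu>"
proof -
  let ?U = "Poly_Mapping.keys h \<union> Poly_Mapping.keys h'"
  let ?F = "\<lambda>h a. frag_of (cls n c (x_monomial n a), coef h a)"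
  \<comment> \<open>Enlarging the index set to \<open>?U\<close> only adds tensors with second
    factor \<open>0\<close>, which lie in the kernel. Afterwards the three sums to be compared run
    over the same exponents.\<close>
  have *: "pol_frag n c g - (\<Sum>a\<in>?U. ?F g a) \<in> tker n c \<mu>" if "Poly_Mapping.keys g \<subseteq> ?U" for g
  proof -
    have "(\<Sum>a\<in>?U. ?F g a) = pol_frag n c g + (\<Sum>a\<in>?U - Poly_Mapping.keys g. ?F g a)"
      unfolding pol_frag_def using sum.subset_diff[OF that, of "?F g"] by simp
    moreover have "(\<Sum>a\<in>?U - Poly_Mapping.keys g. ?F g a) \<in> tker n c \<mu>"
      by (rule tker_sum) (auto simp: in_keys_iff intro: frag_of_zero_tker x_monomial_carrier)
    ultimately show ?thesis using tker_closed(4) by fastforce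
  qed
  have "(\<Sum>a\<in>?U. ?F (h - h') a - (?F h a - ?F h' a)) \<in> tker n c \<mu>"
    unfolding lookup_minus
    by (intro tker_sum frag_of_diff_tker x_monomial_carrier coef_pols[OF assms(1)] coef_pols[OF assms(2)])
  then have "(\<Sum>a\<in>?U. ?F (h - h') a) - ((\<Sum>a\<in>?U. ?F h a) - (\<Sum>a\<in>?U. ?F h' a)) \<in> tker n c \<mu>"
    by (simp add: sum_subtractf)
  from tker_closed(3)[OF tker_closed(3)[OF this *[of "h - h'"]] tker_closed(5)[OF *[of h'] *[of h]]]
  show ?thesis using keys_diff[of h h'] by (simp add: algebra_simps)
qed

text \<open>Constants are singular and form a copy of \<open>irrep n \<mu>\<close>; the universal
  property applied to them yields \<open>to_pol\<close>.\<close>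

interpretation const_map: singular_map n c \<mu> "carrier (irrep n \<mu>)" "mon (\<lambda>_. 0)" for n c \<mu>
proof -
  have z: "exp_act g (\<lambda>_. 0) = (\<lambda>_. 0)" for g by (auto simp: exp_act_def)
  show "singular_map n c \<mu> (carrier (irrep n \<mu>)) (mon (\<lambda>_. 0))"
    by unfold_locales
      (auto simp: sn_space_irrep single_add z exponents_def simp del: yop_mon intro!: pols_mon[OF sn_space_irrep])
qed

abbreviation to_pol :: "nat \<Rightarrow> complex \<Rightarrow> std_elt \<Rightarrow> pol" where
  "to_pol n c \<equiv> dext n c (mon (\<lambda>_. 0))"

text \<open>One half of a Poincare-Birkhoff-Witt statement: \<open>pol_frag\<close> recovers a
  formal sum modulo the kernel, since it does so on the spanning monomials and the property passes
  to differences. Injectivity of \<open>to_pol\<close> follows.\<close>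

lemma tker_of_pol_frag:
  assumes "f \<in> tfree n c \<mu>"
  shows "f - pol_frag n c (fext n c (mon (\<lambda>_. 0)) f) \<in> tker n c \<mu>"
  using tfree_xspan[OF assms]
proof induction
  case (ker f)
  then show ?case using const_map.fext_tker by (simp add: pol_frag_def)
next
  case (mon a v)
  then have "fext n c (Poly_Mapping.single (\<lambda>_. 0)) (frag_of (cls n c (x_monomial n a), v)) = Poly_Mapping.single a v"
    using const_map.fext_frag x_monomial_carrier rep_x_monomial by metis
  then show ?case
    by (cases "v = 0") (auto simp: pol_frag_def tker_closed intro: frag_of_zero_tker x_monomial_carrier)
next
  case (diff f g)
  have p: "fext n c (mon (\<lambda>_. 0)) h \<in> pols n (carrier (irrep n \<mu>))" if "h \<in> xspan n c \<mu>" for h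
    using that xspan_tfree const_map.dext_pols[of "tcls n c \<mu> h" n c \<mu>] const_map.dext_tcls[of h n c \<mu>]
    by (simp add: Delta_carrier)
  show ?case
    using tker_closed(5)[OF tker_closed(5)[OF diff.IH] pol_frag_diff[OF p[OF diff.hyps(1)] p[OF diff.hyps(2)]]]
    by (simp add: fext_simps algebra_simps)
qed

lemma to_pol_inj: "inj_on (to_pol n c) (carrier (Delta n c \<mu>))"
proof (rule inj_onI)
  fix x y assume "x \<in> carrier (Delta n c \<mu>)" "y \<in> carrier (Delta n c \<mu>)" and e: "to_pol n c x = to_pol n c y"
  then obtain f g where f: "x = tcls n c \<mu> f" "f \<in> tfree n c \<mu>" and g: "y = tcls n c \<mu> g" "g \<in> tfree n c \<mu>"
    by (auto simp: Delta_carrier)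
  then have "fext n c (mon (\<lambda>_. 0)) (f - g) = 0" using e by (simp add: const_map.dext_tcls fext_simps)
  then have "f - g \<in> tker n c \<mu>"
    using tker_of_pol_frag[OF tfree_closed(4)[OF f(2) g(2)]] by (simp add: pol_frag_def)
  then show "x = y" using f g by (simp add: tcls_eq_iff)
qed

lemma to_pol_surj: "h \<in> pols n (carrier (irrep n \<mu>)) \<Longrightarrow> \<exists>x\<in>carrier (Delta n c \<mu>). to_pol n c x = h"
proof (rule poly_mapping_sum_induct[where P = "\<lambda>h. \<exists>x\<in>carrier (Delta n c \<mu>). to_pol n c x = h"])
  show "\<exists>x\<in>carrier (Delta n c \<mu>). to_pol n c x = 0"
    using Delta_closed(3) const_map.dext_zero by blast
  fix a assume "h \<in> pols n (carrier (irrep n \<mu>))" "a \<in> Poly_Mapping.keys h"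
  then have "a \<in> exponents n" "coef h a \<in> carrier (irrep n \<mu>)" by (auto simp: pols_def)
  then show "\<exists>x\<in>carrier (Delta n c \<mu>). to_pol n c x = mon a (coef h a)"
    by (intro bexI[of _ "act n c \<mu> (x_monomial n a) (iota n c \<mu> (coef h a))"] Delta_closed iota_carrier x_monomial_carrier)
      (simp add: const_map.dext_act iota_carrier x_monomial_carrier const_map.dext_iota rep_x_monomial)
next
  fix g h assume "\<exists>x\<in>carrier (Delta n c \<mu>). to_pol n c x = g" "\<exists>x\<in>carrier (Delta n c \<mu>). to_pol n c x = h"
  then show "\<exists>x\<in>carrier (Delta n c \<mu>). to_pol n c x = g + h"
    using Delta_closed(1) const_map.dext_add by metis
qed

section \<open>The commuting elements \<open>u\<^sub>i\<close>\<close>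

text \<open>\<open>u_i\<close> splits as \<open>z_i - c J_i\<close>, where
  \<open>z_i = x_i y_i\<close> and \<open>J_i\<close> is a Jucys-Murphy element. The gain is that
  the group simply permutes the \<open>z_i\<close>.\<close>

definition zop :: "nat \<Rightarrow> complex \<Rightarrow> nat \<Rightarrow> pol \<Rightarrow> pol" where
  "zop n c i f = xop i (yop n c i f)"

definition jop :: "nat \<Rightarrow> pol \<Rightarrow> pol" where
  "jop i f = (\<Sum>j\<in>{1..<i}. pop (transpose i j) f)"

definition uop :: "nat \<Rightarrow> complex \<Rightarrow> nat \<Rightarrow> pol \<Rightarrow> pol" where
  "uop n c i f = zop n c i f - sop c (jop i f)"

lemma additive_zop: "additive (zop n c i)"
  by (simp add: additive_def zop_def op_simps)

lemma additive_jop: "additive (jop i)"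
  by (simp add: additive_def jop_def op_simps sum.distrib)

lemma additive_uop: "additive (uop n c i)"
  by (simp add: additive_def uop_def additive.add[OF additive_zop] additive.add[OF additive_jop] op_simps)

lemmas zop_simps = additive.zero[OF additive_zop] additive.add[OF additive_zop]
  additive.diff[OF additive_zop] additive.minus[OF additive_zop]
lemmas jop_simps = additive.zero[OF additive_jop] additive.add[OF additive_jop]
  additive.diff[OF additive_jop] additive.minus[OF additive_jop]
lemmas uop_simps = additive.zero[OF additive_uop] additive.add[OF additive_uop]
  additive.diff[OF additive_uop] additive.minus[OF additive_uop]

lemma zop_sop: "zop n c i (sop z f) = sop z (zop n c i f)"
  by (simp add: zop_def xop_sop yop_sop)

lemma jop_sop: "jop i (sop z f) = sop z (jop i f)"
  by (simp add: jop_def pop_sop op_sum)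

lemma uop_sop: "uop n c i (sop z f) = sop z (uop n c i f)"
  by (simp add: uop_def zop_sop jop_sop sop_sop op_simps mult.commute)

lemma rep_u_elt:
  assumes "i \<in> {1..n}"
  shows "u_elt c i \<in> carrier (smash_ring n)" "rep n c' (u_elt c i) f = xop i (yop n c' i f) - sop c (jop i f)"
proof -
  have t: "(\<Sum>j\<in>{1..<i}. transp i j) \<in> carrier (smash_ring n)"
    using assms by (intro smash_carrier_sum smash_carrier_transp) auto
  then show "u_elt c i \<in> carrier (smash_ring n)"
    using assms unfolding u_elt_def by (intro smash_carrier_intros) auto
  show "rep n c' (u_elt c i) f = xop i (yop n c' i f) - sop c (jop i f)"
    using assms t by (simp add: u_elt_def rep_left_simps rep_mult smash_carrier_intros jop_def)
qed

lemma rep_u: "i \<in> {1..n} \<Longrightarrow> rep n c (u_elt c i) f = uop n c i f"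
  by (simp add: rep_u_elt uop_def zop_def)

lemma pols_uop: "sn_space n V \<Longrightarrow> i \<in> {1..n} \<Longrightarrow> f \<in> pols n V \<Longrightarrow> uop n c i f \<in> pols n V"
  using pols_rep rep_u_elt(1) rep_u by metis

lemma pop_zop: "g permutes {1..n} \<Longrightarrow> pop g (zop n c i f) = zop n c (g i) (pop g f)"
  by (simp add: zop_def pop_xop pop_yop permutes_bij)

lemma transpose_permutes: "i \<in> {1..n} \<Longrightarrow> j \<in> {1..n} \<Longrightarrow> transpose i j permutes {1..n}"
  by (rule permutes_swap_id)

text \<open>Moving a \<open>y\<close> past the other \<open>x\<close> produces one term with
  \<open>c s_ij\<close> in each product, while the terms \<open>x_i x_j y_i y_j\<close>
  cancel.\<close>

lemma zop_zop:
  assumes ij: "i \<in> {1..n}" "j \<in> {1..n}" "i \<noteq> j" and f: "f \<in> pols n UNIV"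
  shows "zop n c i (zop n c j f) - zop n c j (zop n c i f) =
    sop c (zop n c i (pop (transpose i j) f) - pop (transpose i j) (zop n c i f))"
proof -
  let ?s = "transpose i j"
  have s: "?s permutes {1..n}" using ij by (intro transpose_permutes)
  have a: "zop n c p (zop n c q f) = xop p (xop q (yop n c p (yop n c q f))) + sop c (zop n c p (pop (transpose p q) f))"
    if "p \<in> {1..n}" "q \<in> {1..n}" "p \<noteq> q" for p q
  proof -
    have "pop (transpose p q) (yop n c q f) = yop n c p (pop (transpose p q) f)"
      using pop_yop[OF transpose_permutes[OF that(1,2)], of c q f] by simp
    then show ?thesis unfolding zop_def using that by (simp add: yop_xop op_simps xop_sop)
  qed
  have "yop n c i (yop n c j f) = yop n c j (yop n c i f)"
    using ij f by (intro yop_commute) (auto simp: pols_def)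
  moreover have "pop ?s (zop n c i f) = zop n c j (pop ?s f)" using pop_zop[OF s] by simp
  ultimately show ?thesis
    using ij a[of i j] a[of j i]
    by (simp add: op_simps transpose_commute[of j i] xop_commute[of i j])
qed

lemma pop_transpose_conj:
  assumes "bij g"
  shows "pop g (pop (transpose i j) f) = pop (transpose (g i) (g j)) (pop g f)"
  using assms by (simp add: pop_pop transpose_comp_eq bij_is_inj)

lemma pop_jop:
  assumes "bij g"
  shows "pop g (jop i f) = (\<Sum>j\<in>g ` {1..<i}. pop (transpose (g i) j) (pop g f))"
  unfolding jop_def op_sum pop_transpose_conj[OF assms]
  by (subst sum.reindex) (auto intro: inj_on_subset[OF bij_is_inj[OF assms]])

lemma pop_jop_fixed:
  assumes "bij g" "g i = i" "g ` {1..<i} = {1..<i}"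
  shows "pop g (jop i f) = jop i (pop g f)"
  using pop_jop[OF assms(1), of i f] unfolding assms(2,3) jop_def .

lemma transpose_image: "p \<in> A \<Longrightarrow> q \<in> A \<Longrightarrow> transpose p q ` A = A"
  by (rule permutes_image) (rule permutes_swap_id)

lemma transpose_image_other: "p \<notin> A \<Longrightarrow> q \<notin> A \<Longrightarrow> transpose p q ` A = A"
  by (force simp: transpose_def image_iff)

text \<open>For \<open>i < j\<close> the commutator \<open>[z_i, z_j]\<close> cancels against
  \<open>c [z_i, J_j]\<close>, because \<open>(i j)\<close> is the only transposition in
  \<open>J_j\<close> that moves \<open>i\<close>. Moreover \<open>J_i\<close> commutes with
  \<open>z_j\<close> and with \<open>J_j\<close>.\<close>

lemma uop_commute_less:
  assumes ij: "i \<in> {1..n}" "j \<in> {1..n}" "i < j" and f: "f \<in> pols n UNIV"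
  shows "uop n c i (uop n c j f) = uop n c j (uop n c i f)"
proof -
  let ?s = "transpose i j"
  have jz: "jop i (zop n c j f) = zop n c j (jop i f)"
  proof -
    have "pop (transpose i k) (zop n c j f) = zop n c j (pop (transpose i k) f)" if "k \<in> {1..<i}" for k
      using that ij pop_zop[OF transpose_permutes, of i n k c j f] by (simp add: transpose_def)
    then show ?thesis unfolding jop_def additive.sum[OF additive_zop] by (rule sum.cong[OF refl])
  qed
  have zj: "zop n c i (jop j f) - jop j (zop n c i f) = zop n c i (pop ?s f) - pop ?s (zop n c i f)"
  proof -
    have "zop n c i (pop (transpose j k) f) = pop (transpose j k) (zop n c i f)" if "k \<in> {1..<j} - {i}" for k
      using that ij pop_zop[OF transpose_permutes, of j n k c i f] by (simp add: transpose_def)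
    then have "(\<Sum>k\<in>{1..<j} - {i}. zop n c i (pop (transpose j k) f)) = (\<Sum>k\<in>{1..<j} - {i}. pop (transpose j k) (zop n c i f))"
      by (rule sum.cong[OF refl])
    moreover have "sum F {1..<j} = F i + sum F ({1..<j} - {i})" for F :: "nat \<Rightarrow> pol"
      using ij by (intro sum.remove) auto
    ultimately show ?thesis
      unfolding jop_def additive.sum[OF additive_zop] by (simp add: transpose_commute[of i j] del: One_nat_def)
  qed
  have jj: "jop i (jop j f) = jop j (jop i f)"
  proof -
    have "pop (transpose i k) (jop j f) = jop j (pop (transpose i k) f)" if "k \<in> {1..<i}" for k
      using that ij by (intro pop_jop_fixed transpose_image) (auto simp: transpose_def)
    then show ?thesis unfolding jop_def[of i] additive.sum[OF additive_jop] by (rule sum.cong[OF refl])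
  qed
  have "uop n c i (uop n c j f) - uop n c j (uop n c i f) =
    (zop n c i (zop n c j f) - zop n c j (zop n c i f)) - sop c (zop n c i (jop j f) - jop j (zop n c i f))
    + sop c (zop n c j (jop i f) - jop i (zop n c j f)) + sop (c * c) (jop i (jop j f) - jop j (jop i f))"
    by (simp add: uop_def zop_simps jop_simps sop_simps zop_sop jop_sop sop_sop)
  also have "\<dots> = 0"
    unfolding zop_zop[OF ij(1,2) less_imp_neq[OF ij(3)] f] jz zj jj by (simp add: sop_simps)
  finally show ?thesis by simp
qed

lemma uop_commute:
  assumes "i \<in> {1..n}" "j \<in> {1..n}" "f \<in> pols n UNIV"
  shows "uop n c i (uop n c j f) = uop n c j (uop n c i f)"
  using uop_commute_less[OF assms(1,2)] uop_commute_less[OF assms(2,1)] assms(3)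
  by (cases i j rule: linorder_cases) auto

text \<open>The relation \<open>s_j u_j = u_(j+1) s_j + c\<close> of the degenerate affine Hecke
  algebra; it comes from \<open>J_(j+1) = s_j J_j s_j + s_j\<close>.\<close>

lemma pop_uop_simple:
  assumes j: "1 \<le> j" "Suc j \<le> n"
  shows "pop (transpose j (Suc j)) (uop n c j f) = uop n c (Suc j) (pop (transpose j (Suc j)) f) + sop c f"
proof -
  let ?s = "transpose j (Suc j)"
  have s: "?s permutes {1..n}" "bij ?s" using j transpose_permutes[of j n "Suc j"] by auto
  have "?s ` {1..<j} = {1..<j}" by (rule transpose_image_other) auto
  then have "pop ?s (jop j f) = (\<Sum>k\<in>{1..<j}. pop (transpose (Suc j) k) (pop ?s f))"
    using pop_jop[OF s(2), of j f] by simp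
  also have "\<dots> = jop (Suc j) (pop ?s f) - pop (transpose (Suc j) j) (pop ?s f)"
    using j by (simp add: jop_def)
  also have "pop (transpose (Suc j) j) (pop ?s f) = f"
    by (simp add: transpose_commute[of "Suc j"] pop_pop s(2))
  finally show ?thesis using pop_zop[OF s(1), of c j f] by (simp add: uop_def op_simps pop_sop)
qed

lemma pop_uop_simple_Suc:
  assumes j: "1 \<le> j" "Suc j \<le> n"
  shows "pop (transpose j (Suc j)) (uop n c (Suc j) f) = uop n c j (pop (transpose j (Suc j)) f) - sop c f"
proof -
  let ?s = "transpose j (Suc j)"
  have ss: "pop ?s (pop ?s g) = g" for g by (simp add: pop_pop)
  have "pop ?s (pop ?s (uop n c j (pop ?s f))) = pop ?s (uop n c (Suc j) f + sop c (pop ?s f))"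
    using pop_uop_simple[OF j, of c "pop ?s f"] by (simp add: ss)
  then show ?thesis by (simp add: ss op_simps pop_sop)
qed

lemma pop_uop_simple_other:
  assumes j: "1 \<le> j" "Suc j \<le> n" and i: "i \<noteq> j" "i \<noteq> Suc j"
  shows "pop (transpose j (Suc j)) (uop n c i f) = uop n c i (pop (transpose j (Suc j)) f)"
proof -
  let ?s = "transpose j (Suc j)"
  have s: "?s permutes {1..n}" "bij ?s" using j transpose_permutes[of j n "Suc j"] by auto
  have "?s ` {1..<i} = {1..<i}"
    using i j by (cases "i < j") (auto intro!: transpose_image transpose_image_other)
  then have "pop ?s (jop i f) = jop i (pop ?s f)"
    using i by (intro pop_jop_fixed s) (auto simp: transpose_def)
  moreover have "pop ?s (zop n c i f) = zop n c i (pop ?s f)"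
    using pop_zop[OF s(1), of c i f] i by (simp add: transpose_def)
  ultimately show ?thesis by (simp add: uop_def op_simps pop_sop)
qed

section \<open>Triangularity\<close>

text \<open>Off the diagonal \<open>u\<^sub>i\<close> either makes two exponents more equal or moves the larger one of two to the left.\<close>

definition qd :: "nat \<Rightarrow> (nat \<Rightarrow> nat) \<Rightarrow> nat" where
  "qd n a = (\<Sum>i\<in>{1..n}. a i * a i)"

definition sh :: "nat \<Rightarrow> (nat \<Rightarrow> nat) \<Rightarrow> nat" where
  "sh n a = (\<Sum>i\<in>{1..n}. i * a i)"

text \<open>A strict order with finitely many exponents below each one, but not a total one; hence
  the later arguments work with maximal exponents.\<close>

definition lt :: "nat \<Rightarrow> (nat \<Rightarrow> nat) \<Rightarrow> (nat \<Rightarrow> nat) \<Rightarrow> bool" where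
  "lt n b a \<longleftrightarrow> qd n b < qd n a \<or> (qd n b = qd n a \<and> sh n b < sh n a)"

lemma lt_irrefl: "\<not> lt n a a" by (simp add: lt_def)
lemma lt_trans: "lt n a b \<Longrightarrow> lt n b d \<Longrightarrow> lt n a d" by (auto simp: lt_def)

text \<open>The places that precede \<open>i\<close> when \<open>a\<close> is sorted
  non-decreasingly.\<close>

definition dset :: "nat \<Rightarrow> (nat \<Rightarrow> nat) \<Rightarrow> nat \<Rightarrow> nat set" where
  "dset n a i = {j \<in> {1..n}. a j < a i \<or> (a j = a i \<and> j < i)}"

definition lower :: "nat \<Rightarrow> (nat \<Rightarrow> nat) \<Rightarrow> pol set" where
  "lower n a = {f. Poly_Mapping.keys f \<subseteq> {b \<in> exponents n. lt n b a}}"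

lemma lower_closed:
  shows "0 \<in> lower n a" "f \<in> lower n a \<Longrightarrow> g \<in> lower n a \<Longrightarrow> f + g \<in> lower n a"
    "f \<in> lower n a \<Longrightarrow> g \<in> lower n a \<Longrightarrow> f - g \<in> lower n a" "f \<in> lower n a \<Longrightarrow> - f \<in> lower n a"
    "f \<in> lower n a \<Longrightarrow> sop z f \<in> lower n a"
    "b \<in> exponents n \<Longrightarrow> lt n b a \<Longrightarrow> mon b v \<in> lower n a"
proof -
  show "f \<in> lower n a \<Longrightarrow> g \<in> lower n a \<Longrightarrow> f + g \<in> lower n a"
    using keys_add[of f g] unfolding lower_def by blast
  show "f \<in> lower n a \<Longrightarrow> g \<in> lower n a \<Longrightarrow> f - g \<in> lower n a"
    using keys_diff[of f g] unfolding lower_def by blast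
  show "f \<in> lower n a \<Longrightarrow> sop z f \<in> lower n a"
  proof -
    have "Poly_Mapping.keys (sop z f) \<subseteq> Poly_Mapping.keys f" by (auto simp: in_keys_iff coef_sop)
    then show "f \<in> lower n a \<Longrightarrow> sop z f \<in> lower n a" unfolding lower_def by blast
  qed
qed (auto simp: lower_def)

lemma lower_sum: "(\<And>i. i \<in> A \<Longrightarrow> f i \<in> lower n a) \<Longrightarrow> sum f A \<in> lower n a"
  by (induction A rule: infinite_finite_induct) (auto intro: lower_closed)

text \<open>The comparison avoids subtraction because the sums are natural numbers.\<close>

lemma sum_upd2:
  fixes a :: "nat \<Rightarrow> nat"
  assumes "i \<in> {1..n}" "j \<in> {1..n}" "i \<noteq> j"
  shows "(\<Sum>k\<in>{1..n}. F k ((a(i := x, j := y)) k)) + F i (a i) + F j (a j) =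
    (\<Sum>k\<in>{1..n}. F k (a k)) + F i x + (F j y :: nat)"
proof -
  let ?R = "{1..n} - {i} - {j}"
  have s: "sum G {1..n} = G i + (G j + sum G ?R)" for G :: "nat \<Rightarrow> nat"
    using assms by (subst sum.remove[of _ i], simp, simp, subst sum.remove[of _ j]) auto
  have "(\<Sum>k\<in>?R. F k ((a(i := x, j := y)) k)) = (\<Sum>k\<in>?R. F k (a k))"
    by (rule sum.cong) auto
  then show ?thesis using assms unfolding s by simp
qed

lemma lt_interior:
  assumes "i \<in> {1..n}" "j \<in> {1..n}" "i \<noteq> j" "x * x + y * y < a i * a i + a j * a j"
  shows "lt n (a(i := x, j := y)) a"
  using sum_upd2[OF assms(1-3), of "\<lambda>_ z. z * z" a x y] assms(4) by (simp add: lt_def qd_def)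

text \<open>Rearrangement inequality: moving the larger exponent to the smaller index keeps
  \<open>qd\<close> and lowers \<open>sh\<close>.\<close>

lemma lt_swap:
  assumes "i \<in> {1..n}" "j \<in> {1..n}" "j < i" "a j < a i"
  shows "lt n (a(i := a j, j := a i)) a" "lt n (a(j := a i, i := a j)) a"
proof -
  have ne: "i \<noteq> j" using assms by auto
  have "k * q + l * p < k * p + l * q" if lk: "l < k" and qp: "q < p" for k l p q :: nat
  proof -
    obtain d where d: "p = q + d" "0 < d" using less_imp_add_positive[OF qp] by auto
    obtain e where e: "k = l + e" "0 < e" using less_imp_add_positive[OF lk] by auto
    show ?thesis using d e by (simp add: algebra_simps)
  qed
  from this[OF assms(3,4)]
  show "lt n (a(i := a j, j := a i)) a"
    using sum_upd2[OF assms(1,2) ne, of "\<lambda>_ z. z * z" a "a j" "a i"]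
      sum_upd2[OF assms(1,2) ne, of "\<lambda>k z. k * z" a "a j" "a i"]
    by (simp add: lt_def qd_def sh_def)
  then show "lt n (a(j := a i, i := a j)) a" using ne by (metis fun_upd_twist)
qed

lemma square_interior:
  fixes p q t :: nat
  assumes "q < p" "0 < t" "t < p - q"
  shows "(p - t) * (p - t) + (q + t) * (q + t) < p * p + q * q"
proof -
  define d where "d = p - q - t"
  then have "p = q + t + d" "0 < d" using assms by auto
  then show ?thesis using assms by (simp add: algebra_simps)
qed

text \<open>The contribution of \<open>j\<close> to \<open>u_i\<close>, up to the factor
  \<open>-c\<close>. The expanded quotient consists of interior exponents, whose sum of squares is
  smaller, and one extreme term: \<open>x^a\<close> itself if \<open>a i > a j\<close>, minus the
  swapped monomial if \<open>a i < a j\<close>. The latter cancels against the term of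
  \<open>J_i\<close> when \<open>j < i\<close> and is lower when \<open>j > i\<close>.\<close>

lemma xop_ddiff_lower:
  assumes ij: "i \<in> {1..n}" "j \<in> {1..n}" "i \<noteq> j" and a: "a \<in> exponents n"
  shows "xop i (ddiff i j a v) + (if j < i then mon (a \<circ> transpose i j) v else 0)
    - (if j \<in> dset n a i then mon a v else 0) \<in> lower n a"
proof -
  have ex: "a(i := x, j := y) \<in> exponents n" for x y using a ij by (auto simp: exponents_def)
  have X: "xop i (ddiff i j a v) = (\<Sum>t<a i - a j. mon (a(i := a i - t, j := a j + t)) v)
      - (\<Sum>t<a j - a i. mon (a(i := a j - t, j := a i + t)) v)"
  proof -
    have "Suc (p - 1 - t) = p - t" if "t < p - q" for p q t :: nat using that by auto
    then show ?thesis using ij(3) by (simp add: ddiff_def op_simps op_sum fun_upd_twist)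
  qed
  have S: "(\<Sum>t<p - q. mon (a(i := p - t, j := q + t)) v) - mon (a(i := p, j := q)) v \<in> lower n a"
    if pq: "q < p" "p * p + q * q = a i * a i + a j * a j" for p q
  proof -
    obtain d where d: "p - q = Suc d" using pq by (metis Suc_pred zero_less_diff)
    have "(\<Sum>t<p - q. mon (a(i := p - t, j := q + t)) v) - mon (a(i := p, j := q)) v
      = (\<Sum>t<d. mon (a(i := p - Suc t, j := q + Suc t)) v)"
      unfolding d by (subst sum.lessThan_Suc_shift) simp
    also have "\<dots> \<in> lower n a"
    proof (intro lower_sum lower_closed ex lt_interior ij)
      fix t assume "t \<in> {..<d}"
      then show "(p - Suc t) * (p - Suc t) + (q + Suc t) * (q + Suc t) < a i * a i + a j * a j"
        using square_interior[of q p "Suc t"] pq d by simp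
    qed
    finally show ?thesis .
  qed
  show ?thesis
  proof (cases "a i" "a j" rule: linorder_cases)
    case equal
    then have "a \<circ> transpose i j = a" by (simp add: comp_transpose_upd fun_upd_idem)
    then show ?thesis using equal ij by (simp add: X dset_def lower_closed)
  next
    case greater
    then have "(\<Sum>t<a i - a j. mon (a(i := a i - t, j := a j + t)) v) - mon a v \<in> lower n a"
      using S[of "a j" "a i"] by (simp add: fun_upd_idem)
    moreover have "(if j < i then mon (a \<circ> transpose i j) v else 0) \<in> lower n a"
      using lower_closed(1) lower_closed(6)[OF ex lt_swap(1)] ij greater by (auto simp: comp_transpose_upd)
    ultimately show ?thesis
      using greater ij lower_closed(2) by (fastforce simp: X dset_def algebra_simps)
  next
    case less
    then have *: "mon (a(i := a j, j := a i)) v - (\<Sum>t<a j - a i. mon (a(i := a j - t, j := a i + t)) v) \<in> lower n a"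
      using lower_closed(4)[OF S[of "a i" "a j"]] by simp
    show ?thesis
    proof (cases "j < i")
      case True
      from True less * show ?thesis unfolding comp_transpose_upd by (simp add: X dset_def)
    next
      case False
      then have "mon (a(i := a j, j := a i)) v \<in> lower n a"
        using lt_swap(2)[of j n i a] ij less by (intro lower_closed ex) auto
      from lower_closed(3)[OF * this] show ?thesis using False less by (simp add: X dset_def)
    qed
  qed
qed

text \<open>How \<open>u_i\<close> acts on the coefficient of a leading monomial.\<close>

definition diag :: "complex \<Rightarrow> nat \<Rightarrow> (nat \<Rightarrow> nat) \<Rightarrow> nat \<Rightarrow> smash \<Rightarrow> smash" where
  "diag c n a i v = scal (of_nat (a i)) * v - scal c * (\<Sum>j\<in>dset n a i. transp i j * v)"

lemma additive_diag: "additive (diag c n a i)"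
  by (simp add: additive_def diag_def algebra_simps sum.distrib)

lemma uop_mon:
  assumes i: "i \<in> {1..n}" and a: "a \<in> exponents n"
  shows "uop n c i (mon a v) - mon a (diag c n a i v) \<in> lower n a"
proof -
  let ?N = "{1..n} - {i}"
  let ?T = "\<lambda>j. xop i (ddiff i j a (transp i j * v)) + (if j < i then mon (a \<circ> transpose i j) (transp i j * v) else 0)"
  let ?D = "\<lambda>j. if j \<in> dset n a i then mon a (transp i j * v) else 0"
  have D: "(\<Sum>j\<in>?N. ?D j) = mon a (\<Sum>j\<in>dset n a i. transp i j * v)"
  proof -
    have "(\<Sum>j\<in>?N. ?D j) = (\<Sum>j\<in>?N \<inter> dset n a i. mon a (transp i j * v))"
      by (simp add: sum.inter_restrict)
    also have "?N \<inter> dset n a i = dset n a i" by (auto simp: dset_def)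
    finally show ?thesis by (simp add: additive.sum[OF additive_single])
  qed
  have J: "jop i (mon a v) = (\<Sum>j\<in>?N. if j < i then mon (a \<circ> transpose i j) (transp i j * v) else 0)"
  proof -
    have "?N \<inter> {j. j < i} = {1..<i}" using i by auto
    then show ?thesis
      by (simp add: jop_def exp_act_transpose transp_def[symmetric] sum.inter_restrict[symmetric, of ?N]
          sum.If_cases del: One_nat_def)
  qed
  have X: "xop i (mon (a(i := a i - 1)) (scal (of_nat (a i)) * v)) = mon a (scal (of_nat (a i)) * v)"
    by (cases "a i") (simp_all add: op_simps fun_upd_idem)
  have "uop n c i (mon a v) = mon a (scal (of_nat (a i)) * v) - sop c (\<Sum>j\<in>?N. ?T j)"
    unfolding uop_def zop_def yop_mon ymon_def xop_simps X J sum.distrib xop_sop xop_sum sop_simps by simp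
  moreover have "mon a (diag c n a i v) = mon a (scal (of_nat (a i)) * v) - sop c (\<Sum>j\<in>?N. ?D j)"
    unfolding D by (simp add: diag_def single_diff)
  ultimately have "uop n c i (mon a v) - mon a (diag c n a i v) = - sop c (\<Sum>j\<in>?N. ?T j - ?D j)"
    by (simp add: sop_simps sum_subtractf del: One_nat_def)
  also have "\<dots> \<in> lower n a"
    using i a by (intro lower_closed lower_sum xop_ddiff_lower) auto
  finally show ?thesis .
qed

lemma coef_uop_top:
  assumes i: "i \<in> {1..n}" and f: "Poly_Mapping.keys f \<subseteq> exponents n"
    and top: "\<And>a. a \<in> Poly_Mapping.keys f \<Longrightarrow> \<not> lt n b a"
  shows "coef (uop n c i f) b = diag c n b i (coef f b)"
proof (rule poly_mapping_sum_induct[where f = f and P = "\<lambda>f. coef (uop n c i f) b = diag c n b i (coef f b)"])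
  fix a assume a: "a \<in> Poly_Mapping.keys f"
  let ?v = "coef f a"
  have "b \<notin> Poly_Mapping.keys (uop n c i (mon a ?v) - mon a (diag c n a i ?v))"
    using uop_mon[OF i, of a c ?v] f a top[OF a] by (auto simp: lower_def)
  then have "coef (uop n c i (mon a ?v)) b = coef (mon a (diag c n a i ?v)) b"
    by (simp add: in_keys_iff lookup_minus)
  then show "coef (uop n c i (mon a ?v)) b = diag c n b i (coef (mon a ?v) b)"
    by (simp add: lookup_single when_def additive.zero[OF additive_diag])
qed (simp_all add: uop_simps lookup_add additive.zero[OF additive_diag] additive.add[OF additive_diag])

definition downset :: "nat \<Rightarrow> (nat \<Rightarrow> nat) set \<Rightarrow> bool" where
  "downset n B \<longleftrightarrow> B \<subseteq> exponents n \<and> (\<forall>b\<in>B. \<forall>a\<in>exponents n. lt n a b \<longrightarrow> a \<in> B)"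

lemma keys_uop_downset:
  assumes i: "i \<in> {1..n}" and B: "downset n B" and f: "Poly_Mapping.keys f \<subseteq> B"
  shows "Poly_Mapping.keys (uop n c i f) \<subseteq> B"
proof (rule poly_mapping_sum_induct[where f = f and P = "\<lambda>f. Poly_Mapping.keys (uop n c i f) \<subseteq> B"])
  fix a assume a: "a \<in> Poly_Mapping.keys f"
  then have a: "a \<in> B" "a \<in> exponents n" using f B by (auto simp: downset_def)
  let ?v = "coef f a" and ?d = "mon a (diag c n a i (coef f a))"
  have "Poly_Mapping.keys (uop n c i (mon a ?v) - ?d) \<subseteq> B"
    using uop_mon[OF i a(2), of c ?v] a B by (auto simp: lower_def downset_def)
  moreover have "Poly_Mapping.keys ?d \<subseteq> B" using a by simp
  ultimately show "Poly_Mapping.keys (uop n c i (mon a ?v)) \<subseteq> B"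
    using keys_add[of "uop n c i (mon a ?v) - ?d" ?d] by auto
next
  fix g h assume "Poly_Mapping.keys (uop n c i g) \<subseteq> B" "Poly_Mapping.keys (uop n c i h) \<subseteq> B"
  then show "Poly_Mapping.keys (uop n c i (g + h)) \<subseteq> B"
    using keys_add[of "uop n c i g" "uop n c i h"] by (auto simp: uop_simps)
qed (simp add: uop_simps)

text \<open>The sum of squares \<open>qd\<close> bounds every single exponent.\<close>

lemma finite_lt: "finite {b \<in> exponents n. lt n b a}"
proof (rule finite_subset)
  show "{b \<in> exponents n. lt n b a} \<subseteq> {b. \<forall>i. (i \<in> {1..n} \<longrightarrow> b i \<in> {..qd n a}) \<and> (i \<notin> {1..n} \<longrightarrow> b i = 0)}"
  proof clarsimp
    fix b i assume b: "b \<in> exponents n" "lt n b a"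
    have "b i \<le> qd n a" if "i \<in> {1..n}"
    proof -
      have "b i \<le> b i * b i" by simp
      also have "\<dots> \<le> qd n b" unfolding qd_def using that by (intro member_le_sum) auto
      also have "\<dots> \<le> qd n a" using b by (auto simp: lt_def)
      finally show ?thesis .
    qed
    then show "(Suc 0 \<le> i \<and> i \<le> n \<longrightarrow> b i \<le> qd n a) \<and> ((Suc 0 \<le> i \<longrightarrow> \<not> i \<le> n) \<longrightarrow> b i = 0)"
      using b by (auto simp: exponents_def)
  qed
  show "finite {b. \<forall>i. (i \<in> {1..n} \<longrightarrow> b i \<in> {..qd n a}) \<and> (i \<notin> {1..n} \<longrightarrow> b i = 0)}"
    by (rule finite_set_of_finite_funs) auto
qed

lemma ex_maximal:
  assumes "finite A" "b \<in> A"
  obtains m where "m \<in> A" "b = m \<or> lt n b m" "\<And>x. x \<in> A \<Longrightarrow> \<not> lt n m x"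
proof -
  let ?B = "{x \<in> A. b = x \<or> lt n b x}"
  have "asymp_on ?B (lt n)" by (rule asymp_onI) (metis lt_irrefl lt_trans)
  moreover have "transp_on ?B (lt n)" by (rule transp_onI) (rule lt_trans)
  ultimately have "\<exists>m\<in>?B. \<forall>x\<in>?B. x \<noteq> m \<longrightarrow> \<not> lt n m x"
    using assms Finite_Set.bex_max_element[of ?B "lt n"] by auto
  then obtain m where m: "m \<in> ?B" "\<And>x. x \<in> ?B \<Longrightarrow> x \<noteq> m \<Longrightarrow> \<not> lt n m x" by blast
  then have "\<not> lt n m x" if "x \<in> A" for x using that lt_irrefl lt_trans by blast
  then show thesis using m that by blast
qed

section \<open>Sorting permutations\<close>

lemma dset_trans: "j \<in> dset n a i \<Longrightarrow> i \<in> {1..n} \<Longrightarrow> dset n a j \<subset> dset n a i"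
  by (auto simp: dset_def psubset_eq)

lemma sort_perm_dset: "i \<in> {1..n} \<Longrightarrow> sort_perm n a i = Suc (card (dset n a i))"
proof -
  assume i: "i \<in> {1..n}"
  let ?A = "{j \<in> {1..n}. a j < a i}" and ?B = "{j \<in> {1..n}. j < i \<and> a j = a i}"
  have "dset n a i = ?A \<union> ?B" by (auto simp: dset_def)
  moreover have "card (?A \<union> ?B) = card ?A + card ?B" by (rule card_Un_disjoint) auto
  moreover have "{j \<in> {1..n}. j \<le> i \<and> a j = a i} = insert i ?B" using i by auto
  moreover have "card (insert i ?B) = Suc (card ?B)" by (rule card_insert_disjoint) auto
  ultimately show ?thesis using i unfolding sort_perm_def by (simp only: if_True add_Suc_right)
qed

lemma finite_dset [simp]: "finite (dset n a i)"
  by (simp add: dset_def)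

lemma sort_perm_less_iff:
  assumes "i \<in> {1..n}" "j \<in> {1..n}"
  shows "sort_perm n a j < sort_perm n a i \<longleftrightarrow> j \<in> dset n a i"
proof -
  have *: "sort_perm n a j < sort_perm n a i" if "j \<in> dset n a i" "i \<in> {1..n}" "j \<in> {1..n}" for i j
    using psubset_card_mono[OF _ dset_trans[OF that(1,2)]] that by (simp add: sort_perm_dset)
  consider "i = j" | "j \<in> dset n a i" | "i \<in> dset n a j"
    using assms by (cases "a i" "a j" rule: linorder_cases; cases i j rule: linorder_cases) (auto simp: dset_def)
  then show ?thesis
  proof cases
    case 1
    then show ?thesis by (simp add: dset_def)
  next
    case 2
    then show ?thesis using *[of j i] assms by simp
  next
    case 3
    then show ?thesis using *[of i j] assms by (auto simp: dset_def)
  qed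
qed

lemma sort_perm_permutes: "sort_perm n a permutes {1..n}"
proof (rule bij_imp_permutes)
  have inj: "inj_on (sort_perm n a) {1..n}"
  proof (rule inj_onI)
    fix i j assume ij: "i \<in> {1..n}" "j \<in> {1..n}" "sort_perm n a i = sort_perm n a j"
    then have "j \<notin> dset n a i" "i \<notin> dset n a j" using sort_perm_less_iff[of i n j a] sort_perm_less_iff[of j n i a] by auto
    then show "i = j" using ij by (auto simp: dset_def)
  qed
  have "sort_perm n a ` {1..n} \<subseteq> {1..n}"
  proof (rule image_subsetI)
    fix i assume i: "i \<in> {1..n}"
    have "dset n a i \<subseteq> {1..n}" "i \<notin> dset n a i" by (auto simp: dset_def)
    then have "dset n a i \<subset> {1..n}" using i by blast
    then have "card (dset n a i) < card {1..n}" by (intro psubset_card_mono) auto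
    then show "sort_perm n a i \<in> {1..n}" using i by (simp add: sort_perm_dset)
  qed
  then have "sort_perm n a ` {1..n} = {1..n}"
    using inj by (simp add: endo_inj_surj)
  then show "bij_betw (sort_perm n a) {1..n} {1..n}" using inj by (simp add: bij_betw_def)
  show "sort_perm n a x = x" if "x \<notin> {1..n}" for x
    using that unfolding sort_perm_def by (simp only: if_False)
qed

text \<open>Consequently, conjugation by the sorting permutation turns the transpositions in
  \<open>diag\<close> into a Jucys-Murphy element.\<close>

lemma sort_perm_image_dset:
  assumes "i \<in> {1..n}"
  shows "sort_perm n a ` dset n a i = {1..<sort_perm n a i}"
proof -
  have im: "sort_perm n a ` {1..n} = {1..n}" using sort_perm_permutes permutes_image by blast
  then have "sort_perm n a i \<in> {1..n}" using assms by blast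
  then have "{1..<sort_perm n a i} = {k \<in> sort_perm n a ` {1..n}. k < sort_perm n a i}"
    unfolding im by auto
  also have "\<dots> = sort_perm n a ` dset n a i"
    using sort_perm_less_iff[OF assms, of _ a] by (auto simp: dset_def)
  finally show ?thesis by simp
qed

section \<open>Joint eigenvectors\<close>

lemma perm_elt_inv:
  assumes "g permutes {1..n}"
  shows "perm_elt (inv_into UNIV g) * (perm_elt g * x) = x" "perm_elt g * (perm_elt (inv_into UNIV g) * x) = x"
  using permutes_inv_o[OF assms] by (simp_all add: perm_elt_mult flip: mult.assoc)

lemma diag_scal: "diag c n a i (scal z * x) = scal z * diag c n a i x"
proof -
  have "(\<Sum>j\<in>dset n a i. transp i j * (scal z * x)) = scal z * (\<Sum>j\<in>dset n a i. transp i j * x)"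
    by (simp add: transp_scal sum_distrib_left)
  then show ?thesis by (simp add: diag_def scal_scal right_diff_distrib mult.commute)
qed

text \<open>What can be said about joint eigenvectors without reference to hooks: given are an
  eigenbasis for the Jucys-Murphy elements, with contents \<open>ct\<close>, and simplicity of the
  resulting joint spectrum on polynomials.\<close>

locale spectral =
  fixes n :: nat and c :: complex and V :: "smash set" and Ls :: "'l set"
    and v :: "'l \<Rightarrow> smash" and ct :: "'l \<Rightarrow> nat \<Rightarrow> complex" and wt :: "(nat \<Rightarrow> nat) \<Rightarrow> 'l \<Rightarrow> nat \<Rightarrow> complex"
  defines "wt a L i \<equiv> of_nat (a i) - ct L (sort_perm n a i) * c"
  assumes V: "sn_space n V"
    and fin: "finite Ls"
    and v_in: "L \<in> Ls \<Longrightarrow> v L \<in> V"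
    and span: "x \<in> V \<Longrightarrow> \<exists>\<alpha>. x = (\<Sum>L\<in>Ls. scal (\<alpha> L) * v L)"
    and indep: "(\<Sum>L\<in>Ls. scal (\<alpha> L) * v L) = 0 \<Longrightarrow> L \<in> Ls \<Longrightarrow> \<alpha> L = 0"
    and jm: "L \<in> Ls \<Longrightarrow> i \<in> {1..n} \<Longrightarrow> (\<Sum>j\<in>{1..<i}. transp i j * v L) = scal (ct L i) * v L"
    and simple: "a \<in> exponents n \<Longrightarrow> b \<in> exponents n \<Longrightarrow> L \<in> Ls \<Longrightarrow> L' \<in> Ls \<Longrightarrow>
      (\<And>i. i \<in> {1..n} \<Longrightarrow> wt a L i = wt b L' i) \<Longrightarrow> a = b \<and> L = L'"
begin

definition top :: "(nat \<Rightarrow> nat) \<Rightarrow> 'l \<Rightarrow> smash" where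
  "top a L = perm_elt (inv_into UNIV (sort_perm n a)) * v L"

definition eig :: "(nat \<Rightarrow> complex) \<Rightarrow> pol \<Rightarrow> bool" where
  "eig \<kappa> w \<longleftrightarrow> w \<in> pols n V \<and> (\<forall>i\<in>{1..n}. uop n c i w = sop (\<kappa> i) w)"

lemma top_in: "L \<in> Ls \<Longrightarrow> top a L \<in> V"
  unfolding top_def by (rule sn_spaceD(4)[OF V permutes_inv[OF sort_perm_permutes] v_in])

lemma top_span:
  assumes "x \<in> V"
  shows "\<exists>\<alpha>. x = (\<Sum>L\<in>Ls. scal (\<alpha> L) * top a L)"
proof -
  have "perm_elt (sort_perm n a) * x \<in> V" using sn_spaceD(4)[OF V sort_perm_permutes assms] .
  then obtain \<alpha> where "perm_elt (sort_perm n a) * x = (\<Sum>L\<in>Ls. scal (\<alpha> L) * v L)" using span by blast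
  then have "x = perm_elt (inv_into UNIV (sort_perm n a)) * (\<Sum>L\<in>Ls. scal (\<alpha> L) * v L)"
    by (metis perm_elt_inv(1) sort_perm_permutes)
  then show ?thesis by (auto simp: top_def sum_distrib_left perm_elt_scal)
qed

lemma top_indep:
  assumes "(\<Sum>L\<in>Ls. scal (\<alpha> L) * top a L) = 0" "L \<in> Ls"
  shows "\<alpha> L = 0"
proof -
  have "perm_elt (sort_perm n a) * (\<Sum>L\<in>Ls. scal (\<alpha> L) * top a L) = (\<Sum>L\<in>Ls. scal (\<alpha> L) * v L)"
    by (simp add: top_def sum_distrib_left perm_elt_scal perm_elt_inv[OF sort_perm_permutes])
  then show ?thesis using assms indep by simp
qed

lemma top_independent1: "L \<in> Ls \<Longrightarrow> scal z * top a L = 0 \<Longrightarrow> z = 0"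
  using top_indep[of "\<lambda>L'. if L' = L then z else 0" a L] fin
  by (simp add: if_distrib[of scal] if_distribR sum.delta cong: if_cong)

lemma diag_top:
  assumes "L \<in> Ls" "i \<in> {1..n}"
  shows "diag c n a i (top a L) = scal (wt a L i) * top a L"
proof -
  let ?g = "sort_perm n a"
  let ?h = "inv_into UNIV ?g"
  have g: "?g permutes {1..n}" by (rule sort_perm_permutes)
  have h: "?h permutes {1..n}" by (rule permutes_inv[OF g])
  have gi: "?g i \<in> {1..n}" using permutes_in_image[OF g] assms by blast
  have "transp i j * top a L = perm_elt ?h * (transp (?g i) (?g j) * v L)" for j
    using perm_elt_transp[OF permutes_bij[OF h], of "?g i" "?g j"] permutes_inverses(2)[OF g]
    by (simp add: top_def flip: mult.assoc)
  then have "(\<Sum>j\<in>dset n a i. transp i j * top a L) = perm_elt ?h * (\<Sum>j\<in>dset n a i. transp (?g i) (?g j) * v L)"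
    by (simp add: sum_distrib_left)
  also have "(\<Sum>j\<in>dset n a i. transp (?g i) (?g j) * v L) = (\<Sum>k\<in>?g ` dset n a i. transp (?g i) k * v L)"
    by (subst sum.reindex) (auto intro: inj_on_subset[OF permutes_inj[OF g]])
  also have "\<dots> = scal (ct L (?g i)) * v L"
    unfolding sort_perm_image_dset[OF assms(2)] by (rule jm[OF assms(1) gi])
  finally show ?thesis
    by (simp add: diag_def perm_elt_scal top_def wt_def scal_diff scal_scal left_diff_distrib mult.commute)
qed

lemma diag_top_sum:
  assumes "i \<in> {1..n}" "A \<subseteq> Ls"
  shows "diag c n a i (\<Sum>L\<in>A. scal (\<alpha> L) * top a L) = (\<Sum>L\<in>A. scal (\<alpha> L * wt a L i) * top a L)"
  unfolding additive.sum[OF additive_diag]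
  using assms by (intro sum.cong) (auto simp: diag_scal diag_top scal_scal)

text \<open>At a maximal exponent nothing from other monomials reaches the coefficient, so it is an
  eigenvector of every \<open>diag c n b i\<close>. The basis \<open>top b L\<close> diagonalizes
  these simultaneously.\<close>

lemma eig_maximal:
  assumes w: "eig \<kappa> w" and b: "b \<in> Poly_Mapping.keys w" "\<And>a. a \<in> Poly_Mapping.keys w \<Longrightarrow> \<not> lt n b a"
  shows "\<exists>\<alpha>. coef w b = (\<Sum>L\<in>Ls. scal (\<alpha> L) * top b L)
    \<and> (\<forall>L\<in>Ls. \<alpha> L \<noteq> 0 \<longrightarrow> (\<forall>i\<in>{1..n}. \<kappa> i = wt b L i)) \<and> (\<exists>L\<in>Ls. \<alpha> L \<noteq> 0)"
proof -
  have wV: "w \<in> pols n V" using w by (simp add: eig_def)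
  obtain \<alpha> where \<alpha>: "coef w b = (\<Sum>L\<in>Ls. scal (\<alpha> L) * top b L)"
    using top_span[OF coef_pols[OF wV]] by blast
  have "\<kappa> i = wt b L i" if L: "L \<in> Ls" "\<alpha> L \<noteq> 0" "i \<in> {1..n}" for L i
  proof -
    have "coef (uop n c i w) b = diag c n b i (coef w b)"
      using wV b by (intro coef_uop_top L) (auto simp: pols_def)
    then have "scal (\<kappa> i) * coef w b = diag c n b i (coef w b)"
      using w L by (simp add: eig_def coef_sop)
    then have "(\<Sum>L\<in>Ls. scal (\<alpha> L * (\<kappa> i - wt b L i)) * top b L) = 0"
      unfolding \<alpha> diag_top_sum[OF L(3) order_refl]
      by (simp add: sum_distrib_left scal_scal right_diff_distrib scal_diff left_diff_distrib sum_subtractf mult.commute)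
    from top_indep[OF this L(1)] L(2) show ?thesis by simp
  qed
  moreover have "\<exists>L\<in>Ls. \<alpha> L \<noteq> 0"
  proof (rule ccontr)
    assume "\<not> (\<exists>L\<in>Ls. \<alpha> L \<noteq> 0)"
    then have "coef w b = 0" unfolding \<alpha> by (intro sum.neutral) auto
    then show False using b by (simp add: in_keys_iff)
  qed
  ultimately show ?thesis using \<alpha> by blast
qed

text \<open>Applied in contrapositive form: a joint eigenvector whose eigenvalues are not of the
  form \<open>wt b L\<close> vanishes.\<close>

lemma eig_weight:
  assumes "eig \<kappa> w" "w \<noteq> 0"
  obtains b L where "b \<in> exponents n" "L \<in> Ls" "\<And>i. i \<in> {1..n} \<Longrightarrow> \<kappa> i = wt b L i"
proof -
  obtain b where "b \<in> Poly_Mapping.keys w" using assms(2) by (metis equals0I keys_eq_empty)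
  then obtain m where m: "m \<in> Poly_Mapping.keys w" "\<And>x. x \<in> Poly_Mapping.keys w \<Longrightarrow> \<not> lt n m x"
    using ex_maximal[of "Poly_Mapping.keys w" b n] by (metis finite_keys)
  have me: "m \<in> exponents n" using m(1) assms(1) by (auto simp: eig_def pols_def)
  then show thesis using eig_maximal[OF assms(1) m] that[OF me] by blast
qed

text \<open>By simplicity every maximal exponent of \<open>w\<close> equals \<open>a\<close>, and
  each exponent that occurs lies below or at a maximal one.\<close>

lemma eig_top:
  assumes a: "a \<in> exponents n" "S \<in> Ls" and w: "eig (wt a S) w"
  shows "\<And>b. b \<in> Poly_Mapping.keys w \<Longrightarrow> b = a \<or> lt n b a" "\<exists>z. coef w a = scal z * top a S"
    "coef w a = 0 \<Longrightarrow> w = 0"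
proof -
  have max: "m = a \<and> (\<exists>z. coef w a = scal z * top a S)"
    if m: "m \<in> Poly_Mapping.keys w" "\<And>x. x \<in> Poly_Mapping.keys w \<Longrightarrow> \<not> lt n m x" for m
  proof -
    have me: "m \<in> exponents n" using m(1) w by (auto simp: eig_def pols_def)
    obtain \<alpha> where \<alpha>: "coef w m = (\<Sum>L\<in>Ls. scal (\<alpha> L) * top m L)"
      "\<forall>L\<in>Ls. \<alpha> L \<noteq> 0 \<longrightarrow> (\<forall>i\<in>{1..n}. wt a S i = wt m L i)" "\<exists>L\<in>Ls. \<alpha> L \<noteq> 0"
      using eig_maximal[OF w m] by blast
    have eq: "a = m \<and> S = L" if "L \<in> Ls" "\<alpha> L \<noteq> 0" for L
      using simple[OF a(1) me a(2) that(1)] \<alpha>(2) that by blast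
    then have am: "a = m" using \<alpha>(3) by blast
    have "(\<Sum>L\<in>Ls. scal (\<alpha> L) * top m L) = (\<Sum>L\<in>{S}. scal (\<alpha> L) * top m L)"
    proof (rule sum.mono_neutral_right[OF fin])
      have "\<alpha> L = 0" if "L \<in> Ls - {S}" for L using that eq by blast
      then show "\<forall>L\<in>Ls - {S}. scal (\<alpha> L) * top m L = 0" by simp
    qed (use a(2) in simp)
    then show ?thesis using \<alpha>(1) am by auto
  qed
  have ex: "\<exists>m. m \<in> Poly_Mapping.keys w \<and> (b = m \<or> lt n b m) \<and> (\<forall>x\<in>Poly_Mapping.keys w. \<not> lt n m x)"
    if "b \<in> Poly_Mapping.keys w" for b
    using ex_maximal[of "Poly_Mapping.keys w" b n] that by (metis finite_keys)
  show keys: "b = a \<or> lt n b a" if "b \<in> Poly_Mapping.keys w" for b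
    using ex[OF that] max by blast
  show "\<exists>z. coef w a = scal z * top a S"
  proof (cases "w = 0")
    case True
    then show ?thesis by (auto intro: exI[of _ 0])
  next
    case False
    then obtain b where "b \<in> Poly_Mapping.keys w" by (metis equals0I keys_eq_empty)
    then show ?thesis using ex max by blast
  qed
  show "w = 0" if "coef w a = 0"
  proof (rule ccontr)
    assume "w \<noteq> 0"
    then obtain b where "b \<in> Poly_Mapping.keys w" by (metis equals0I keys_eq_empty)
    then have "a \<in> Poly_Mapping.keys w" using ex max by blast
    then show False using that by (simp add: in_keys_iff)
  qed
qed

lemma eig_sop: "eig \<kappa> w \<Longrightarrow> eig \<kappa> (sop z w)"
  by (auto simp: eig_def pols_sop[OF V] uop_sop sop_sop mult.commute)

lemma eig_diff: "eig \<kappa> w \<Longrightarrow> eig \<kappa> w' \<Longrightarrow> eig \<kappa> (w - w')"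
  by (auto simp: eig_def pols_diff[OF V] uop_simps sop_simps)

lemma eig_unique:
  assumes "a \<in> exponents n" "S \<in> Ls" "eig (wt a S) w" "eig (wt a S) w'" "coef w a = coef w' a"
  shows "w = w'"
  using eig_top(3)[OF assms(1,2) eig_diff[OF assms(3,4)]] assms(5) by (simp add: lookup_minus)

text \<open>Operators in the algebra generated by the \<open>u\<^sub>i\<close> that do not annihilate the top coefficient at \<open>(a, S)\<close>.\<close>

definition nice :: "(nat \<Rightarrow> nat) \<Rightarrow> 'l \<Rightarrow> (pol \<Rightarrow> pol) \<Rightarrow> bool" where
  "nice a S Q \<longleftrightarrow> (\<forall>f\<in>pols n V. Q f \<in> pols n V \<and> (\<forall>i\<in>{1..n}. \<forall>z. Q (uop n c i f - sop z f) = uop n c i (Q f) - sop z (Q f)))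
     \<and> (\<forall>B f. downset n B \<longrightarrow> Poly_Mapping.keys f \<subseteq> B \<longrightarrow> Poly_Mapping.keys (Q f) \<subseteq> B)
     \<and> (\<exists>\<rho>. \<rho> \<noteq> 0 \<and> (\<forall>f\<in>pols n V. (\<forall>b\<in>Poly_Mapping.keys f. \<not> lt n a b) \<longrightarrow>
          (\<forall>z. coef f a = scal z * top a S \<longrightarrow> coef (Q f) a = scal (\<rho> * z) * top a S)))"

lemma niceD:
  assumes "nice a S Q"
  shows "f \<in> pols n V \<Longrightarrow> Q f \<in> pols n V"
    "f \<in> pols n V \<Longrightarrow> i \<in> {1..n} \<Longrightarrow> Q (uop n c i f - sop z f) = uop n c i (Q f) - sop z (Q f)"
    "downset n B \<Longrightarrow> Poly_Mapping.keys f \<subseteq> B \<Longrightarrow> Poly_Mapping.keys (Q f) \<subseteq> B"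
    "\<exists>\<rho>. \<rho> \<noteq> 0 \<and> (\<forall>f\<in>pols n V. (\<forall>b\<in>Poly_Mapping.keys f. \<not> lt n a b) \<longrightarrow>
          (\<forall>z. coef f a = scal z * top a S \<longrightarrow> coef (Q f) a = scal (\<rho> * z) * top a S))"
  using assms by (auto simp: nice_def)

lemma downset_not_above: "downset n {b \<in> exponents n. \<not> lt n a b}"
  unfolding downset_def using lt_trans by blast

lemma nice_id: "nice a S (\<lambda>f. f)"
  unfolding nice_def by (auto intro: exI[of _ 1])

lemma nice_compose:
  assumes "nice a S Q" "nice a S Q'"
  shows "nice a S (\<lambda>f. Q (Q' f))"
proof -
  obtain \<rho> where \<rho>: "\<rho> \<noteq> 0" "\<forall>f\<in>pols n V. (\<forall>b\<in>Poly_Mapping.keys f. \<not> lt n a b) \<longrightarrow>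
      (\<forall>z. coef f a = scal z * top a S \<longrightarrow> coef (Q f) a = scal (\<rho> * z) * top a S)"
    using niceD(4)[OF assms(1)] by (elim exE conjE)
  obtain \<rho>' where \<rho>': "\<rho>' \<noteq> 0" "\<forall>f\<in>pols n V. (\<forall>b\<in>Poly_Mapping.keys f. \<not> lt n a b) \<longrightarrow>
      (\<forall>z. coef f a = scal z * top a S \<longrightarrow> coef (Q' f) a = scal (\<rho>' * z) * top a S)"
    using niceD(4)[OF assms(2)] by (elim exE conjE)
  have k: "\<not> lt n a b" if f: "f \<in> pols n V" "\<forall>b\<in>Poly_Mapping.keys f. \<not> lt n a b" and b: "b \<in> Poly_Mapping.keys (Q' f)" for f b
  proof -
    have "Poly_Mapping.keys f \<subseteq> {b \<in> exponents n. \<not> lt n a b}" using f by (auto simp: pols_def)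
    then have "Poly_Mapping.keys (Q' f) \<subseteq> {b \<in> exponents n. \<not> lt n a b}"
      by (rule niceD(3)[OF assms(2) downset_not_above])
    then show ?thesis using b by blast
  qed
  have "coef (Q (Q' f)) a = scal (\<rho> * \<rho>' * z) * top a S"
    if f: "f \<in> pols n V" "\<forall>b\<in>Poly_Mapping.keys f. \<not> lt n a b" "coef f a = scal z * top a S" for f z
  proof -
    have "coef (Q' f) a = scal (\<rho>' * z) * top a S" using \<rho>'(2) f by simp
    then have "coef (Q (Q' f)) a = scal (\<rho> * (\<rho>' * z)) * top a S"
      using \<rho>(2) niceD(1)[OF assms(2) f(1)] k[OF f(1,2)] by simp
    then show ?thesis by (simp add: mult.assoc)
  qed
  then show ?thesis
    unfolding nice_def using \<rho>(1) \<rho>'(1) niceD(1-3)[OF assms(1)] niceD(1-3)[OF assms(2)]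
    by (intro conjI ballI allI impI exI[of _ "\<rho> * \<rho>'"]) simp_all
qed

lemma nice_uop:
  assumes i: "i \<in> {1..n}" and S: "S \<in> Ls" and k: "\<kappa> \<noteq> wt a S i"
  shows "nice a S (\<lambda>f. uop n c i f - sop \<kappa> f)"
  unfolding nice_def
proof (intro conjI ballI allI impI)
  fix f assume f: "f \<in> pols n V"
  show "uop n c i f - sop \<kappa> f \<in> pols n V" by (intro pols_diff[OF V] pols_uop[OF V] pols_sop[OF V] i f)
  fix j z assume j: "j \<in> {1..n}"
  show "uop n c i (uop n c j f - sop z f) - sop \<kappa> (uop n c j f - sop z f) =
    uop n c j (uop n c i f - sop \<kappa> f) - sop z (uop n c i f - sop \<kappa> f)"
    using uop_commute[OF i j pols_UNIV[OF f], of c] by (simp add: uop_simps uop_sop sop_simps sop_sop mult.commute)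
next
  fix B and f :: pol assume "downset n B" "Poly_Mapping.keys f \<subseteq> B"
  then have "Poly_Mapping.keys (uop n c i f) \<subseteq> B" "Poly_Mapping.keys (sop \<kappa> f) \<subseteq> B"
    using keys_uop_downset[OF i] by (auto simp: in_keys_iff coef_sop subset_iff, metis mult_zero_right)
  then show "Poly_Mapping.keys (uop n c i f - sop \<kappa> f) \<subseteq> B" using keys_diff[of "uop n c i f" "sop \<kappa> f"] by blast
next
  show "\<exists>\<rho>. \<rho> \<noteq> 0 \<and> (\<forall>f\<in>pols n V. (\<forall>b\<in>Poly_Mapping.keys f. \<not> lt n a b) \<longrightarrow>
          (\<forall>z. coef f a = scal z * top a S \<longrightarrow> coef (uop n c i f - sop \<kappa> f) a = scal (\<rho> * z) * top a S))"
  proof (intro exI[of _ "wt a S i - \<kappa>"] conjI ballI impI allI)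
    show "wt a S i - \<kappa> \<noteq> 0" using k by simp
    fix f z assume f: "f \<in> pols n V" "\<forall>b\<in>Poly_Mapping.keys f. \<not> lt n a b" "coef f a = scal z * top a S"
    then have "coef (uop n c i f) a = diag c n a i (coef f a)"
      by (intro coef_uop_top i) (auto simp: pols_def)
    then show "coef (uop n c i f - sop \<kappa> f) a = scal ((wt a S i - \<kappa>) * z) * top a S"
      using f(3) S i
      by (simp add: lookup_minus coef_sop diag_scal diag_top scal_scal left_diff_distrib right_diff_distrib scal_diff mult.commute)
  qed
qed

text \<open>Each \<open>L\<close> in \<open>A\<close> costs one factor
  \<open>u_i - wt b L i\<close>, which removes the component along \<open>top b L\<close> at a
  maximal \<open>b\<close>. Simplicity allows \<open>i\<close> to be chosen such that this factor
  does not vanish at \<open>(a, S)\<close>.\<close>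

lemma nice_layer:
  assumes a: "a \<in> exponents n" "S \<in> Ls" and b: "b \<in> exponents n" "b \<noteq> a" and A: "A \<subseteq> Ls"
  shows "\<exists>Q. nice a S Q \<and> (\<forall>f\<in>pols n V. (\<forall>d\<in>Poly_Mapping.keys f. \<not> lt n b d) \<longrightarrow>
    (\<exists>\<alpha>. coef (Q f) b = (\<Sum>L\<in>Ls - A. scal (\<alpha> L) * top b L)))"
  using finite_subset[OF A fin] A
proof (induction A)
  case empty
  show ?case using top_span coef_pols nice_id by (intro exI[of _ "\<lambda>f. f"]) auto
next
  case (insert L A)
  then obtain Q where Q: "nice a S Q" and Qc: "\<And>f. f \<in> pols n V \<Longrightarrow> (\<forall>d\<in>Poly_Mapping.keys f. \<not> lt n b d) \<Longrightarrow>
    (\<exists>\<alpha>. coef (Q f) b = (\<Sum>L\<in>Ls - A. scal (\<alpha> L) * top b L))" by auto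
  have L: "L \<in> Ls" using insert by simp
  obtain i where i: "i \<in> {1..n}" "wt b L i \<noteq> wt a S i" using simple[OF b(1) a(1) L a(2)] b(2) by blast
  let ?Q = "\<lambda>f. uop n c i (Q f) - sop (wt b L i) (Q f)"
  have "\<exists>\<alpha>. coef (?Q f) b = (\<Sum>L\<in>Ls - insert L A. scal (\<alpha> L) * top b L)"
    if f: "f \<in> pols n V" "\<forall>d\<in>Poly_Mapping.keys f. \<not> lt n b d" for f
  proof -
    obtain \<alpha> where \<alpha>: "coef (Q f) b = (\<Sum>L\<in>Ls - A. scal (\<alpha> L) * top b L)" using Qc[OF f] by blast
    have QV: "Q f \<in> pols n V" using niceD(1)[OF Q] f by simp
    have "Poly_Mapping.keys f \<subseteq> {d \<in> exponents n. \<not> lt n b d}" using f by (auto simp: pols_def)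
    then have "Poly_Mapping.keys (Q f) \<subseteq> {d \<in> exponents n. \<not> lt n b d}"
      by (rule niceD(3)[OF Q downset_not_above])
    then have "coef (uop n c i (Q f)) b = diag c n b i (coef (Q f) b)"
      using i by (intro coef_uop_top) auto
    then have "coef (?Q f) b = (\<Sum>L'\<in>Ls - A. scal (\<alpha> L' * (wt b L' i - wt b L i)) * top b L')"
      unfolding lookup_minus coef_sop \<alpha> diag_top_sum[OF i(1) Diff_subset]
      by (simp add: sum_distrib_left scal_scal right_diff_distrib scal_diff left_diff_distrib sum_subtractf mult.commute)
    also have "\<dots> = (\<Sum>L'\<in>Ls - insert L A. scal (\<alpha> L' * (wt b L' i - wt b L i)) * top b L')"
      using fin by (intro sum.mono_neutral_right) auto
    finally show ?thesis by (intro exI[of _ "\<lambda>L'. \<alpha> L' * (wt b L' i - wt b L i)"])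
  qed
  then show ?case using nice_compose[OF nice_uop[OF i(1) a(2) i(2)] Q] by (intro exI[of _ ?Q]) blast
qed

text \<open>The exponents in \<open>B\<close> are removed one at a time, always a maximal one, so
  that what remains is again a downset.\<close>

lemma nice_kill:
  assumes a: "a \<in> exponents n" "S \<in> Ls" and "finite B" "downset n B" "a \<notin> B"
  shows "\<exists>Q. nice a S Q \<and> (\<forall>f\<in>pols n V. Poly_Mapping.keys f \<subseteq> B \<longrightarrow> Q f = 0)"
  using assms(3-)
proof (induction "card B" arbitrary: B)
  case 0
  then show ?case using nice_id by (intro exI[of _ "\<lambda>f. f"]) auto
next
  case (Suc k)
  then obtain b0 where "b0 \<in> B" by fastforce
  then obtain b where b: "b \<in> B" "\<And>x. x \<in> B \<Longrightarrow> \<not> lt n b x"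
    using ex_maximal[OF Suc.prems(1)] by metis
  have be: "b \<in> exponents n" "b \<noteq> a" using b Suc.prems by (auto simp: downset_def)
  have "downset n (B - {b})" using Suc.prems(2) b by (auto simp: downset_def)
  moreover have "k = card (B - {b})" using Suc b by simp
  ultimately obtain Q where Q: "nice a S Q" "\<And>f. f \<in> pols n V \<Longrightarrow> Poly_Mapping.keys f \<subseteq> B - {b} \<Longrightarrow> Q f = 0"
    using Suc.hyps(1)[of "B - {b}"] Suc.prems by auto
  obtain R where R: "nice a S R" "\<And>f. f \<in> pols n V \<Longrightarrow> (\<forall>d\<in>Poly_Mapping.keys f. \<not> lt n b d) \<Longrightarrow> coef (R f) b = 0"
    using nice_layer[OF a be order_refl] by auto
  have "Q (R f) = 0" if f: "f \<in> pols n V" "Poly_Mapping.keys f \<subseteq> B" for f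
  proof (rule Q(2))
    show "R f \<in> pols n V" using niceD(1)[OF R(1)] f by simp
    have "Poly_Mapping.keys (R f) \<subseteq> B" using niceD(3)[OF R(1) Suc.prems(2)] f by simp
    moreover have "b \<notin> Poly_Mapping.keys (R f)" using R(2)[OF f(1)] b f by (auto simp: in_keys_iff)
    ultimately show "Poly_Mapping.keys (R f) \<subseteq> B - {b}" by blast
  qed
  then show ?case using nice_compose[OF Q(1) R(1)] by (intro exI[of _ "\<lambda>f. Q (R f)"]) blast
qed

text \<open>\<open>u_i - wt a S i\<close> sends the leading term to lower terms, which
  \<open>Q\<close> annihilates. Since \<open>Q\<close> commutes with the \<open>u_i\<close>, it
  sends the leading term to an eigenvector, whose top coefficient is a nonzero multiple of the
  original one.\<close>

lemma eig_exists:
  assumes a: "a \<in> exponents n" "S \<in> Ls"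
  shows "\<exists>w. eig (wt a S) w \<and> coef w a = top a S"
proof -
  let ?B = "{b \<in> exponents n. lt n b a}"
  have "downset n ?B" unfolding downset_def using lt_trans by blast
  then obtain Q where Q: "nice a S Q" "\<And>f. f \<in> pols n V \<Longrightarrow> Poly_Mapping.keys f \<subseteq> ?B \<Longrightarrow> Q f = 0"
    using nice_kill[OF a finite_lt] lt_irrefl by blast
  let ?f = "mon a (top a S)"
  have f: "?f \<in> pols n V" by (rule pols_mon[OF V a(1) top_in[OF a(2)]])
  have QV: "Q ?f \<in> pols n V" using niceD(1)[OF Q(1)] f by simp
  have "uop n c i (Q ?f) = sop (wt a S i) (Q ?f)" if i: "i \<in> {1..n}" for i
  proof -
    let ?g = "uop n c i ?f - sop (wt a S i) ?f"
    have "?g \<in> lower n a" using uop_mon[OF i a(1), of c "top a S"] a i by (simp add: diag_top)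
    moreover have "?g \<in> pols n V" by (intro pols_diff[OF V] pols_uop[OF V] pols_sop[OF V] i f)
    ultimately have "Q ?g = 0" using Q(2) by (simp add: lower_def)
    moreover have "Q ?g = uop n c i (Q ?f) - sop (wt a S i) (Q ?f)" by (rule niceD(2)[OF Q(1) f i])
    ultimately show ?thesis by simp
  qed
  then have e: "eig (wt a S) (Q ?f)" using QV by (simp add: eig_def)
  have "\<forall>b\<in>Poly_Mapping.keys ?f. \<not> lt n a b" using lt_irrefl by auto
  moreover have "coef ?f a = scal 1 * top a S" by simp
  ultimately obtain \<rho> where \<rho>: "\<rho> \<noteq> 0" "coef (Q ?f) a = scal (\<rho> * 1) * top a S"
    using niceD(4)[OF Q(1)] f by blast
  have "coef (sop (1 / \<rho>) (Q ?f)) a = top a S" using \<rho> by (simp add: coef_sop scal_scal)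
  then show ?thesis using eig_sop[OF e] by blast
qed

definition ev :: "(nat \<Rightarrow> nat) \<Rightarrow> 'l \<Rightarrow> pol" where
  "ev a S = (THE w. eig (wt a S) w \<and> coef w a = top a S)"

lemma ev:
  assumes a: "a \<in> exponents n" "S \<in> Ls"
  shows "eig (wt a S) (ev a S)" "coef (ev a S) a = top a S"
proof -
  have "\<exists>!w. eig (wt a S) w \<and> coef w a = top a S" using eig_exists[OF a] eig_unique[OF a] by metis
  from theI'[OF this] show "eig (wt a S) (ev a S)" "coef (ev a S) a = top a S" by (auto simp: ev_def)
qed

lemma ev_eqI: "a \<in> exponents n \<Longrightarrow> S \<in> Ls \<Longrightarrow> eig (wt a S) w \<Longrightarrow> coef w a = top a S \<Longrightarrow> w = ev a S"
  using eig_unique ev by metis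

lemma eig_multiple:
  assumes "a \<in> exponents n" "S \<in> Ls" "eig (wt a S) w"
  obtains z where "w = sop z (ev a S)"
proof -
  obtain z where "coef w a = scal z * top a S" using eig_top(2)[OF assms] by blast
  then have "w = sop z (ev a S)"
    by (intro eig_unique[OF assms eig_sop[OF ev(1)]]) (simp_all add: assms ev coef_sop)
  then show thesis by (rule that)
qed

lemma ev_nonzero: "a \<in> exponents n \<Longrightarrow> S \<in> Ls \<Longrightarrow> sop z (ev a S) = 0 \<Longrightarrow> z = 0"
  using coef_sop[of z "ev a S" a] top_independent1[of S z a] ev by auto

text \<open>The intertwiner \<open>\<sigma>\<^sub>j\<close>, as it acts on joint eigenvectors with eigenvalues \<open>\<kappa>\<close>.\<close>

definition sig :: "nat \<Rightarrow> (nat \<Rightarrow> complex) \<Rightarrow> pol \<Rightarrow> pol" where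
  "sig j \<kappa> w = pop (transpose j (Suc j)) w - sop (c / (\<kappa> j - \<kappa> (Suc j))) w"

lemma eig_sig:
  assumes j: "1 \<le> j" "Suc j \<le> n" and w: "eig \<kappa> w" and ne: "\<kappa> j \<noteq> \<kappa> (Suc j)"
  shows "eig (\<kappa> \<circ> transpose j (Suc j)) (sig j \<kappa> w)"
proof -
  let ?s = "transpose j (Suc j)"
  define q where "q = c / (\<kappa> j - \<kappa> (Suc j))"
  have sig: "sig j \<kappa> w = pop ?s w - sop q w" by (simp add: sig_def q_def)
  have wV: "w \<in> pols n V" and u: "\<And>i. i \<in> {1..n} \<Longrightarrow> uop n c i w = sop (\<kappa> i) w" using w by (auto simp: eig_def)
  \<comment> \<open>This identity absorbs the constant \<open>c\<close> of the Hecke relation into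
    the eigenvalues, and it dictates the scalar in \<open>\<sigma>_j\<close>.\<close>
  have k: "c = q * \<kappa> j - q * \<kappa> (Suc j)" unfolding right_diff_distrib[symmetric] using ne by (simp add: q_def)
  have "uop n c i (sig j \<kappa> w) = sop (\<kappa> (?s i)) (sig j \<kappa> w)" if i: "i \<in> {1..n}" for i
  proof -
    consider "i = j" | "i = Suc j" | "i \<noteq> j" "i \<noteq> Suc j" by blast
    then show ?thesis
    proof cases
      case 1
      have "uop n c j (pop ?s w) = sop (\<kappa> (Suc j)) (pop ?s w) + sop c w"
        using pop_uop_simple_Suc[OF j, of c w] u[of "Suc j"] j by (simp add: pop_sop)
      then have "uop n c j (sig j \<kappa> w) = sop (\<kappa> (Suc j)) (pop ?s w) + sop (c - q * \<kappa> j) w"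
        using u[of j] j by (simp add: sig uop_simps uop_sop sop_sop sop_minus)
      also have "c - q * \<kappa> j = - (\<kappa> (Suc j) * q)" using k by (simp add: algebra_simps)
      finally show ?thesis using 1 by (simp add: sig sop_simps sop_sop sop_uminus)
    next
      case 2
      have "uop n c (Suc j) (pop ?s w) = sop (\<kappa> j) (pop ?s w) - sop c w"
        using pop_uop_simple[OF j, of c w] u[of j] j by (simp add: pop_sop)
      then have "uop n c (Suc j) (sig j \<kappa> w) = sop (\<kappa> j) (pop ?s w) - sop (c + q * \<kappa> (Suc j)) w"
        using u[of "Suc j"] j by (simp add: sig uop_simps uop_sop sop_sop sop_plus)
      also have "c + q * \<kappa> (Suc j) = \<kappa> j * q" using k by (simp add: algebra_simps)
      finally show ?thesis using 2 by (simp add: sig sop_simps sop_sop)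
    next
      case 3
      then have "uop n c i (pop ?s w) = sop (\<kappa> i) (pop ?s w)"
        using pop_uop_simple_other[OF j 3, of c w] u[OF i] by (simp add: pop_sop)
      then show ?thesis using 3 u[OF i] by (simp add: sig uop_simps uop_sop sop_simps sop_sop mult.commute)
    qed
  qed
  moreover have "sig j \<kappa> w \<in> pols n V"
    unfolding sig using j wV by (intro pols_diff[OF V] pols_pop[OF V] pols_sop[OF V] transpose_permutes) auto
  ultimately show ?thesis by (simp add: eig_def)
qed

end

section \<open>Contents of hooks\<close>

text \<open>A standard tableau of hook shape is encoded by the set \<open>L\<close> of the entries of its leg, and \<open>hct L k\<close> is
  the content of the box with entry \<open>k\<close>.\<close>

definition legsets :: "nat \<Rightarrow> nat \<Rightarrow> nat set set" where
  "legsets n l = {L. L \<subseteq> {2..n} \<and> card L = l}"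

definition hct :: "nat set \<Rightarrow> nat \<Rightarrow> int" where
  "hct L k = (if k \<in> L then - int (card {j \<in> L. j \<le> k}) else int (card ({1..<k} - L)))"

lemma finite_legsets: "finite (legsets n l)"
  by (rule finite_subset[of _ "Pow {2..n}"]) (auto simp: legsets_def)

lemma legsets_finite: "L \<in> legsets n l \<Longrightarrow> finite L"
  by (auto simp: legsets_def intro: finite_subset)

lemma hct_neg_iff: "finite L \<Longrightarrow> hct L k < 0 \<longleftrightarrow> k \<in> L"
  by (auto simp: hct_def card_gt_0_iff)

lemma hct_1: "L \<in> legsets n l \<Longrightarrow> hct L (Suc 0) = 0"
  by (auto simp: hct_def legsets_def)

lemma hct_Suc_leg:
  assumes "finite L" "k \<in> L" "Suc k \<in> L"
  shows "hct L (Suc k) = hct L k - 1"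
proof -
  have "{j \<in> L. j \<le> Suc k} = insert (Suc k) {j \<in> L. j \<le> k}" using assms by (auto simp: le_Suc_eq)
  then show ?thesis using assms by (simp add: hct_def)
qed

lemma hct_Suc_arm:
  assumes "1 \<le> k" "k \<notin> L" "Suc k \<notin> L"
  shows "hct L (Suc k) = hct L k + 1"
proof -
  have "{1..<Suc k} - L = insert k ({1..<k} - L)" using assms by auto
  then show ?thesis using assms by (simp add: hct_def)
qed

text \<open>Keeps the denominator in \<open>\<sigma>_j\<close> away from zero.\<close>

lemma hct_Suc_neq:
  assumes "finite L" "1 \<le> k"
  shows "hct L k \<noteq> hct L (Suc k)"
proof
  assume e: "hct L k = hct L (Suc k)"
  have "k \<in> L \<longleftrightarrow> Suc k \<in> L"
    using hct_neg_iff[OF assms(1), of k] hct_neg_iff[OF assms(1), of "Suc k"] unfolding e by blast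
  then have "hct L (Suc k) = hct L k - 1 \<or> hct L (Suc k) = hct L k + 1"
    using hct_Suc_leg[OF assms(1), of k] hct_Suc_arm[OF assms(2), of L] by blast
  then show False unfolding e by linarith
qed

lemma hct_range:
  assumes "L \<in> legsets n l" "k \<in> {1..n}"
  shows "- int l \<le> hct L k" "hct L k \<le> int n - int l - 1"
proof -
  have L: "L \<subseteq> {2..n}" "card L = l" "finite L" using assms(1) legsets_finite[OF assms(1)] assms by (auto simp: legsets_def)
  have "card {j \<in> L. j \<le> k} \<le> card L" using L by (intro card_mono) auto
  then show "- int l \<le> hct L k" using L by (auto simp: hct_def)
  have "L \<subseteq> {1..n}" using L by auto
  then have ln: "card ({1..n} - L) = n - l" "l \<le> n"
    using L card_Diff_subset[of L "{1..n}"] card_mono[of "{1..n}" L] by auto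
  show "hct L k \<le> int n - int l - 1"
  proof (cases "k \<in> L")
    case True
    then have "hct L k < 0" using hct_neg_iff L by blast
    moreover have "L \<subseteq> {1..n} - {1}" using L by auto
    then have "l < n" using assms(2) L card_mono[of "{1..n} - {1}" L] by auto
    ultimately show ?thesis by simp
  next
    case False
    have "card ({1..<k} - L) \<le> card (({1..n} - L) - {k})" using assms(2) by (intro card_mono) auto
    also have "\<dots> = n - l - 1" using False assms(2) ln by simp
    finally have "card ({1..<k} - L) \<le> n - l - 1" .
    moreover have "0 < n - l" using False assms(2) ln by (metis DiffI card_gt_0_iff empty_iff finite_Diff finite_atLeastAtMost)
    ultimately show ?thesis using False by (simp add: hct_def)
  qed
qed

lemma hct_determines:
  assumes "L \<in> legsets n l" "L' \<in> legsets n l" "\<And>k. k \<in> {1..n} \<Longrightarrow> hct L k = hct L' k"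
  shows "L = L'"
proof -
  have "k \<in> L \<longleftrightarrow> k \<in> L'" if "k \<in> {1..n}" for k
    using assms(3)[OF that] hct_neg_iff[OF legsets_finite[OF assms(1)], of k]
      hct_neg_iff[OF legsets_finite[OF assms(2)], of k] by simp
  moreover have "L \<subseteq> {1..n}" "L' \<subseteq> {1..n}" using assms by (auto simp: legsets_def)
  ultimately show ?thesis by blast
qed

section \<open>Moving an entry of the leg, and removing its largest entry\<close>

definition leg_swap :: "nat \<Rightarrow> nat set \<Rightarrow> nat set" where
  "leg_swap j L = insert (Suc j) (L - {j})"

lemma leg_swap_in:
  assumes "L \<in> legsets n l" "j \<in> L" "Suc j \<notin> L" "Suc j \<le> n"
  shows "leg_swap j L \<in> legsets n l"
proof -
  have "Suc (card (L - {j})) = card L" using assms legsets_finite[OF assms(1)] by (intro card_Suc_Diff1)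
  then show ?thesis using assms legsets_finite[OF assms(1)] by (auto simp: legsets_def leg_swap_def simp del: card_Diff_insert)
qed

lemma hct_leg_swap:
  assumes "finite L" "j \<in> L" "Suc j \<notin> L" "1 \<le> j" "1 \<le> i"
  shows "hct (leg_swap j L) i = hct L (transpose j (Suc j) i)"
proof -
  let ?L = "leg_swap j L"
  consider "i = j" | "i = Suc j" | "i < j" | "Suc j < i" by linarith
  then show ?thesis
  proof cases
    case 1
    have "{1..<j} - ?L = {1..<Suc j} - L" using assms by (auto simp: leg_swap_def less_Suc_eq)
    then show ?thesis using 1 assms by (simp add: hct_def leg_swap_def)
  next
    case 2
    have "{k \<in> ?L. k \<le> Suc j} = insert (Suc j) ({k \<in> L. k \<le> j} - {j})"
      using assms by (auto simp: leg_swap_def le_Suc_eq)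
    then have "card {k \<in> ?L. k \<le> Suc j} = Suc (card ({k \<in> L. k \<le> j} - {j}))" using assms by simp
    also have "\<dots> = card {k \<in> L. k \<le> j}" using assms by (intro card_Suc_Diff1) auto
    finally show ?thesis using 2 assms by (simp add: hct_def leg_swap_def)
  next
    case 3
    then have "{k \<in> ?L. k \<le> i} = {k \<in> L. k \<le> i}" "{1..<i} - ?L = {1..<i} - L" "i \<in> ?L \<longleftrightarrow> i \<in> L"
      by (auto simp: leg_swap_def)
    then show ?thesis using 3 by (simp add: hct_def)
  next
    case 4
    then have "{k \<in> ?L. k \<le> i} = insert (Suc j) ({k \<in> L. k \<le> i} - {j})" by (auto simp: leg_swap_def)
    then have "card {k \<in> ?L. k \<le> i} = Suc (card ({k \<in> L. k \<le> i} - {j}))" using assms by simp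
    also have "\<dots> = card {k \<in> L. k \<le> i}" using assms 4 by (intro card_Suc_Diff1) auto
    finally have 1: "card {k \<in> ?L. k \<le> i} = card {k \<in> L. k \<le> i}" .
    have "{1..<i} - ?L = insert j (({1..<i} - L) - {Suc j})"
    proof (rule Set.set_eqI)
      fix x show "x \<in> {1..<i} - ?L \<longleftrightarrow> x \<in> insert j (({1..<i} - L) - {Suc j})"
        using 4 assms by (cases "x = j"; cases "x = Suc j") (simp_all add: leg_swap_def)
    qed
    then have "card ({1..<i} - ?L) = Suc (card (({1..<i} - L) - {Suc j}))" using assms by simp
    also have "\<dots> = card ({1..<i} - L)" using assms 4 by (intro card_Suc_Diff1) auto
    finally have 2: "card ({1..<i} - ?L) = card ({1..<i} - L)" .
    have "i \<in> ?L \<longleftrightarrow> i \<in> L" using 4 by (auto simp: leg_swap_def)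
    then show ?thesis using 1 2 4 by (simp add: hct_def)
  qed
qed

lemma hct_above:
  assumes "S \<subseteq> {1..<k}" "1 \<le> k"
  shows "hct S k = int k - 1 - int (card S)"
proof -
  have "card ({1..<k} - S) = (k - 1) - card S" "card S \<le> k - 1"
    using assms card_Diff_subset[of S "{1..<k}"] card_mono[of "{1..<k}" S] finite_subset[of S "{1..<k}"] by auto
  then show ?thesis using assms by (auto simp: hct_def)
qed

lemma legsets_Max:
  assumes "L \<in> legsets n l" "1 \<le> l"
  shows "Max L \<in> L" "Max L \<in> {2..n}" "L - {Max L} \<in> legsets n (l - 1)" "L - {Max L} \<subseteq> {2..<Max L}"
    "hct L (Max L) = - int l"
proof -
  have L: "L \<subseteq> {2..n}" "card L = l" "finite L" "L \<noteq> {}" using legsets_finite[OF assms(1)] assms by (auto simp: legsets_def)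
  show m: "Max L \<in> L" using L by simp
  then show "Max L \<in> {2..n}" using L by blast
  show "L - {Max L} \<in> legsets n (l - 1)" using L m by (auto simp: legsets_def)
  have le: "x \<le> Max L" if "x \<in> L" for x using that L by simp
  show "L - {Max L} \<subseteq> {2..<Max L}"
  proof
    fix x assume "x \<in> L - {Max L}"
    then show "x \<in> {2..<Max L}" using le[of x] L(1) by auto
  qed
  have "{j \<in> L. j \<le> Max L} = L" using le by auto
  then show "hct L (Max L) = - int l" using L m by (simp add: hct_def)
qed

lemma hct_bottom:
  assumes "L \<in> legsets n l" "1 \<le> l" "hct L k = - int l"
  shows "k = Max L"
proof -
  have L: "finite L" "card L = l" using assms(1) legsets_finite[OF assms(1)] assms by (auto simp: legsets_def)
  have k: "k \<in> L" using assms hct_neg_iff[OF L(1), of k] by simp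
  then have "card {j \<in> L. j \<le> k} = card L" using assms L by (simp add: hct_def)
  then have "{j \<in> L. j \<le> k} = L" using L by (intro card_subset_eq) auto
  then show ?thesis using k L by (intro Max_eqI[symmetric]) auto
qed

lemma hct_remove_Max:
  assumes "L \<in> legsets n l" "1 \<le> l"
  shows "1 \<le> i \<Longrightarrow> i < Max L \<Longrightarrow> hct (L - {Max L}) i = hct L i"
    "Max L \<le> k \<Longrightarrow> hct (L - {Max L}) k = int k - int l"
    "Max L < i \<Longrightarrow> hct L i = int i - 1 - int l"
proof -
  have L: "L \<subseteq> {2..n}" "card L = l" "finite L" using assms(1) legsets_finite[OF assms(1)] assms by (auto simp: legsets_def)
  note M = legsets_Max[OF assms]
  show "hct (L - {Max L}) i = hct L i" if "1 \<le> i" "i < Max L"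
  proof -
    have "{j \<in> L - {Max L}. j \<le> i} = {j \<in> L. j \<le> i}" "{1..<i} - (L - {Max L}) = {1..<i} - L"
      using that by auto
    then show ?thesis using that by (simp add: hct_def)
  qed
  show "hct (L - {Max L}) k = int k - int l" if "Max L \<le> k"
  proof -
    have "{2..<Max L} \<subseteq> {1..<k}" "1 \<le> k" using M(2) that by auto
    then have "L - {Max L} \<subseteq> {1..<k}" "1 \<le> k" using M(4) by blast+
    moreover have "card (L - {Max L}) = l - 1" using M(3) by (simp add: legsets_def)
    ultimately show ?thesis using hct_above[of "L - {Max L}" k] assms(2) by simp
  qed
  show "hct L i = int i - 1 - int l" if "Max L < i"
  proof -
    have "x < i" if "x \<in> L" for x using Max_ge[OF L(3) that] \<open>Max L < i\<close> by simp
    then have "L \<subseteq> {1..<i}" using L(1) by (auto simp: subset_iff)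
    then show ?thesis using hct_above[of L i] that L by simp
  qed
qed

text \<open>If \<open>j\<close> and \<open>j + 1\<close> lie in one row or column, the content
  changes by one in a direction fixed by its sign, so no tableau \<open>S\<close> shows the two
  contents in opposite order at consecutive entries. For \<open>j = 1\<close> the entry
  \<open>1\<close> would need a negative content. Taking \<open>k\<close> apart from
  \<open>j\<close> allows for the shift by one caused by sorting \<open>m e_p\<close>.\<close>

lemma hct_not_swapped:
  assumes "finite L" "S \<in> legsets n l" "1 \<le> j" "1 \<le> k" "j = 1 \<Longrightarrow> k = 1"
    and c: "j \<in> L \<and> Suc j \<in> L \<or> j \<notin> L \<and> Suc j \<notin> L \<or> j = 1"
    and "hct S k = hct L (Suc j)" "hct S (Suc k) = hct L j"
    and "1 \<notin> L"
  shows False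
proof -
  have S: "finite S" using legsets_finite[OF assms(2)] .
  note neg = hct_neg_iff[OF S] hct_neg_iff[OF assms(1)]
  consider "j \<in> L" "Suc j \<in> L" | "j \<notin> L" "Suc j \<notin> L" | "j = 1" "Suc j \<in> L" using c assms(9) by blast
  then show False
  proof cases
    case 1
    then have "k \<in> S" "Suc k \<in> S" using neg assms by metis+
    then show False using 1 hct_Suc_leg[OF S, of k] hct_Suc_leg[OF assms(1), of j] assms by simp
  next
    case 2
    then have "k \<notin> S" "Suc k \<notin> S" using neg assms by metis+
    then show False using 2 hct_Suc_arm[of k S] hct_Suc_arm[of j L] assms by simp
  next
    case 3
    then have "hct S (Suc 0) = hct L (Suc j)" using assms by simp
    moreover have "hct L (Suc j) < 0" using 3 neg(2) by blast
    ultimately show False using hct_1[OF assms(2)] by simp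
  qed
qed

text \<open>Every leg arises from \<open>{2..<l + 2}\<close> by moves \<open>leg_swap\<close>. The
  induction is on the sum of the entries and lowers one entry by one.\<close>

lemma legsets_const:
  assumes step: "\<And>L j. L \<in> legsets n l \<Longrightarrow> j \<in> L \<Longrightarrow> Suc j \<notin> L \<Longrightarrow> Suc j \<le> n \<Longrightarrow> f (leg_swap j L) = f L"
    and L: "L \<in> legsets n l"
  shows "f L = f {2..<l + 2}"
  using L
proof (induction "\<Sum>L" arbitrary: L rule: less_induct)
  case less
  have L: "L \<subseteq> {2..n}" "card L = l" "finite L" using less.prems legsets_finite[OF less.prems] by (auto simp: legsets_def)
  show ?case
  proof (cases "\<exists>j. Suc j \<in> L \<and> j \<notin> L \<and> 2 \<le> j")
    case True
    then obtain j where j: "Suc j \<in> L" "j \<notin> L" "2 \<le> j" by blast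
    let ?K = "insert j (L - {Suc j})"
    have jn: "Suc j \<le> n" using j L by auto
    have "card ?K = Suc (card (L - {Suc j}))" using L j by simp
    also have "\<dots> = card L" using L j by (intro card_Suc_Diff1) auto
    finally have K: "?K \<in> legsets n l" using L j jn by (auto simp: legsets_def)
    have "\<Sum>L = Suc j + \<Sum>(L - {Suc j})" using L j by (simp add: sum.remove)
    moreover have "\<Sum>?K = j + \<Sum>(L - {Suc j})" using L j by simp
    ultimately have "f ?K = f {2..<l + 2}" using less.hyps[of ?K] K by simp
    moreover have "leg_swap j ?K = L" using j by (auto simp: leg_swap_def)
    ultimately show ?thesis using step[OF K, of j] jn by auto
  next
    case False
    have down: "j \<in> L" if "k \<in> L" "2 \<le> j" "j \<le> k" for j k
      using that(3,1,2) by (induction rule: inc_induct) (use False that in auto)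
    have "L = {2..<l + 2}"
    proof (cases "L = {}")
      case True
      then show ?thesis using L by simp
    next
      case ne: False
      define M where "M = Max L"
      have M: "M \<in> L" "\<And>x. x \<in> L \<Longrightarrow> x \<le> M" using L(3) ne by (simp_all add: M_def)
      have "L \<subseteq> {2..M}" using M(2) L(1) by (auto simp: subset_iff)
      moreover have "{2..M} \<subseteq> L" using down[OF M(1)] by (auto simp: subset_iff)
      ultimately have LM: "L = {2..M}" by (rule subset_antisym)
      have "2 \<le> M" using M(1) L(1) by auto
      moreover have "l = card {2..M}" using L(2) LM by simp
      ultimately have "{2..<l + 2} = {2..M}" by auto
      then show ?thesis using LM by simp
    qed
    then show ?thesis by simp
  qed
qed

section \<open>The exponents \<open>m e_p\<close> and the arithmetic of joint eigenvalues\<close>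

definition mexp :: "nat \<Rightarrow> nat \<Rightarrow> nat \<Rightarrow> nat" where
  "mexp m p i = m * e_vec p i"

lemma mexp_exponents: "p \<in> {1..n} \<Longrightarrow> mexp m p \<in> exponents n"
  by (auto simp: mexp_def e_vec_def exponents_def)

text \<open>The only positive exponent goes last, and the places after \<open>p\<close> close
  up.\<close>

lemma sort_perm_mexp:
  assumes "0 < m" "p \<in> {1..n}" "i \<in> {1..n}"
  shows "sort_perm n (mexp m p) i = (if i < p then i else if i = p then n else i - 1)"
proof -
  consider "i < p" | "i = p" | "p < i" by linarith
  then show ?thesis
  proof cases
    case 1
    then have "dset n (mexp m p) i = {1..<i}" using assms by (auto simp: dset_def mexp_def e_vec_def)
    then show ?thesis using 1 assms by (simp add: sort_perm_dset)
  next
    case 2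
    then have "dset n (mexp m p) i = {1..n} - {p}" using assms by (auto simp: dset_def mexp_def e_vec_def)
    then show ?thesis using 2 assms by (simp add: sort_perm_dset)
  next
    case 3
    then have "dset n (mexp m p) i = {1..<i} - {p}" using assms by (auto simp: dset_def mexp_def e_vec_def split: if_splits)
    then show ?thesis using 3 assms by (simp add: sort_perm_dset)
  qed
qed

lemma sort_perm_zero: "sort_perm n (\<lambda>_. 0) = id"
proof
  fix i
  show "sort_perm n (\<lambda>_. 0) i = id i"
  proof (cases "i \<in> {1..n}")
    case True
    then have "dset n (\<lambda>_. 0) i = {1..<i}" by (auto simp: dset_def)
    then show ?thesis using True by (simp add: sort_perm_dset)
  next
    case False
    then show ?thesis unfolding sort_perm_def by (simp only: if_False id_apply)
  qed
qed

text \<open>Clearing the denominator \<open>n\<close> turns equality of eigenvalues into an equation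
  between integers, to which coprimality applies.\<close>

lemma weight_eq_int:
  fixes m n A B :: nat and x y :: int
  assumes "0 < n" "coprime m n" and "of_nat A - of_int x * (of_nat m / of_nat n) = (of_nat B - of_int y * (of_nat m / of_nat n) :: complex)"
  shows "int n * (int A - int B) = int m * (x - y)" "int n dvd x - y"
proof -
  have "of_int (int n * (int A - int B)) = (of_int (int m * (x - y)) :: complex)"
    using assms(1,3) by (simp add: field_simps)
  then show e: "int n * (int A - int B) = int m * (x - y)" by (simp only: of_int_eq_iff)
  have "int n dvd int m * (x - y)" by (metis dvd_triv_left e)
  moreover have "coprime (int n) (int m)" using assms(2) by (simp add: coprime_commute)
  ultimately show "int n dvd x - y" using coprime_dvd_mult_right_iff by blast
qed

text \<open>At each place the difference of contents is divisible by \<open>n\<close> and smaller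
  than \<open>n\<close> in absolute value. So contents agree, then exponents, and the contents
  determine the leg.\<close>

lemma hook_simple:
  fixes c :: complex
  assumes "0 < n" "coprime m n" "c = of_nat m / of_nat n"
    and "a \<in> exponents n" "b \<in> exponents n" "L \<in> legsets n l" "L' \<in> legsets n l"
    and w: "\<And>i. i \<in> {1..n} \<Longrightarrow> of_nat (a i) - of_int (hct L (sort_perm n a i)) * c = of_nat (b i) - of_int (hct L' (sort_perm n b i)) * c"
  shows "a = b \<and> L = L'"
proof -
  have e: "a i = b i \<and> hct L (sort_perm n a i) = hct L' (sort_perm n b i)" if i: "i \<in> {1..n}" for i
  proof -
    let ?x = "hct L (sort_perm n a i)" and ?y = "hct L' (sort_perm n b i)"
    have "sort_perm n a i \<in> {1..n}" "sort_perm n b i \<in> {1..n}"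
      using permutes_in_image[OF sort_perm_permutes] i by blast+
    then have "\<bar>?x - ?y\<bar> < int n"
      using hct_range[OF assms(6)] hct_range[OF assms(7)] by (smt (verit))
    moreover note d = weight_eq_int[OF assms(1,2) w[OF i, unfolded assms(3)]]
    ultimately have "?x - ?y = 0" using dvd_imp_le_int[of "?x - ?y" "int n"] by fastforce
    moreover have "int n * (int (a i) - int (b i)) = 0" using d(1) calculation by simp
    ultimately show ?thesis using assms(1) by simp
  qed
  have "a i = b i" for i using e[of i] assms(4,5) by (cases "i \<in> {1..n}") (auto simp: exponents_def)
  then have ab: "a = b" by auto
  have "L = L'"
  proof (rule hct_determines[OF assms(6,7)])
    fix k assume "k \<in> {1..n}"
    then obtain i where "i \<in> {1..n}" "k = sort_perm n a i" using permutes_image[OF sort_perm_permutes[of n a]] by blast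
    then show "hct L k = hct L' k" using e[of i] ab by simp
  qed
  then show ?thesis using ab by simp
qed

text \<open>Between neighbouring hooks the contents may also differ by \<open>n\<close>, but only as
  \<open>-l\<close> against \<open>n - l\<close>, and \<open>-l\<close> belongs to the largest leg
  entry alone. There the exponent has to be \<open>m\<close>, elsewhere it is zero. The permutation
  \<open>s\<close> makes room for eigenvalues rearranged by some \<open>s_j\<close>.\<close>

lemma hook_weight_shift:
  fixes c :: complex
  assumes "0 < n" "coprime m n" "c = of_nat m / of_nat n" "1 \<le> l"
    and L: "L \<in> legsets n l" and S: "S \<in> legsets n (l - 1)" and b: "b \<in> exponents n"
    and s: "s permutes {1..n}" "s p' = Max L"
    and w: "\<And>i. i \<in> {1..n} \<Longrightarrow> - of_int (hct L (s i)) * c = of_nat (b i) - of_int (hct S (sort_perm n b i)) * c"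
  shows "b = mexp m p'" "\<And>i. i \<in> {1..n} \<Longrightarrow> i \<noteq> p' \<Longrightarrow> hct S (sort_perm n b i) = hct L (s i)"
proof -
  have e: "(i = p' \<longrightarrow> b i = m) \<and> (i \<noteq> p' \<longrightarrow> b i = 0 \<and> hct S (sort_perm n b i) = hct L (s i))" if i: "i \<in> {1..n}" for i
  proof -
    let ?x = "hct L (s i)" and ?y = "hct S (sort_perm n b i)"
    have "sort_perm n b i \<in> {1..n}" "s i \<in> {1..n}"
      using permutes_in_image[OF sort_perm_permutes] permutes_in_image[OF s(1)] i by blast+
    then have r: "- int l \<le> ?x" "?x \<le> int n - int l - 1" "- int l + 1 \<le> ?y" "?y \<le> int n - int l"
      using hct_range[OF L, of "s i"] hct_range[OF S, of "sort_perm n b i"] assms(4) by auto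
    have "of_nat (b i) - of_int ?y * (of_nat m / of_nat n) = (of_nat 0 - of_int ?x * (of_nat m / of_nat n) :: complex)"
      using w[OF i] assms(3) by simp
    note d = weight_eq_int[OF assms(1,2) this]
    then obtain q where q: "?y - ?x = int n * q" by blast
    have "- int n < int n * q" "int n * q < int n * 2" using r q assms(1) by linarith+
    then have "int n * (- 1) < int n * q" "int n * q < int n * 2" by simp_all
    then have "- 1 < q" "q < 2" using assms(1) by (simp_all only: mult_less_cancel_left_pos of_nat_0_less_iff)
    then have "q = 0 \<or> q = 1" by linarith
    moreover have "int n * int (b i) = int m * (int n * q)" using d(1) q by simp
    then have "int (b i) = int m * q" using assms(1) by simp
    moreover have "i = p' \<longleftrightarrow> ?x = - int l"
      using hct_bottom[OF L assms(4), of "s i"] legsets_Max(5)[OF L assms(4)] s(2) permutes_inj[OF s(1)]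
      by (metis injD)
    moreover have "q = 1 \<longleftrightarrow> ?x = - int l" using r q calculation(1) assms(1) by auto
    ultimately show ?thesis using q by auto
  qed
  have "p' \<in> {1..n}" using permutes_in_image[OF s(1), of p'] s(2) legsets_Max(2)[OF L assms(4)] by auto
  then have "b i = mexp m p' i" for i
    using e[of i] b by (cases "i \<in> {1..n}") (auto simp: exponents_def mexp_def e_vec_def)
  then show "b = mexp m p'" by auto
  show "\<And>i. i \<in> {1..n} \<Longrightarrow> i \<noteq> p' \<Longrightarrow> hct S (sort_perm n b i) = hct L (s i)" using e by blast
qed

section \<open>The singular vectors\<close>

text \<open>Counterpart of \<open>hook_weight_shift\<close> within a single hook, where only the
  zero exponent survives.\<close>

lemma hook_weight_same:
  fixes c :: complex
  assumes "0 < n" "coprime m n" "c = of_nat m / of_nat n"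
    and L: "L \<in> legsets n l" and S: "S \<in> legsets n l" and b: "b \<in> exponents n"
    and s: "s permutes {1..n}"
    and w: "\<And>i. i \<in> {1..n} \<Longrightarrow> - of_int (hct L (s i)) * c = of_nat (b i) - of_int (hct S (sort_perm n b i)) * c"
    and i: "i \<in> {1..n}"
  shows "hct S i = hct L (s i)"
proof -
  have e: "b i = 0 \<and> hct S (sort_perm n b i) = hct L (s i)" if i: "i \<in> {1..n}" for i
  proof -
    let ?x = "hct S (sort_perm n b i)" and ?y = "hct L (s i)"
    have "sort_perm n b i \<in> {1..n}" "s i \<in> {1..n}"
      using permutes_in_image[OF sort_perm_permutes] permutes_in_image[OF s] i by blast+
    then have "\<bar>?x - ?y\<bar> < int n"
      using hct_range[OF L] hct_range[OF S] by (smt (verit))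
    moreover have "of_nat (b i) - of_int ?x * (of_nat m / of_nat n) = (of_nat 0 - of_int ?y * (of_nat m / of_nat n) :: complex)"
      using w[OF i] assms(3) by simp
    note d = weight_eq_int[OF assms(1,2) this]
    ultimately have "?x - ?y = 0" using d(2) dvd_imp_le_int[of "?x - ?y" "int n"] by fastforce
    moreover have "int n * (int (b i) - int 0) = 0" using d(1) calculation by simp
    ultimately show ?thesis using assms(1) by simp
  qed
  have "b = (\<lambda>_. 0)"
  proof
    show "b i = 0" for i using e[of i] b by (cases "i \<in> {1..n}") (auto simp: exponents_def)
  qed
  then show ?thesis using e[OF i] by (simp add: sort_perm_zero)
qed

lemma coef_pop:
  assumes "bij g"
  shows "coef (pop g f) (exp_act g a) = perm_elt g * coef f a"
proof -
  have inj: "exp_act g b = exp_act g a \<longleftrightarrow> b = a" for b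
  proof
    assume e: "exp_act g b = exp_act g a"
    show "b = a"
    proof
      fix i show "b i = a i" using fun_cong[OF e, of "g i"] by (simp add: exp_act_apply assms)
    qed
  qed simp
  show ?thesis
    by (rule additive_poly_mapping_eqI[where h = "\<lambda>f. coef (pop g f) (exp_act g a)" and k = "\<lambda>f. perm_elt g * coef f a"])
      (simp_all add: additive_def op_simps lookup_add distrib_left lookup_single when_def inj)
qed

lemma exp_act_mexp: "bij g \<Longrightarrow> exp_act g (mexp m p) = mexp m (g p)"
proof
  fix i assume b: "bij g"
  obtain k where "i = g k" using b by (metis bij_pointE)
  then show "exp_act g (mexp m p) i = mexp m (g p) i"
    using b by (simp add: exp_act_apply mexp_def e_vec_def bij_is_inj inj_eq)
qed

text \<open>The normalized basis, indexed by leg sets and freed of \<open>Delta\<close>. In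
  \<open>norm\<close> the parameter \<open>c\<close> has cancelled: the value of
  \<open>c / (u_j - u_(j+1))\<close> on \<open>v L\<close> is the inverse of a difference of
  contents.\<close>

locale hook_rep =
  fixes n m l :: nat and c :: complex and V :: "smash set" and v :: "nat set \<Rightarrow> smash"
  assumes n_pos: "0 < n" and m_pos: "0 < m" and cop: "coprime m n" and c_def: "c = of_nat m / of_nat n"
    and V: "sn_space n V"
    and v_in: "L \<in> legsets n l \<Longrightarrow> v L \<in> V"
    and span: "x \<in> V \<Longrightarrow> \<exists>\<alpha>. x = (\<Sum>L\<in>legsets n l. scal (\<alpha> L) * v L)"
    and indep: "(\<Sum>L\<in>legsets n l. scal (\<alpha> L) * v L) = 0 \<Longrightarrow> L \<in> legsets n l \<Longrightarrow> \<alpha> L = 0"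
    and jm: "L \<in> legsets n l \<Longrightarrow> i \<in> {1..n} \<Longrightarrow> (\<Sum>j\<in>{1..<i}. transp i j * v L) = scal (of_int (hct L i)) * v L"
    and norm: "L \<in> legsets n l \<Longrightarrow> j \<in> L \<Longrightarrow> Suc j \<notin> L \<Longrightarrow> Suc j \<le> n \<Longrightarrow>
      v (leg_swap j L) = transp j (Suc j) * v L - scal (1 / of_int (hct L (Suc j) - hct L j)) * v L"
begin

sublocale spectral n c V "legsets n l" v "\<lambda>L i. of_int (hct L i)"
  "\<lambda>a L i. of_nat (a i) - of_int (hct L (sort_perm n a i)) * c"
  by unfold_locales
    (use V finite_legsets v_in span indep jm hook_simple[OF n_pos cop c_def] in \<open>simp_all del: One_nat_def\<close>)

abbreviation wt :: "(nat \<Rightarrow> nat) \<Rightarrow> nat set \<Rightarrow> nat \<Rightarrow> complex" where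
  "wt a L i \<equiv> of_nat (a i) - of_int (hct L (sort_perm n a i)) * c"

definition om :: "nat set \<Rightarrow> nat \<Rightarrow> complex" where
  "om L i = - of_int (hct L i) * c"

definition kap :: "nat set \<Rightarrow> nat \<Rightarrow> complex" where
  "kap L j = 1 / of_int (hct L (Suc j) - hct L j)"

lemma c_nonzero: "c \<noteq> 0"
  using n_pos m_pos by (simp add: c_def)

lemma wt_zero: "wt (\<lambda>_. 0) L i = om L i"
  by (simp add: sort_perm_zero om_def)

lemma zero_exponents: "(\<lambda>_. 0) \<in> exponents n"
  by (simp add: exponents_def)

lemma eig_cong: "(\<And>i. i \<in> {1..n} \<Longrightarrow> \<kappa> i = \<kappa>' i) \<Longrightarrow> eig \<kappa> w \<longleftrightarrow> eig \<kappa>' w"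
  by (simp add: eig_def)

lemma om_diff: "om L j - om L (Suc j) = c * of_int (hct L (Suc j) - hct L j)"
  by (simp add: om_def algebra_simps)

lemma om_Suc_neq: "L \<in> legsets n l' \<Longrightarrow> 1 \<le> j \<Longrightarrow> om L j \<noteq> om L (Suc j)"
  using hct_Suc_neq[OF legsets_finite, of L n l' j] c_nonzero by (simp add: om_def)

lemma sig_om: "sig j (om L) w = pop (transpose j (Suc j)) w - sop (kap L j) w"
  unfolding sig_def om_diff kap_def using c_nonzero by simp

lemma top_zero: "top (\<lambda>_. 0) L = v L"
  by (simp add: top_def sort_perm_zero)

lemma eig_zero: "L \<in> legsets n l \<Longrightarrow> eig (om L) (mon (\<lambda>_. 0) (v L))"
proof -
  assume L: "L \<in> legsets n l"
  have "uop n c i (mon (\<lambda>_. 0) (v L)) = sop (om L i) (mon (\<lambda>_. 0) (v L))" if i: "i \<in> {1..n}" for i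
  proof -
    have "jop i (mon (\<lambda>_. 0) (v L)) = mon (\<lambda>_. 0) (\<Sum>j\<in>{1..<i}. transp i j * v L)"
      by (simp add: jop_def additive.sum[OF additive_single] exp_act_def transp_def o_def)
    then show ?thesis using jm[OF L i]
      by (simp add: uop_def zop_def om_def op_simps scal_scal scal_minus single_uminus mult.commute del: yop_mon One_nat_def)
  qed
  then show ?thesis using L by (simp add: eig_def pols_mon[OF V zero_exponents] v_in)
qed

lemma ev_zero: "L \<in> legsets n l \<Longrightarrow> mon (\<lambda>_. 0) (v L) = ev (\<lambda>_. 0) L"
  using eig_zero wt_zero by (intro ev_eqI zero_exponents) (simp_all add: top_zero)

text \<open>A nonzero \<open>\<sigma>_j v_L\<close> would carry the eigenvalues of
  \<open>v_L\<close> with the places \<open>j\<close> and \<open>j + 1\<close> exchanged, and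
  \<open>hct_not_swapped\<close> excludes these.\<close>

lemma transp_reflect:
  assumes L: "L \<in> legsets n l" and j: "1 \<le> j" "Suc j \<le> n"
    and C: "j \<in> L \<and> Suc j \<in> L \<or> j \<notin> L \<and> Suc j \<notin> L \<or> j = 1"
  shows "transp j (Suc j) * v L = scal (kap L j) * v L"
proof -
  let ?s = "transpose j (Suc j)" and ?w = "mon (\<lambda>_. 0) (v L)"
  have s: "?s permutes {1..n}" using j by (intro transpose_permutes) auto
  have "sig j (om L) ?w = 0"
  proof (rule ccontr)
    assume "sig j (om L) ?w \<noteq> 0"
    with eig_sig[OF j eig_zero[OF L] om_Suc_neq[OF L j(1)]] obtain b S where
      b: "b \<in> exponents n" "S \<in> legsets n l" "\<And>i. i \<in> {1..n} \<Longrightarrow> (om L \<circ> ?s) i = wt b S i"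
      using eig_weight by metis
    then have e: "hct S i = hct L (?s i)" if "i \<in> {1..n}" for i
      using that by (intro hook_weight_same[OF n_pos cop c_def L b(2,1) s]) (simp_all add: om_def)
    have "1 \<notin> L" using L by (auto simp: legsets_def)
    then show False
      using hct_not_swapped[OF legsets_finite[OF L] b(2) j(1) j(1) _ C] e[of j] e[of "Suc j"] j by simp
  qed
  then have "mon (\<lambda>_. 0) (transp j (Suc j) * v L) = mon (\<lambda>_. 0) (scal (kap L j) * v L)"
    by (simp add: sig_om exp_act_def transp_def o_def)
  then show ?thesis by (metis lookup_single_eq)
qed

end

locale hook_pair = N: hook_rep n m l c V v + M: hook_rep n m "l - 1" c V' v'
  for n m l :: nat and c :: complex and V V' :: "smash set" and v v' :: "nat set \<Rightarrow> smash" +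
  assumes l: "1 \<le> l"
begin

definition W :: "nat set \<Rightarrow> pol" where
  "W L = M.ev (mexp m (Max L)) (L - {Max L})"

lemma wt_Max:
  assumes L: "L \<in> legsets n l" and i: "i \<in> {1..n}"
  shows "M.wt (mexp m (Max L)) (L - {Max L}) i = M.om L i"
proof -
  note M = legsets_Max[OF L l] and R = hct_remove_Max[OF L l]
  have p: "Max L \<in> {1..n}" using M(2) by auto
  note s = sort_perm_mexp[OF M.m_pos p i]
  consider "i < Max L" | "i = Max L" | "Max L < i" by linarith
  then show ?thesis
  proof cases
    case 1
    then show ?thesis using R(1)[of i] i s by (simp add: mexp_def e_vec_def M.om_def)
  next
    case 2
    have "of_nat m - (of_nat n - of_nat l) * c = of_nat l * c" using M.n_pos by (simp add: M.c_def field_simps)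
    then show ?thesis using R(2)[of n] M(2,5) 2 s by (simp add: mexp_def e_vec_def M.om_def)
  next
    case 3
    have "hct (L - {Max L}) (i - 1) = hct L i" using R(2)[of "i - 1"] R(3)[of i] 3 i by (simp add: of_nat_diff)
    then show ?thesis using 3 s by (simp add: mexp_def e_vec_def M.om_def)
  qed
qed

lemma Max_in: "L \<in> legsets n l \<Longrightarrow> mexp m (Max L) \<in> exponents n"
  using legsets_Max(2)[OF _ l] by (intro mexp_exponents) force

lemma eig_wt_Max:
  "L \<in> legsets n l \<Longrightarrow> M.eig (M.wt (mexp m (Max L)) (L - {Max L})) w \<longleftrightarrow> M.eig (M.om L) w"
  by (rule M.eig_cong) (rule wt_Max)

lemma W_eig: "L \<in> legsets n l \<Longrightarrow> M.eig (M.om L) (W L)"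
  using M.ev(1)[OF Max_in legsets_Max(3)[OF _ l]] by (simp add: W_def flip: eig_wt_Max)

lemma W_eqI:
  assumes "L \<in> legsets n l" "M.eig (M.om L) w" "coef w (mexp m (Max L)) = M.top (mexp m (Max L)) (L - {Max L})"
  shows "w = W L"
  unfolding W_def using assms
  by (intro M.ev_eqI[OF Max_in[OF assms(1)] legsets_Max(3)[OF assms(1) l]]) (simp_all add: eig_wt_Max)

lemma W_multiple:
  assumes "L \<in> legsets n l" "M.eig (M.om L) w"
  obtains z where "w = sop z (W L)"
  using M.eig_multiple[OF Max_in[OF assms(1)] legsets_Max(3)[OF assms(1) l]] assms that
  by (auto simp: eig_wt_Max W_def)

lemma W_nonzero: "L \<in> legsets n l \<Longrightarrow> sop z (W L) = 0 \<Longrightarrow> z = 0"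
  unfolding W_def using M.ev_nonzero[OF Max_in legsets_Max(3)[OF _ l]] by blast

lemma sort_perm_mexp_swap:
  assumes j: "1 \<le> j" "Suc j \<le> n"
  shows "sort_perm n (mexp m (Suc j)) = sort_perm n (mexp m j) \<circ> transpose j (Suc j)"
proof
  fix i
  have jn: "j \<in> {1..n}" "Suc j \<in> {1..n}" using j by auto
  show "sort_perm n (mexp m (Suc j)) i = (sort_perm n (mexp m j) \<circ> transpose j (Suc j)) i"
  proof (cases "i \<in> {1..n}")
    case True
    then have "transpose j (Suc j) i \<in> {1..n}" using jn by (auto simp: transpose_def)
    then show ?thesis
      using sort_perm_mexp[OF M.m_pos jn(2) True] sort_perm_mexp[OF M.m_pos jn(1), of "transpose j (Suc j) i"] True
      by (auto simp: transpose_def)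
  next
    case False
    then have "transpose j (Suc j) i = i" using jn by (auto simp: transpose_def)
    then show ?thesis using permutes_not_in[OF sort_perm_permutes False] by simp
  qed
qed

text \<open>The exponent \<open>m\<close> moves from place \<open>j\<close> to \<open>j + 1\<close>,
  which is upward in \<open>lt\<close>. So the new top coefficient comes from \<open>s_j\<close>
  alone, and no scalar appears.\<close>

lemma sig_mexp:
  assumes S: "S \<in> legsets n (l - 1)" and j: "1 \<le> j" "Suc j \<le> n"
  shows "M.sig j (M.wt (mexp m j) S) (M.ev (mexp m j) S) = M.ev (mexp m (Suc j)) S"
proof -
  let ?s = "transpose j (Suc j)" and ?k = "M.wt (mexp m j) S" and ?w = "M.ev (mexp m j) S"
  have jn: "j \<in> {1..n}" "Suc j \<in> {1..n}" using j by auto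
  have s: "bij ?s" by simp
  note ex = mexp_exponents[OF jn(1), of m] mexp_exponents[OF jn(2), of m]
  \<comment> \<open>Equality would make two contents of one hook differ by exactly
    \<open>n\<close>.\<close>
  have ne: "?k j \<noteq> ?k (Suc j)"
  proof
    assume "?k j = ?k (Suc j)"
    then have "of_nat m - of_int (hct S n) * (of_nat m / of_nat n) = (of_nat 0 - of_int (hct S j) * (of_nat m / of_nat n) :: complex)"
      using sort_perm_mexp[OF M.m_pos jn(1) jn(1)] sort_perm_mexp[OF M.m_pos jn(1) jn(2)] M.c_def
      by (simp add: mexp_def e_vec_def)
    from weight_eq_int(1)[OF M.n_pos M.cop this] have "int n = hct S n - hct S j" using M.m_pos by simp
    then show False using hct_range[OF S, of n] hct_range[OF S, of j] jn by simp
  qed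
  show ?thesis
  proof (rule M.ev_eqI[OF ex(2) S])
    have k: "(?k \<circ> ?s) i = M.wt (mexp m (Suc j)) S i" for i
      using sort_perm_mexp_swap[OF j] exp_act_mexp[OF s, of m j]
      by (simp add: exp_act_transpose fun_eq_iff)
    have "M.eig (?k \<circ> ?s) (M.sig j ?k ?w)" by (rule M.eig_sig[OF j M.ev(1)[OF ex(1) S] ne])
    then show "M.eig (M.wt (mexp m (Suc j)) S) (M.sig j ?k ?w)" by (rule M.eig_cong[OF k, THEN iffD1])
    have lt: "lt n (mexp m j) (mexp m (Suc j))"
    proof -
      have "(mexp m (Suc j))(Suc j := mexp m (Suc j) j, j := mexp m (Suc j) (Suc j)) = mexp m j"
        by (auto simp: mexp_def e_vec_def fun_eq_iff)
      then show ?thesis using lt_swap(1)[OF jn(2,1), of "mexp m (Suc j)"] M.m_pos by (simp add: mexp_def e_vec_def)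
    qed
    have "mexp m (Suc j) \<noteq> mexp m j" "\<not> lt n (mexp m (Suc j)) (mexp m j)"
      using lt lt_irrefl lt_trans by metis+
    then have z: "coef ?w (mexp m (Suc j)) = 0"
      using M.eig_top(1)[OF ex(1) S M.ev(1)[OF ex(1) S], of "mexp m (Suc j)"] by (auto simp: in_keys_iff)
    have "coef (pop ?s ?w) (mexp m (Suc j)) = perm_elt ?s * M.top (mexp m j) S"
      using coef_pop[OF s, of ?w "mexp m j"] M.ev(2)[OF ex(1) S] exp_act_mexp[OF s, of m j] by simp
    also have "\<dots> = M.top (mexp m (Suc j)) S"
      unfolding M.top_def sort_perm_mexp_swap[OF j]
      using permutes_bij[OF sort_perm_permutes] by (simp add: o_inv_distrib perm_elt_mult flip: mult.assoc)
    finally show "coef (M.sig j ?k ?w) (mexp m (Suc j)) = M.top (mexp m (Suc j)) S"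
      using z by (simp add: M.sig_def lookup_minus coef_sop)
  qed
qed

lemma sig_wt_om:
  assumes "\<kappa> j = M.om L j" "\<kappa> (Suc j) = M.om L (Suc j)"
  shows "M.sig j \<kappa> w = M.sig j (M.om L) w"
  using assms by (simp add: M.sig_def)

text \<open>If \<open>j\<close> is the largest entry, the exponent itself moves and
  \<open>sig_mexp\<close> applies. Otherwise the exponent stays, the sorting permutation fixes
  \<open>j\<close> and \<open>j + 1\<close>, and the normalization of \<open>v'\<close> carries over
  to the top coefficient.\<close>

lemma W_swap:
  assumes L: "L \<in> legsets n l" and j: "j \<in> L" "Suc j \<notin> L" "Suc j \<le> n"
  shows "pop (transpose j (Suc j)) (W L) = W (leg_swap j L) + sop (M.kap L j) (W L)"
proof -
  let ?s = "transpose j (Suc j)" and ?p = "Max L" and ?S = "L - {Max L}" and ?L = "leg_swap j L"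
  note M = legsets_Max[OF L l]
  have fL: "finite L" by (rule legsets_finite[OF L])
  have j1: "1 \<le> j" using j(1) L by (auto simp: legsets_def)
  have jn: "j \<in> {1..n}" "Suc j \<in> {1..n}" using j j1 by auto
  have pn: "?p \<in> {1..n}" using M(2) by auto
  have L': "?L \<in> legsets n l" by (rule leg_swap_in[OF L j])
  have le: "x \<le> ?p" if "x \<in> L" for x using that fL by simp
  have "M.sig j (M.om L) (W L) = W ?L"
  proof (cases "j = ?p")
    case True
    have "Max ?L = Suc j" using fL le True by (intro Max_eqI) (auto simp: leg_swap_def le_SucI)
    moreover have "?L - {Suc j} = L - {j}" using j by (auto simp: leg_swap_def)
    ultimately have "W ?L = M.ev (mexp m (Suc j)) ?S" using True by (simp add: W_def)
    also have "\<dots> = M.sig j (M.wt (mexp m j) ?S) (M.ev (mexp m j) ?S)"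
      using sig_mexp[OF M(3) j1 j(3)] by simp
    also have "\<dots> = M.sig j (M.om L) (W L)"
      unfolding W_def True[symmetric] using wt_Max[OF L jn(1)] wt_Max[OF L jn(2)] True by (intro sig_wt_om) simp_all
    finally show ?thesis by simp
  next
    case False
    have jp: "j < ?p" using le[OF j(1)] False by simp
    have "Suc j \<noteq> ?p" using j(2) M(1) by auto
    then have sp: "Suc j < ?p" using jp by simp
    have "Max ?L = ?p" using fL le M(1) False sp by (intro Max_eqI) (auto simp: leg_swap_def)
    have S': "?L - {?p} = leg_swap j ?S" using sp by (auto simp: leg_swap_def)
    show ?thesis
    proof (rule W_eqI[OF L'])
      have "M.eig (M.om L \<circ> ?s) (M.sig j (M.om L) (W L))"
        by (rule M.eig_sig[OF j1 j(3) W_eig[OF L] M.om_Suc_neq[OF L j1]])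
      moreover have "(M.om L \<circ> ?s) i = M.om ?L i" if "i \<in> {1..n}" for i
        using that hct_leg_swap[OF fL j(1,2) j1, of i] by (simp add: M.om_def)
      ultimately show "M.eig (M.om ?L) (M.sig j (M.om L) (W L))" using M.eig_cong[of "M.om L \<circ> ?s" "M.om ?L"] by blast
      let ?a = "mexp m ?p" and ?g = "sort_perm n (mexp m ?p)"
      have "exp_act ?s ?a = ?a" using exp_act_mexp[of ?s m ?p] jp sp by (simp add: transpose_def)
      then have "coef (pop ?s (W L)) ?a = transp j (Suc j) * coef (W L) ?a"
        using coef_pop[of ?s "W L" ?a] by (simp add: transp_def)
      moreover have top: "coef (W L) ?a = M.top ?a ?S" unfolding W_def by (rule M.ev(2)[OF Max_in[OF L] M(3)])
      moreover have "transp j (Suc j) * M.top ?a ?S = perm_elt (inv_into UNIV ?g) * (transp j (Suc j) * v' ?S)"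
      proof -
        have g: "?g permutes {1..n}" by (rule sort_perm_permutes)
        have "?g j = j" "?g (Suc j) = Suc j"
          using sort_perm_mexp[OF M.m_pos pn jn(1)] sort_perm_mexp[OF M.m_pos pn jn(2)] jp sp by simp_all
        then have "inv_into UNIV ?g j = j" "inv_into UNIV ?g (Suc j) = Suc j"
          using permutes_inv_eq[OF g] by auto
        then show ?thesis
          using perm_elt_transp[OF permutes_bij[OF permutes_inv[OF g]], of j "Suc j"]
          by (simp add: M.top_def flip: mult.assoc)
      qed
      moreover have "M.kap L j = 1 / of_int (hct ?S (Suc j) - hct ?S j)"
        using hct_remove_Max(1)[OF L l, of j] hct_remove_Max(1)[OF L l, of "Suc j"] j1 jp sp by (simp add: M.kap_def)
      then have "v' (leg_swap j ?S) = transp j (Suc j) * v' ?S - scal (M.kap L j) * v' ?S"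
        using M.norm[OF M(3), of j] j jp by simp
      ultimately show "coef (M.sig j (M.om L) (W L)) (mexp m (Max ?L)) = M.top (mexp m (Max ?L)) (?L - {Max ?L})"
        unfolding \<open>Max ?L = ?p\<close> S' M.sig_om lookup_minus coef_sop
        by (simp add: M.top_def right_diff_distrib perm_elt_scal)
    qed
  qed
  then show ?thesis by (simp add: M.sig_om algebra_simps)
qed

lemma W_reflect:
  assumes L: "L \<in> legsets n l" and j: "1 \<le> j" "Suc j \<le> n"
    and C: "j \<in> L \<and> Suc j \<in> L \<or> j \<notin> L \<and> Suc j \<notin> L \<or> j = 1"
  shows "pop (transpose j (Suc j)) (W L) = sop (M.kap L j) (W L)"
proof -
  let ?s = "transpose j (Suc j)" and ?p = "Max L" and ?S = "L - {Max L}"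
  note M = legsets_Max[OF L l]
  have fL: "finite L" by (rule legsets_finite[OF L])
  have jn: "j \<in> {1..n}" "Suc j \<in> {1..n}" using j by auto
  have pn: "?p \<in> {1..n}" using M(2) by auto
  have L1: "1 \<notin> L" using L by (auto simp: legsets_def)
  have le: "x \<le> ?p" if "x \<in> L" for x using that fL by simp
  have jp: "j \<noteq> ?p"
  proof
    assume "j = ?p"
    then have "j \<in> L" "j \<noteq> 1" using M(1,2) by auto
    then have "Suc j \<in> L" using C by blast
    then show False using le[of "Suc j"] \<open>j = ?p\<close> by simp
  qed
  show ?thesis
  proof (cases "Suc j = ?p")
    case True
    let ?e = "M.ev (mexp m j) ?S" and ?k = "M.wt (mexp m j) ?S"
    have k: "?k j = M.om L (Suc j)" "?k (Suc j) = M.om L j"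
      using wt_Max[OF L jn(1)] wt_Max[OF L jn(2)] sort_perm_mexp_swap[OF j] True
        exp_act_mexp[of ?s m j] by (simp_all add: exp_act_transpose fun_eq_iff) (simp_all add: mexp_def e_vec_def)
    have h: "hct L (Suc j) = hct L j - 1"
    proof (cases "j \<in> L")
      case jL: True
      have "Suc j \<in> L" unfolding True by (rule M(1))
      with jL show ?thesis by (rule hct_Suc_leg[OF fL])
    next
      \<comment> \<open>With \<open>j = 1\<close> and largest entry \<open>2\<close> the leg is just
        \<open>{2}\<close>; then \<open>l = 1\<close>, and the two contents are \<open>0\<close> and
        \<open>-1\<close>.\<close>
      case False
      then have "j = 1" using C M(1) True by auto
      moreover have "L \<subseteq> {2..?p}" using le L by (auto simp: legsets_def)
      ultimately have "L \<subseteq> {2}" using True by auto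
      then have "l \<le> 1" using L card_mono[of "{2::nat}" L] by (simp add: legsets_def)
      then show ?thesis using M(5) l True hct_1[OF L] \<open>j = 1\<close> by simp
    qed
    \<comment> \<open>So the scalar in \<open>\<sigma>_j\<close> is \<open>1\<close>, and any vector
      of the form \<open>(s_j - 1) e\<close> is negated by \<open>s_j\<close>.\<close>
    have "?k j - ?k (Suc j) = c" unfolding k M.om_def h by (simp add: algebra_simps)
    then have "W L = pop ?s ?e - ?e"
      using sig_mexp[OF M(3) j] M.c_nonzero True by (simp add: W_def M.sig_def)
    then have "pop ?s (W L) = - W L" by (simp add: op_simps pop_pop)
    moreover have "M.kap L j = - 1" using h by (simp add: M.kap_def)
    ultimately show ?thesis by (simp add: sop_uminus)
  next
    case False
    have s: "?s permutes {1..n}" using jn by (intro transpose_permutes)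
    have sp: "?s ?p = ?p" using jp False by (simp add: transpose_def)
    have "M.sig j (M.om L) (W L) = 0"
    proof (rule ccontr)
      assume "M.sig j (M.om L) (W L) \<noteq> 0"
      with M.eig_sig[OF j W_eig[OF L] M.om_Suc_neq[OF L j(1)]] obtain b S where
        b: "b \<in> exponents n" "S \<in> legsets n (l - 1)" "\<And>i. i \<in> {1..n} \<Longrightarrow> (M.om L \<circ> ?s) i = M.wt b S i"
        using M.eig_weight by metis
      have w: "- of_int (hct L (?s i)) * c = of_nat (b i) - of_int (hct S (sort_perm n b i)) * c" if "i \<in> {1..n}" for i
        using b(3)[OF that] by (simp add: M.om_def)
      have e1: "b = mexp m ?p" by (rule hook_weight_shift(1)[OF M.n_pos M.cop M.c_def l L b(2,1) s sp w])
      have e2: "hct S (sort_perm n b i) = hct L (?s i)" if "i \<in> {1..n}" "i \<noteq> ?p" for i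
        by (rule hook_weight_shift(2)[OF M.n_pos M.cop M.c_def l L b(2,1) s sp w that])
      \<comment> \<open>Beyond the largest entry sorting shifts the places down by one; this is
        where \<open>hct_not_swapped\<close> is used with \<open>k = j - 1\<close>.\<close>
      have "sort_perm n b j = (if j < ?p then j else j - 1)" "sort_perm n b (Suc j) = (if j < ?p then Suc j else j)"
        using sort_perm_mexp[OF M.m_pos pn jn(1)] sort_perm_mexp[OF M.m_pos pn jn(2)] jp False e1 by auto
      then have "hct S (if j < ?p then j else j - 1) = hct L (Suc j)" "hct S (if j < ?p then Suc j else j) = hct L j"
        using e2[OF jn(1) jp] e2[OF jn(2) False] by simp_all
      moreover have "Suc (j - 1) = j" "1 \<le> j - 1" "j \<noteq> 1" if "\<not> j < ?p" using that M(2) jp by auto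
      ultimately show False
        using hct_not_swapped[OF fL b(2) j(1) _ _ C _ _ L1, of j] j(1)
          hct_not_swapped[OF fL b(2) j(1) _ _ C _ _ L1, of "j - 1"]
        by (cases "j < ?p") simp_all
    qed
    then show ?thesis by (simp add: M.sig_om)
  qed
qed

section \<open>The linear map \<open>theta\<close> and its equivariance\<close>

definition coord :: "smash \<Rightarrow> nat set \<Rightarrow> complex" where
  "coord x = (SOME \<alpha>. x = (\<Sum>L\<in>legsets n l. scal (\<alpha> L) * v L))"

definition theta :: "smash \<Rightarrow> pol" where
  "theta x = (\<Sum>L\<in>legsets n l. sop (coord x L) (W L))"

text \<open>Independence of the \<open>v L\<close> makes the choice in \<open>coord\<close>
  immaterial.\<close>

lemma theta_sum: "theta (\<Sum>L\<in>legsets n l. scal (\<alpha> L) * v L) = (\<Sum>L\<in>legsets n l. sop (\<alpha> L) (W L))"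
proof -
  let ?x = "\<Sum>L\<in>legsets n l. scal (\<alpha> L) * v L"
  have "?x = (\<Sum>L\<in>legsets n l. scal (coord ?x L) * v L)"
    unfolding coord_def by (rule someI[where P = "\<lambda>\<beta>. ?x = (\<Sum>L\<in>legsets n l. scal (\<beta> L) * v L)"]) (rule refl)
  then have "(\<Sum>L\<in>legsets n l. scal (coord ?x L - \<alpha> L) * v L) = 0"
    by (simp add: scal_diff left_diff_distrib sum_subtractf)
  from N.indep[OF this] show ?thesis unfolding theta_def by (intro sum.cong) auto
qed

lemma W_pols: "L \<in> legsets n l \<Longrightarrow> W L \<in> pols n V'"
  using W_eig by (simp add: M.eig_def)

lemma theta_add: "x \<in> V \<Longrightarrow> y \<in> V \<Longrightarrow> theta (x + y) = theta x + theta y"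
proof -
  assume "x \<in> V" "y \<in> V"
  then obtain \<alpha> \<beta> where e: "x = (\<Sum>L\<in>legsets n l. scal (\<alpha> L) * v L)" "y = (\<Sum>L\<in>legsets n l. scal (\<beta> L) * v L)"
    using N.span by metis
  have "x + y = (\<Sum>L\<in>legsets n l. scal (\<alpha> L + \<beta> L) * v L)"
    by (simp add: e scal_add distrib_right sum.distrib)
  then show ?thesis by (simp only: theta_sum e sop_plus sum.distrib)
qed

lemma theta_scal: "x \<in> V \<Longrightarrow> theta (scal z * x) = sop z (theta x)"
proof -
  assume "x \<in> V"
  then obtain \<alpha> where e: "x = (\<Sum>L\<in>legsets n l. scal (\<alpha> L) * v L)" using N.span by metis
  have "scal z * x = (\<Sum>L\<in>legsets n l. scal (z * \<alpha> L) * v L)"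
    by (simp add: e sum_distrib_left scal_scal)
  then show ?thesis by (simp only: theta_sum e op_sum sop_sop)
qed

lemma theta_v: "L \<in> legsets n l \<Longrightarrow> theta (v L) = W L"
proof -
  assume L: "L \<in> legsets n l"
  let ?d = "\<lambda>K. if K = L then 1 else 0"
  have d: "(\<Sum>K\<in>legsets n l. if K = L then f K else 0) = f L" for f :: "nat set \<Rightarrow> 'a::comm_monoid_add"
    using L finite_legsets by (simp add: sum.delta)
  have "(\<Sum>K\<in>legsets n l. scal (?d K) * v K) = (\<Sum>K\<in>legsets n l. if K = L then v K else 0)"
    by (rule sum.cong) auto
  then have "theta (v L) = (\<Sum>K\<in>legsets n l. sop (?d K) (W K))" using theta_sum[of ?d] unfolding d by simp
  also have "\<dots> = (\<Sum>K\<in>legsets n l. if K = L then W K else 0)" by (rule sum.cong) auto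
  also have "\<dots> = W L" by (rule d)
  finally show ?thesis .
qed

lemma theta_lincomb:
  assumes "finite A" "\<And>L. L \<in> A \<Longrightarrow> f L \<in> V"
  shows "theta (sum f A) = (\<Sum>L\<in>A. theta (f L))"
  using assms
proof (induction A)
  case empty
  have "theta 0 = 0" using theta_scal[OF sn_spaceD(1)[OF N.V], of 0] by simp
  then show ?case by simp
next
  case (insert L A)
  then show ?case using theta_add sn_space_sum[OF N.V, of A f] by simp
qed

lemma theta_transp_v:
  assumes L: "L \<in> legsets n l" and j: "1 \<le> j" "Suc j \<le> n"
  shows "theta (transp j (Suc j) * v L) = pop (transpose j (Suc j)) (W L)"
proof -
  let ?s = "transpose j (Suc j)"
  have A: "theta (transp j (Suc j) * v L) = pop ?s (W L) \<and> transp j (Suc j) * v L = v (leg_swap j L) + scal (M.kap L j) * v L"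
    if "L \<in> legsets n l" "j \<in> L" "Suc j \<notin> L" for L
  proof -
    have t: "transp j (Suc j) * v L = v (leg_swap j L) + scal (M.kap L j) * v L"
      using N.norm[OF that j(2)] by (simp add: M.kap_def algebra_simps)
    have "theta (transp j (Suc j) * v L) = W (leg_swap j L) + sop (M.kap L j) (W L)"
      unfolding t using that leg_swap_in[OF that j(2)] sn_spaceD(3)[OF N.V]
      by (simp add: theta_add theta_scal N.v_in theta_v)
    then show ?thesis using W_swap[OF that j(2)] t by simp
  qed
  consider "j \<in> L" "Suc j \<notin> L" | "j \<notin> L" "Suc j \<in> L" "j \<noteq> 1"
    | "j \<in> L \<and> Suc j \<in> L \<or> j \<notin> L \<and> Suc j \<notin> L \<or> j = 1" by blast
  then show ?thesis
  proof cases
    case 1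
    then show ?thesis using A L by blast
  next
    \<comment> \<open>Now \<open>L\<close> results from a swap applied to \<open>?K\<close>. Since
      \<open>s_j\<close> squares to one, the formulas for \<open>v ?K\<close> and
      \<open>W ?K\<close> can be solved for the images of \<open>v L\<close> and \<open>W L\<close>
      under \<open>s_j\<close>, with the same coefficients on both sides.\<close>
    case 2
    let ?K = "insert j (L - {Suc j})"
    have fL: "finite L" by (rule legsets_finite[OF L])
    have "card ?K = Suc (card (L - {Suc j}))" using 2 fL by simp
    also have "\<dots> = card L" using 2 fL by (intro card_Suc_Diff1) auto
    finally have K: "?K \<in> legsets n l" using L 2 j by (auto simp: legsets_def)
    have KL: "leg_swap j ?K = L" using 2 by (auto simp: leg_swap_def)
    have jK: "j \<in> ?K" "Suc j \<notin> ?K" by auto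
    let ?k = "M.kap ?K j"
    have t: "transp j (Suc j) * v ?K = v L + scal ?k * v ?K" using A[OF K jK] KL by simp
    have p: "pop ?s (W ?K) = W L + sop ?k (W ?K)" using W_swap[OF K jK j(2)] KL by simp
    have "transp j (Suc j) * (transp j (Suc j) * v ?K) = v ?K"
      by (simp add: transp_def perm_elt_mult flip: mult.assoc)
    then have "transp j (Suc j) * v L = v ?K - scal ?k * (transp j (Suc j) * v ?K)"
      using t by (metis (no_types, lifting) add_diff_cancel_right' distrib_left transp_scal)
    also have "\<dots> = scal (1 - ?k * ?k) * v ?K + scal (- ?k) * v L"
      unfolding t by (simp add: scal_diff scal_minus scal_scal algebra_simps)
    finally have 1: "theta (transp j (Suc j) * v L) = sop (1 - ?k * ?k) (W ?K) + sop (- ?k) (W L)"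
      using K L sn_spaceD(3)[OF N.V] by (simp add: theta_add theta_scal N.v_in theta_v)
    have "W ?K = pop ?s (pop ?s (W ?K))" by (simp add: pop_pop)
    also have "\<dots> = pop ?s (W L) + sop ?k (pop ?s (W ?K))"
      by (subst p) (simp only: pop_simps pop_sop)
    finally have 2: "pop ?s (W L) = W ?K - sop ?k (W L + sop ?k (W ?K))" unfolding p by (simp only: eq_diff_eq)
    have 3: "sop (1 - k * k) f + sop (- k) g = f - sop k (g + sop k f)" for k f g
      by (simp add: sop_simps sop_minus sop_uminus sop_sop)
    show ?thesis by (rule trans[OF 1 trans[OF 3 2[symmetric]]])
  next
    case 3
    show ?thesis
      unfolding N.transp_reflect[OF L j 3] W_reflect[OF L j 3] theta_scal[OF N.v_in[OF L]] theta_v[OF L] ..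
  qed
qed

definition equivariant :: "(nat \<Rightarrow> nat) \<Rightarrow> bool" where
  "equivariant g \<longleftrightarrow> g permutes {1..n} \<and> (\<forall>x\<in>V. theta (perm_elt g * x) = pop g (theta x))"

lemma equivariant_comp: "equivariant g \<Longrightarrow> equivariant h \<Longrightarrow> equivariant (g \<circ> h)"
  using sn_spaceD(4)[OF N.V]
  by (auto simp: equivariant_def permutes_compose permutes_bij mult.assoc simp flip: perm_elt_mult pop_pop)

lemma equivariant_adjacent:
  assumes j: "1 \<le> j" "Suc j \<le> n"
  shows "equivariant (transpose j (Suc j))"
proof -
  have s: "transpose j (Suc j) permutes {1..n}" using j by (intro transpose_permutes) auto
  have "theta (transp j (Suc j) * x) = pop (transpose j (Suc j)) (theta x)" if x: "x \<in> V" for x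
  proof -
    obtain \<alpha> where e: "x = (\<Sum>L\<in>legsets n l. scal (\<alpha> L) * v L)" using N.span x by metis
    have t: "transp j (Suc j) * v L \<in> V" if "L \<in> legsets n l" for L
      using that s unfolding transp_def by (intro sn_spaceD(4)[OF N.V] N.v_in)
    have "theta (transp j (Suc j) * x) = (\<Sum>L\<in>legsets n l. theta (scal (\<alpha> L) * (transp j (Suc j) * v L)))"
      unfolding e sum_distrib_left transp_scal
      by (rule theta_lincomb[OF finite_legsets]) (intro sn_spaceD(3)[OF N.V] t)
    also have "\<dots> = (\<Sum>L\<in>legsets n l. sop (\<alpha> L) (pop (transpose j (Suc j)) (W L)))"
      by (rule sum.cong) (simp_all add: theta_scal t theta_transp_v[OF _ j])
    also have "\<dots> = pop (transpose j (Suc j)) (theta x)"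
      unfolding e theta_sum by (simp add: op_sum pop_sop)
    finally show ?thesis .
  qed
  then show ?thesis using s by (simp add: equivariant_def transp_def)
qed

text \<open>\<open>j\<close> is raised by conjugation with the adjacent transposition of
  \<open>j\<close> and \<open>j + 1\<close>.\<close>

lemma equivariant_transpose:
  assumes "i \<in> {1..n}" "j \<in> {1..n}" "i < j"
  shows "equivariant (transpose i j)"
  using assms(2,3)
proof (induction j)
  case (Suc j)
  show ?case
  proof (cases "i = j")
    case True
    then show ?thesis using Suc.prems assms(1) equivariant_adjacent[of j] by auto
  next
    case False
    then have ij: "i < j" using Suc.prems by simp
    let ?s = "transpose j (Suc j)"
    have "equivariant (transpose i j)" using Suc ij assms(1) by auto
    moreover have "equivariant ?s" using Suc.prems ij assms(1) by (intro equivariant_adjacent) auto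
    ultimately have "equivariant (?s \<circ> (transpose i j \<circ> ?s))" by (intro equivariant_comp)
    moreover have "?s \<circ> (transpose i j \<circ> ?s) = transpose i (Suc j)"
      using ij by (auto simp: fun_eq_iff transpose_def)
    ultimately show ?thesis by simp
  qed
qed simp

lemma equivariant_permutes:
  assumes "g permutes {1..n}"
  shows "equivariant g"
proof -
  have id: "equivariant id" by (simp add: equivariant_def permutes_id)
  have t: "equivariant (transpose i j)" if "i \<in> {1..n}" "j \<in> {1..n}" for i j
    using equivariant_transpose[of i j] equivariant_transpose[of j i] that id
    by (cases i j rule: linorder_cases) (auto simp: transpose_commute)
  show ?thesis
    using assms finite_atLeastAtMost
  proof (induction rule: permutes_induct)
    case id
    show ?case by (fact \<open>equivariant id\<close>)
  next
    case (swap a b p)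
    then show ?case using t equivariant_comp by blast
  qed
qed

lemma xop_inj: "xop k f = 0 \<Longrightarrow> f = 0"
proof (rule poly_mapping_eqI)
  fix a assume z: "xop k f = 0"
  have up: "b(k := Suc (b k)) = a(k := Suc (a k)) \<longleftrightarrow> b = a" for b :: "nat \<Rightarrow> nat"
    by (metis fun_upd_idem_iff fun_upd_same fun_upd_upd nat.inject)
  have "coef (xop k f) (a(k := Suc (a k))) = coef f a"
    by (rule additive_poly_mapping_eqI[where h = "\<lambda>f. coef (xop k f) (a(k := Suc (a k)))" and k = "\<lambda>f. coef f a"])
      (simp_all add: additive_def op_simps lookup_add lookup_single when_def up)
  then show "coef f a = coef 0 a" using z by simp
qed

text \<open>The entry \<open>1\<close> has content \<open>0\<close> and \<open>J_1\<close> is an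
  empty sum, so the eigenvalue equation reads \<open>x_1 y_1 w_L = 0\<close>; multiplication by
  \<open>x_1\<close> is injective.\<close>

lemma yop_W:
  assumes "L \<in> legsets n l"
  shows "yop n c 1 (W L) = 0"
proof -
  have "uop n c 1 (W L) = sop (M.om L 1) (W L)" using W_eig[OF assms] M.n_pos by (simp add: M.eig_def)
  then have "xop 1 (yop n c 1 (W L)) = 0" using hct_1[OF assms] by (simp add: uop_def zop_def jop_def M.om_def op_simps)
  then show ?thesis by (rule xop_inj)
qed

lemma yop_theta:
  assumes "x \<in> V" "i \<in> {1..n}"
  shows "yop n c i (theta x) = 0"
proof -
  have 1: "yop n c 1 (theta x) = 0" for x
    unfolding theta_def op_sum yop_sop by (intro sum.neutral ballI) (simp only: yop_W op_simps)
  let ?s = "transpose 1 i"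
  have s: "?s permutes {1..n}" using assms M.n_pos by (intro transpose_permutes) auto
  have "pop ?s (theta x) = theta (perm_elt ?s * x)"
    using equivariant_permutes[OF s] assms by (simp add: equivariant_def)
  then have "pop ?s (yop n c i (theta x)) = 0"
    using pop_yop[OF s, of c i "theta x"] 1 by simp
  then have "pop ?s (pop ?s (yop n c i (theta x))) = 0" by (simp add: op_simps)
  then show ?thesis by (simp add: pop_pop)
qed

lemma theta_pols: "theta x \<in> pols n V'"
  unfolding theta_def by (intro pols_sum[OF M.V] pols_sop[OF M.V] W_pols)

lemma theta_perm: "x \<in> V \<Longrightarrow> g permutes {1..n} \<Longrightarrow> theta (perm_elt g * x) = pop g (theta x)"
  using equivariant_permutes by (simp add: equivariant_def)

end

section \<open>Standard tableaux of hook shape\<close>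

definition tab :: "nat \<Rightarrow> nat set \<Rightarrow> nat list list" where
  "tab n L = hook_tableau n (sorted_list_of_set L)"

text \<open>With \<open>1\<close> taken into the filter, the first row becomes the sorted complement
  of \<open>L\<close>.\<close>

lemma tab_eq:
  assumes "L \<in> legsets n l" "0 < n"
  shows "tab n L = filter (\<lambda>k. k \<notin> L) [1..<Suc n] # map (\<lambda>i. [i]) (sorted_list_of_set L)"
proof -
  have "[1..<Suc n] = 1 # [2..<Suc n]" using assms(2) by (simp add: upt_conv_Cons numeral_2_eq_2)
  moreover have "1 \<notin> L" using assms(1) by (auto simp: legsets_def)
  ultimately show ?thesis
    using legsets_finite[OF assms(1)] by (simp add: tab_def hook_tableau_def)
qed

lemma card_below_nth:
  fixes xs :: "nat list"
  assumes "sorted_wrt (<) xs" "s < length xs"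
  shows "card {x \<in> set xs. x < xs ! s} = s" "card {x \<in> set xs. x \<le> xs ! s} = Suc s"
proof -
  have iff: "xs ! r < xs ! s \<longleftrightarrow> r < s" if "r < length xs" for r
    using that assms sorted_wrt_nth_less[OF assms(1)] by (metis not_less_iff_gr_or_eq)
  have eq: "xs ! r = xs ! s \<longleftrightarrow> r = s" if "r < length xs" for r
    using that assms sorted_wrt_nth_less[OF assms(1)] by (metis not_less_iff_gr_or_eq)
  have set: "set xs = (!) xs ` {..<length xs}" by (auto simp: set_conv_nth)
  have 1: "{x \<in> set xs. x < xs ! s} = (!) xs ` {..<s}"
  proof -
    have "{x \<in> set xs. x < xs ! s} = (!) xs ` {r \<in> {..<length xs}. xs ! r < xs ! s}" unfolding set by blast
    also have "{r \<in> {..<length xs}. xs ! r < xs ! s} = {..<s}" using iff assms(2) by auto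
    finally show ?thesis .
  qed
  have 2: "{x \<in> set xs. x \<le> xs ! s} = (!) xs ` {..<Suc s}"
  proof -
    have "{x \<in> set xs. x \<le> xs ! s} = (!) xs ` {r \<in> {..<length xs}. xs ! r \<le> xs ! s}" unfolding set by blast
    also have "{r \<in> {..<length xs}. xs ! r \<le> xs ! s} = {..<Suc s}"
      using iff eq assms(2) unfolding le_less by auto
    finally show ?thesis .
  qed
  have "distinct xs" using assms(1) strict_sorted_iff by blast
  then have "inj_on ((!) xs) {..<s}" "inj_on ((!) xs) {..<Suc s}"
    using assms(2) by (auto intro!: inj_on_nth)
  then show "card {x \<in> set xs. x < xs ! s} = s" "card {x \<in> set xs. x \<le> xs ! s} = Suc s"
    unfolding 1 2 by (simp_all only: card_image card_lessThan)
qed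

lemma sorted_row: "sorted_wrt (<) (filter P [a..<b::nat])"
  by (rule sorted_wrt_filter) (rule sorted_wrt_upt)

text \<open>In a sorted list the index of an entry counts the smaller ones. For the arm this gives
  the column; for the leg it gives the row, shifted by one for the corner box.\<close>

lemma box_content_tab:
  assumes L: "L \<in> legsets n l" and k: "k \<in> {1..n}"
  shows "box_content (tab n L) k = hct L k"
proof -
  let ?R = "filter (\<lambda>k. k \<notin> L) [1..<Suc n]" and ?is = "sorted_list_of_set L"
  have fL: "finite L" by (rule legsets_finite[OF L])
  have n: "0 < n" using k by simp
  note T = tab_eq[OF L n]
  have LL: "L \<subseteq> {2..n}" using L by (simp add: legsets_def)
  have R: "set ?R = {1..n} - L" by auto
  have srt: "sorted_wrt (<) ?is" "set ?is = L" using fL by (simp_all add: strict_sorted_iff)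
  let ?P = "\<lambda>r s. r < length (tab n L) \<and> s < length (tab n L ! r) \<and> tab n L ! r ! s = k"
  have pos: "int s - int r = hct L k" if "?P r s" for r s
  proof (cases r)
    case 0
    then have s: "s < length ?R" "?R ! s = k" using that T by simp_all
    then have kR: "k \<in> set ?R" using nth_mem by metis
    have "{x \<in> set ?R. x < ?R ! s} = {1..<k} - L" using s(2) k unfolding R by auto
    then have "s = card ({1..<k} - L)" using card_below_nth(1)[OF sorted_row s(1)] by simp
    then show ?thesis using kR 0 by (simp add: hct_def)
  next
    case (Suc r')
    then have r: "r' < length ?is" "s = 0" "?is ! r' = k" using that T by auto
    then have kL: "k \<in> L" using nth_mem[of r' ?is] srt(2) by simp
    have "{x \<in> set ?is. x \<le> ?is ! r'} = {j \<in> L. j \<le> k}" using r(3) srt(2) by simp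
    then have "card {j \<in> L. j \<le> k} = Suc r'" using card_below_nth(2)[OF srt(1) r(1)] by simp
    then show ?thesis using kL r(2) Suc by (simp add: hct_def)
  qed
  have "\<exists>r s. ?P r s"
  proof (cases "k \<in> L")
    case True
    then obtain r where "r < length ?is" "?is ! r = k" using srt(2) by (metis in_set_conv_nth)
    then show ?thesis unfolding T by (intro exI[of _ "Suc r"] exI[of _ 0]) simp
  next
    case False
    then have "k \<in> set ?R" unfolding R using k by simp
    then obtain s where "s < length ?R" "?R ! s = k" by (metis in_set_conv_nth)
    then show ?thesis unfolding T by (intro exI[of _ 0] exI[of _ s]) simp
  qed
  then obtain r s where rs: "?P r s" by (elim exE)
  show ?thesis unfolding box_content_def
  proof (rule the_equality)
    show "\<exists>r s. r < length (tab n L) \<and> s < length (tab n L ! r) \<and> tab n L ! r ! s = k \<and> hct L k = int s - int r"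
      using rs pos[OF rs] by (intro exI[of _ r] exI[of _ s]) simp
    fix d assume "\<exists>r s. r < length (tab n L) \<and> s < length (tab n L ! r) \<and> tab n L ! r ! s = k \<and> d = int s - int r"
    then obtain r s where "?P r s" "d = int s - int r" by (elim exE conjE) simp
    then show "d = hct L k" using pos[of r s] by simp
  qed
qed

lemma column_tab:
  assumes L: "L \<in> legsets n l" and n: "0 < n"
  shows "column (tab n L) 0 = insert 1 L"
proof -
  have fL: "finite L" by (rule legsets_finite[OF L])
  have h: "tab n L = (1 # filter (\<lambda>k. k \<notin> L) [2..<Suc n]) # map (\<lambda>i. [i]) (sorted_list_of_set L)"
    using fL by (simp add: tab_def hook_tableau_def)
  show ?thesis
  proof (intro equalityI subsetI)
    fix x assume "x \<in> column (tab n L) 0"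
    then obtain r where r: "r < length (tab n L)" "x = tab n L ! r ! 0" by (auto simp: column_def)
    then show "x \<in> insert 1 L"
      using nth_mem[of "r - 1" "sorted_list_of_set L"] fL unfolding h by (cases r) auto
  next
    fix x assume "x \<in> insert 1 L"
    then consider "x = 1" | "x \<in> set (sorted_list_of_set L)" using fL by auto
    then show "x \<in> column (tab n L) 0"
    proof cases
      case 1
      then show ?thesis unfolding column_def h by (intro CollectI exI[of _ 0]) simp
    next
      case 2
      then obtain r where "r < length (sorted_list_of_set L)" "sorted_list_of_set L ! r = x" by (metis in_set_conv_nth)
      then show ?thesis unfolding column_def h by (intro CollectI exI[of _ "Suc r"]) simp
    qed
  qed
qed

text \<open>An adjacent transposition preserves the order on a set that does not contain both
  \<open>j\<close> and \<open>j + 1\<close>.\<close>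

lemma map_transpose_sorted:
  fixes xs ys :: "nat list"
  assumes "sorted_wrt (<) xs" "sorted_wrt (<) ys" "set ys = transpose j (Suc j) ` set xs"
    "j \<notin> set xs \<or> Suc j \<notin> set xs"
  shows "map (transpose j (Suc j)) xs = ys"
proof (rule strict_sorted_equal[symmetric])
  have "transpose j (Suc j) x < transpose j (Suc j) y" if "x \<in> set xs" "y \<in> set xs" "x < y" for x y
    using that assms(4) by (auto simp: transpose_def)
  then show "sorted_wrt (<) (map (transpose j (Suc j)) xs)"
    using sorted_wrt_mono_rel[OF _ assms(1)] by (simp add: sorted_wrt_map)
qed (use assms in simp_all)

lemma tab_leg_swap:
  assumes L: "L \<in> legsets n l" and j: "j \<in> L" "Suc j \<notin> L" "Suc j \<le> n"
  shows "map (map (transpose j (Suc j))) (tab n L) = tab n (leg_swap j L)"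
proof -
  let ?s = "transpose j (Suc j)"
  have j1: "2 \<le> j" using L j by (auto simp: legsets_def)
  have n: "0 < n" using j by simp
  have L': "leg_swap j L \<in> legsets n l" by (rule leg_swap_in[OF L j])
  have fL: "finite L" "finite (leg_swap j L)" using legsets_finite L L' by blast+
  have im: "leg_swap j L = ?s ` L"
  proof -
    have "insert j (L - {j}) = L" using j by auto
    then have "?s ` L = insert (?s j) (?s ` (L - {j}))" by (metis image_insert)
    also have "?s j = Suc j" by simp
    also have "?s ` (L - {j}) = id ` (L - {j})" using j by (intro image_cong) (auto simp: transpose_def)
    finally show ?thesis by (simp add: leg_swap_def)
  qed
  have 1: "map ?s (sorted_list_of_set L) = sorted_list_of_set (leg_swap j L)"
    using fL im j by (intro map_transpose_sorted) (simp_all add: strict_sorted_iff)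
  have 2: "map ?s (filter (\<lambda>k. k \<notin> L) [1..<Suc n]) = filter (\<lambda>k. k \<notin> leg_swap j L) [1..<Suc n]"
  proof (rule map_transpose_sorted[OF sorted_row sorted_row])
    have "set (filter (\<lambda>k. k \<notin> A) [1..<Suc n]) = {1..n} - A" for A by auto
    moreover have "?s ` ({1..n} - L) = {1..n} - ?s ` L"
      using j j1 transpose_image[of j "{1..n}" "Suc j"] by (simp add: image_set_diff)
    ultimately show "set (filter (\<lambda>k. k \<notin> leg_swap j L) [1..<Suc n]) = ?s ` set (filter (\<lambda>k. k \<notin> L) [1..<Suc n])"
      by (simp only: im)
  qed (use j in simp)
  have "map (map ?s) (map (\<lambda>i. [i]) xs) = map (\<lambda>i. [i]) (map ?s xs)" for xs by simp
  then show ?thesis unfolding tab_eq[OF L n] tab_eq[OF L' n] list.map(2) 1[symmetric] 2[symmetric] by (rule arg_cong)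
qed

lemma sum_list_hook: "l \<le> n \<Longrightarrow> sum_list (hook n l) = n"
  by (simp add: hook_def sum_list_replicate)

lemma tab_std:
  assumes L: "L \<in> legsets n l" and l: "l < n"
  shows "tab n L \<in> std_tableaux (hook n l)"
proof -
  let ?R = "filter (\<lambda>k. k \<notin> L) [1..<Suc n]" and ?is = "sorted_list_of_set L"
  have n: "0 < n" using l by simp
  have fL: "finite L" by (rule legsets_finite[OF L])
  have LL: "L \<subseteq> {1..n}" "card L = l" "\<And>x. x \<in> L \<Longrightarrow> 2 \<le> x" using L by (auto simp: legsets_def)
  note T = tab_eq[OF L n]
  have h: "tab n L = (1 # filter (\<lambda>k. k \<notin> L) [2..<Suc n]) # map (\<lambda>i. [i]) ?is"
    using fL by (simp add: tab_def hook_tableau_def)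
  have R: "set ?R = {1..n} - L" by auto
  have "distinct ?R" by simp
  then have lenR: "length ?R = n - l"
    using distinct_card[of ?R] R card_Diff_subset[OF fL LL(1)] LL(2) by simp
  have conc: "concat (tab n L) = ?R @ ?is" unfolding T by simp
  have "map length (tab n L) = hook n l"
    unfolding T using lenR LL(2) by (simp add: hook_def comp_def map_replicate_const del: upt_Suc)
  moreover have "distinct (concat (tab n L))" unfolding conc using R fL by auto
  moreover have "set (concat (tab n L)) = {1..sum_list (hook n l)}"
    unfolding conc using R fL LL(1) l by (auto simp: sum_list_hook)
  moreover have "sorted ?R" using sorted_row strict_sorted_iff by blast
  then have "\<forall>R\<in>set (tab n L). sorted R" unfolding T by (auto simp del: upt_Suc)
  moreover have "tab n L ! r ! s < tab n L ! Suc r ! s" if rs: "Suc r < length (tab n L)" "s < length (tab n L ! Suc r)" for r s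
  proof -
    have r: "r < length ?is" "s = 0" using rs unfolding h by auto
    have srt: "sorted_wrt (<) ?is" "set ?is = L" using fL by (simp_all add: strict_sorted_iff)
    show ?thesis
    proof (cases r)
      case 0
      then show ?thesis using r LL(3)[of "?is ! 0"] nth_mem[of 0 ?is] srt(2) unfolding h by auto
    next
      case (Suc r')
      then show ?thesis using r sorted_wrt_nth_less[OF srt(1), of r' "Suc r'"] unfolding h by simp
    qed
  qed
  ultimately show ?thesis unfolding std_tableaux_def by blast
qed

text \<open>The leg determines a standard filling of a hook: increasing rows and columns force
  \<open>1\<close> into the corner, and the arm is the sorted complement.\<close>

lemma std_tab:
  assumes T: "T \<in> std_tableaux (hook n l)" and l: "l < n"
  obtains L where "L \<in> legsets n l" "T = tab n L"
proof -
  note D = T[unfolded std_tableaux_def, simplified mem_Collect_eq]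
  have len: "map length T = (n - l) # replicate l 1" using D by (simp add: hook_def)
  then obtain R Rs where TR: "T = R # Rs" "length R = n - l" "map length Rs = replicate l 1" by (cases T) auto
  have lRs: "length Rs = l" using arg_cong[OF TR(3), of length] by simp
  have Rs: "Rs = map (\<lambda>i. [i]) (map hd Rs)"
  proof (rule nth_equalityI)
    fix i assume i: "i < length Rs"
    have "map length Rs ! i = 1" unfolding TR(3) using i lRs by simp
    then have "length (Rs ! i) = 1" using i by simp
    then show "Rs ! i = map (\<lambda>i. [i]) (map hd Rs) ! i" using i by (cases "Rs ! i") auto
  qed simp
  define ys where "ys = map hd Rs"
  have lis: "length ys = l" using lRs by (simp add: ys_def)
  have T': "T = R # map (\<lambda>i. [i]) ys" unfolding ys_def Rs[symmetric] by (rule TR(1))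
  have conc: "concat T = R @ ys" unfolding T' by simp
  have dis: "distinct (R @ ys)" "set R \<union> set ys = {1..n}" "sorted R"
    using D l unfolding conc sum_list_hook[OF less_imp_le[OF l]] by (auto simp: T')
  have col: "T ! r ! s < T ! Suc r ! s" if "Suc r < length T" "s < length (T ! Suc r)" for r s
    using D that by blast
  have step: "ys ! r < ys ! Suc r" if "Suc r < length ys" for r
    using col[of "Suc r" 0] that unfolding T' by simp
  have sis: "sorted_wrt (<) ys"
    by (rule sorted_wrt_iff_nth_Suc_transp[THEN iffD2]) (use step in \<open>auto simp: transp_def\<close>)
  obtain x R' where R: "R = x # R'" using TR(2) l by (cases R) auto
  have x: "x < ys ! 0" if "0 < length ys" using col[of 0 0] that unfolding T' R by simp
  have xis: "x < y" if y: "y \<in> set ys" for y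
  proof -
    obtain r where r: "r < length ys" "y = ys ! r" using y by (metis in_set_conv_nth)
    have "x < ys ! 0" using x r(1) by linarith
    then show ?thesis using r sorted_wrt_nth_less[OF sis, of 0 r] by (cases r) auto
  qed
  have xR: "x \<le> y" if "y \<in> set R" for y using that dis(3) R by auto
  have "1 \<in> set R \<union> set ys" using dis(2) l by auto
  moreover have "1 \<le> x" using dis(2) R by auto
  ultimately have x1: "x = 1" using xR xis by fastforce
  let ?L = "set ys"
  have "?L \<subseteq> {2..n}"
  proof
    fix y assume y: "y \<in> ?L"
    then show "y \<in> {2..n}" using xis[OF y] x1 dis(2) by auto
  qed
  moreover have "card ?L = l" using dis(1) lis distinct_card[of ys] by simp
  ultimately have L: "?L \<in> legsets n l" by (simp add: legsets_def)
  have "sorted_list_of_set ?L = ys"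
    using sis strict_sorted_equal[of ys "sorted_list_of_set ?L"] by (simp add: strict_sorted_iff)
  moreover have "R = filter (\<lambda>k. k \<notin> ?L) [1..<Suc n]"
  proof (rule strict_sorted_equal[OF sorted_row])
    show "sorted_wrt (<) R" using dis by (simp add: strict_sorted_iff)
    have "set R = {1..n} - ?L" using dis(1) unfolding dis(2)[symmetric] by auto
    moreover have "set (filter (\<lambda>k. k \<notin> ?L) [1..<Suc n]) = {1..n} - ?L" by auto
    ultimately show "set R = set (filter (\<lambda>k. k \<notin> ?L) [1..<Suc n])" by simp
  qed
  ultimately have "T = tab n ?L" unfolding T' using tab_eq[OF L] l by simp
  then show thesis using L that by blast
qed

lemma tab_inj: "0 < n \<Longrightarrow> inj_on (tab n) (legsets n l)"
proof (rule inj_onI)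
  fix L L' assume n: "0 < n" and L: "L \<in> legsets n l" "L' \<in> legsets n l" and e: "tab n L = tab n L'"
  have "1 \<notin> L" "1 \<notin> L'" using L by (auto simp: legsets_def)
  then show "L = L'" using column_tab[OF L(1) n] column_tab[OF L(2) n] e by (metis Diff_insert_absorb)
qed

lemma tab_bij: "l < n \<Longrightarrow> bij_betw (tab n) (legsets n l) (std_tableaux (hook n l))"
  unfolding bij_betw_def using tab_inj[of n l] tab_std[of _ n l] std_tab[of _ n l] by blast

lemma legs_set:
  assumes "is \<in> legs n l"
  shows "set is \<in> legsets n l" "hook_tableau n is = tab n (set is)"
    "1 \<le> l \<Longrightarrow> last is = Max (set is)" "1 \<le> l \<Longrightarrow> hook_tableau n (butlast is) = tab n (set is - {Max (set is)})"
proof -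
  have s: "length is = l" "sorted_wrt (<) is" "set is \<subseteq> {2..n}" using assms by (auto simp: legs_def)
  have d: "distinct is" "sorted is" using s(2) strict_sorted_iff by blast+
  have u: "sorted_list_of_set (set xs) = xs" if "sorted_wrt (<) xs" for xs :: "nat list"
    using that strict_sorted_equal[of xs "sorted_list_of_set (set xs)"] by (simp add: strict_sorted_iff)
  show "set is \<in> legsets n l" using s d distinct_card[of "is"] by (simp add: legsets_def)
  show "hook_tableau n is = tab n (set is)" using u[OF s(2)] by (simp add: tab_def)
  assume "1 \<le> l"
  then have ne: "is \<noteq> []" using s by auto
  then have app: "is = butlast is @ [last is]" by simp
  then have b: "sorted_wrt (<) (butlast is)" "\<And>x. x \<in> set (butlast is) \<Longrightarrow> x < last is"
    using s(2) sorted_wrt_append[of "(<)" "butlast is" "[last is]"] by auto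
  have st: "set is = insert (last is) (set (butlast is))" using app by (metis list.set(2) list.simps(15) set_append Un_insert_right append.right_neutral empty_set sup_bot_right)
  show m: "last is = Max (set is)" unfolding st using b(2) by (intro Max_eqI[symmetric]) (auto intro: less_imp_le)
  have "set is - {last is} = set (butlast is)" using st b(2) by auto
  then have "set is - {Max (set is)} = set (butlast is)" by (simp only: m)
  then show "hook_tableau n (butlast is) = tab n (set is - {Max (set is)})" using u[OF b(1)] by (simp add: tab_def)
qed

section \<open>Eigenvectors in standard modules\<close>

lemma to_pol_eqI:
  "x \<in> carrier (Delta n c \<mu>) \<Longrightarrow> y \<in> carrier (Delta n c \<mu>) \<Longrightarrow> to_pol n c x = to_pol n c y \<Longrightarrow> x = y"
  by (rule inj_onD[OF to_pol_inj])

lemmas to_pol_simps = const_map.dext_add const_map.dext_act const_map.dext_zero const_map.dext_iota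

text \<open>The identities are pulled back along the injection \<open>to_pol\<close>; negatives
  exist because \<open>to_pol\<close> is onto the polynomials.\<close>

lemma Delta_abelian_group: "abelian_group (Delta n c \<mu>)"
proof (rule abelian_groupI)
  fix x y z assume x: "x \<in> carrier (Delta n c \<mu>)" and y: "y \<in> carrier (Delta n c \<mu>)" and z: "z \<in> carrier (Delta n c \<mu>)"
  show "x \<oplus>\<^bsub>Delta n c \<mu>\<^esub> y \<in> carrier (Delta n c \<mu>)" by (rule Delta_closed(1)[OF x y])
  show "x \<oplus>\<^bsub>Delta n c \<mu>\<^esub> y \<oplus>\<^bsub>Delta n c \<mu>\<^esub> z = x \<oplus>\<^bsub>Delta n c \<mu>\<^esub> (y \<oplus>\<^bsub>Delta n c \<mu>\<^esub> z)"
    by (rule to_pol_eqI[of _ n c \<mu>]) (simp_all add: x y z Delta_closed to_pol_simps add.assoc)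
  show "x \<oplus>\<^bsub>Delta n c \<mu>\<^esub> y = y \<oplus>\<^bsub>Delta n c \<mu>\<^esub> x"
    by (rule to_pol_eqI[of _ n c \<mu>]) (simp_all add: x y Delta_closed to_pol_simps add.commute)
next
  fix x assume x: "x \<in> carrier (Delta n c \<mu>)"
  show "\<zero>\<^bsub>Delta n c \<mu>\<^esub> \<oplus>\<^bsub>Delta n c \<mu>\<^esub> x = x"
    by (rule to_pol_eqI[of _ n c \<mu>]) (simp_all add: x Delta_closed to_pol_simps)
  obtain y where y: "y \<in> carrier (Delta n c \<mu>)" "to_pol n c y = - to_pol n c x"
    using to_pol_surj pols_uminus[OF sn_space_irrep const_map.dext_pols[OF x]] by blast
  have "y \<oplus>\<^bsub>Delta n c \<mu>\<^esub> x = \<zero>\<^bsub>Delta n c \<mu>\<^esub>"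
    by (rule to_pol_eqI[of _ n c \<mu>]) (simp_all add: x y Delta_closed to_pol_simps)
  then show "\<exists>y\<in>carrier (Delta n c \<mu>). y \<oplus>\<^bsub>Delta n c \<mu>\<^esub> x = \<zero>\<^bsub>Delta n c \<mu>\<^esub>" using y by blast
qed (rule Delta_closed)

lemma to_pol_minus:
  assumes "x \<in> carrier (Delta n c \<mu>)" "y \<in> carrier (Delta n c \<mu>)"
  shows "to_pol n c (x \<ominus>\<^bsub>Delta n c \<mu>\<^esub> y) = to_pol n c x - to_pol n c y"
proof -
  interpret abelian_group "Delta n c \<mu>" by (rule Delta_abelian_group)
  have "to_pol n c (x \<ominus>\<^bsub>Delta n c \<mu>\<^esub> y \<oplus>\<^bsub>Delta n c \<mu>\<^esub> y) = to_pol n c x"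
    using assms by (simp add: minus_eq a_assoc l_neg)
  then show ?thesis using assms by (simp add: to_pol_simps eq_diff_eq)
qed

lemma to_pol_finsum:
  assumes "finite F" "\<And>x. x \<in> F \<Longrightarrow> f x \<in> carrier (Delta n c \<mu>)"
  shows "finsum (Delta n c \<mu>) f F \<in> carrier (Delta n c \<mu>)"
    "to_pol n c (finsum (Delta n c \<mu>) f F) = (\<Sum>x\<in>F. to_pol n c (f x))"
proof -
  interpret abelian_group "Delta n c \<mu>" by (rule Delta_abelian_group)
  show c: "finsum (Delta n c \<mu>) f F \<in> carrier (Delta n c \<mu>)" using assms by (intro finsum_closed) auto
  show "to_pol n c (finsum (Delta n c \<mu>) f F) = (\<Sum>x\<in>F. to_pol n c (f x))"
    using assms
  proof (induction F)
    case (insert x F)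
    have "f \<in> F \<rightarrow> carrier (Delta n c \<mu>)" "f x \<in> carrier (Delta n c \<mu>)" using insert.prems by auto
    then show ?case using insert finsum_closed[of f F] by (simp add: to_pol_simps)
  qed (simp add: to_pol_simps)
qed

section \<open>From the normalized basis in \<open>Delta\<close> to the spectral setting\<close>

lemma irrep_vectorspace: "vectorspace class_ring (irrep n \<mu>)"
proof -
  note D = sn_spaceD[OF sn_space_irrep[of n \<mu>]]
  have "\<forall>v\<in>carrier (irrep n \<mu>). \<exists>w\<in>carrier (irrep n \<mu>). v + w = 0" using D(5) add.right_inverse by blast
  then show ?thesis
    by (intro vs_criteria[OF class_field]) (auto simp: scal_mult scal_add algebra_simps intro: D)
qed

lemma irrep_finsum:
  assumes "finite A" "\<And>x. x \<in> A \<Longrightarrow> f x \<in> carrier (irrep n \<mu>)"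
  shows "finsum (irrep n \<mu>) f A = sum f A"
proof -
  interpret vectorspace class_ring "irrep n \<mu>" by (rule irrep_vectorspace)
  show ?thesis using assms
  proof (induction A)
    case (insert x A)
    have "f \<in> A \<rightarrow> carrier (irrep n \<mu>)" "f x \<in> carrier (irrep n \<mu>)" using insert.prems by auto
    then show ?case using insert by simp
  qed simp
qed

lemma uop_const:
  "uop n c i (mon (\<lambda>_. 0) w) = - mon (\<lambda>_. 0) (scal c * (\<Sum>j\<in>{1..<i}. transp i j * w))"
proof -
  have "jop i (mon (\<lambda>_. 0) w) = mon (\<lambda>_. 0) (\<Sum>j\<in>{1..<i}. transp i j * w)"
    by (simp add: jop_def additive.sum[OF additive_single] exp_act_def transp_def o_def)
  then show ?thesis by (simp add: uop_def zop_def op_simps del: yop_mon One_nat_def)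
qed

lemma pop_const: "pop g (mon (\<lambda>_. 0) w) = mon (\<lambda>_. 0) (perm_elt g * w)"
  by (simp add: exp_act_def o_def)

lemma mon_const_eq_iff: "mon a x = mon a y \<longleftrightarrow> x = y"
  by (metis lookup_single_eq)

lemma std_tableaux_hook: "l < n \<Longrightarrow> std_tableaux (hook n l) = tab n ` legsets n l"
  using tab_bij[of l n] by (simp add: bij_betw_def)

text \<open>The eigenvalue and normalization conditions are given inside \<open>Delta\<close>. On
  constants \<open>u_i\<close> is \<open>-c J_i\<close>, so division by the nonzero \<open>c\<close>
  yields the eigenvalues of the Jucys-Murphy elements.\<close>

lemma hook_rep_of_basis:
  assumes "0 < m" "0 < n" "coprime m n" and c: "c = of_nat m / of_nat n" and l: "l < n"
    and hb: "hook_basis n c l u"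
  shows "hook_rep n m l c (carrier (irrep n (hook n l))) (\<lambda>L. u (tab n L))"
proof -
  let ?\<mu> = "hook n l" and ?v = "\<lambda>L. u (tab n L)"
  let ?V = "carrier (irrep n ?\<mu>)" and ?Ls = "legsets n l"
  let ?ev = "\<lambda>T i. - of_int (box_content T i) * c"
  have c0: "c \<noteq> 0" using assms by simp
  have inj: "inj_on u (std_tableaux ?\<mu>)"
    and bas: "vectorspace.basis class_ring (irrep n ?\<mu>) (u ` std_tableaux ?\<mu>)"
    and eigen: "\<And>T i. T \<in> std_tableaux ?\<mu> \<Longrightarrow> i \<in> {1..n} \<Longrightarrow>
      act n c ?\<mu> (u_elt c i) (iota n c ?\<mu> (u T)) = act n c ?\<mu> (scal (?ev T i)) (iota n c ?\<mu> (u T))"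
    and nrm: "\<And>T j. T \<in> std_tableaux ?\<mu> \<Longrightarrow> j \<in> {2..<n} \<Longrightarrow> j \<in> column T 0 \<and> Suc j \<notin> column T 0 \<Longrightarrow>
        iota n c ?\<mu> (u (map (map (transpose j (Suc j))) T)) =
        act n c ?\<mu> (transp j (Suc j)) (iota n c ?\<mu> (u T))
          \<ominus>\<^bsub>Delta n c ?\<mu>\<^esub> act n c ?\<mu> (scal (c / (?ev T j - ?ev T (Suc j)))) (iota n c ?\<mu> (u T))"
    using hb unfolding hook_basis_def Let_def by blast+
  interpret vs: vectorspace class_ring "irrep n ?\<mu>" by (rule irrep_vectorspace)
  let ?A = "u ` std_tableaux ?\<mu>"
  have A: "?A = ?v ` ?Ls" unfolding std_tableaux_hook[OF l] image_image ..
  have vinj: "inj_on ?v ?Ls"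
    using comp_inj_on[of "tab n" ?Ls u] tab_bij[OF l] inj by (simp add: bij_betw_def comp_def)
  have finA: "finite ?A" unfolding A using finite_legsets by blast
  have AV: "?A \<subseteq> ?V" and ind: "\<not> vs.lin_dep ?A" and gen: "vs.span ?A = ?V" using bas by (auto simp: vs.basis_def)
  have reindex: "vs.lincomb a ?A = (\<Sum>L\<in>?Ls. scal (a (?v L)) * ?v L)" for a
  proof -
    have "vs.lincomb a ?A = (\<Sum>w\<in>?A. scal (a w) * w)"
      unfolding vs.lincomb_def using finA AV sn_spaceD(3)[OF sn_space_irrep] by (subst irrep_finsum) auto
    then show ?thesis unfolding A sum.reindex[OF vinj] by (simp add: comp_def)
  qed
  have vV: "?v L \<in> ?V" if "L \<in> ?Ls" for L using AV that unfolding A by blast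
  show ?thesis
  proof
    show "0 < n" "0 < m" "coprime m n" "c = of_nat m / of_nat n" by fact+
    show "sn_space n ?V" by (rule sn_space_irrep)
    show "?v L \<in> ?V" if "L \<in> ?Ls" for L by (rule vV[OF that])
    show "\<exists>\<alpha>. x = (\<Sum>L\<in>?Ls. scal (\<alpha> L) * ?v L)" if x: "x \<in> ?V" for x
    proof -
      have "x \<in> vs.span ?A" using x gen by simp
      then obtain a where "vs.lincomb a ?A = x" using vs.finite_in_span[OF finA AV] by blast
      then show ?thesis unfolding reindex by (intro exI[of _ "\<lambda>L. a (?v L)"]) simp
    qed
    show "\<alpha> L = 0" if z: "(\<Sum>L\<in>?Ls. scal (\<alpha> L) * ?v L) = 0" and L: "L \<in> ?Ls" for \<alpha> L
    proof (rule ccontr)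
      assume ne: "\<alpha> L \<noteq> 0"
      let ?a = "\<lambda>w. \<alpha> (inv_into ?Ls ?v w)"
      have a: "?a (?v K) = \<alpha> K" if "K \<in> ?Ls" for K using inv_into_f_f[OF vinj that] by simp
      have "vs.lincomb ?a ?A = 0" unfolding reindex using z a by simp
      then have "vs.lin_dep ?A"
        using finA L a[OF L] ne unfolding A by (intro vs.lin_dep_crit[where a = ?a and v = "?v L" and A = "?v ` ?Ls"]) auto
      then show False using ind by simp
    qed
    show "(\<Sum>j\<in>{1..<i}. transp i j * ?v L) = scal (of_int (hct L i)) * ?v L" if L: "L \<in> ?Ls" and i: "i \<in> {1..n}" for L i
    proof -
      let ?J = "\<Sum>j\<in>{1..<i}. transp i j * ?v L"
      note e = arg_cong[OF eigen[OF tab_std[OF L l] i], of "to_pol n c"]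
      have "uop n c i (mon (\<lambda>_. 0) (?v L)) = sop (- of_int (hct L i) * c) (mon (\<lambda>_. 0) (?v L))"
        using e L i vV[OF L] box_content_tab[OF L i]
        by (simp add: to_pol_simps iota_carrier rep_u_elt(1) rep_u smash_carrier_scal del: One_nat_def)
      then have "mon (\<lambda>_. 0) (- (scal c * ?J)) = mon (\<lambda>_. 0) (scal (- of_int (hct L i) * c) * ?v L)"
        unfolding uop_const single_uminus sop_mon .
      then have "scal c * ?J = scal (of_int (hct L i) * c) * ?v L" unfolding mon_const_eq_iff by (simp add: scal_minus)
      then have "scal (1 / c) * (scal c * ?J) = scal (1 / c) * (scal (of_int (hct L i) * c) * ?v L)" by simp
      then show ?thesis using c0 by (simp add: scal_scal del: One_nat_def)
    qed
    show "?v (leg_swap j L) = transp j (Suc j) * ?v L - scal (1 / of_int (hct L (Suc j) - hct L j)) * ?v L"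
      if L: "L \<in> ?Ls" and j: "j \<in> L" "Suc j \<notin> L" "Suc j \<le> n" for L j
    proof -
      have j2: "j \<in> {2..<n}" using L j by (auto simp: legsets_def)
      have "j \<in> column (tab n L) 0 \<and> Suc j \<notin> column (tab n L) 0"
        using j j2 column_tab[OF L \<open>0 < n\<close>] by auto
      note e = arg_cong[OF nrm[OF tab_std[OF L l] j2 this], of "to_pol n c"]
      have jn: "j \<in> {1..n}" "Suc j \<in> {1..n}" using j2 by auto
      have k: "c / (?ev (tab n L) j - ?ev (tab n L) (Suc j)) = 1 / of_int (hct L (Suc j) - hct L j)"
      proof -
        have "?ev (tab n L) j - ?ev (tab n L) (Suc j) = c * of_int (hct L (Suc j) - hct L j)"
          using box_content_tab[OF L jn(1)] box_content_tab[OF L jn(2)] by (simp add: algebra_simps)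
        then show ?thesis using c0 by simp
      qed
      have io: "iota n c ?\<mu> (?v L) \<in> carrier (Delta n c ?\<mu>)" using iota_carrier vV[OF L] by blast
      have "mon (\<lambda>_. 0) (?v (leg_swap j L)) = pop (transpose j (Suc j)) (mon (\<lambda>_. 0) (?v L))
         - sop (1 / of_int (hct L (Suc j) - hct L j)) (mon (\<lambda>_. 0) (?v L))"
        using e io vV[OF L] vV[OF leg_swap_in[OF L j]] unfolding k tab_leg_swap[OF L j]
        by (simp add: to_pol_minus to_pol_simps Delta_closed smash_carrier_scal smash_carrier_transp[OF jn] del: pop_mon sop_mon)
      then show ?thesis
        unfolding pop_const sop_mon single_diff[symmetric] mon_const_eq_iff transp_def[symmetric] .
    qed
  qed
qed

locale hook_delta = hook_rep n m l c "carrier (irrep n (hook n l))" "\<lambda>L. u (tab n L)"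
  for n m l :: nat and c :: complex and u :: "nat list list \<Rightarrow> smash" +
  assumes l_less: "l < n"
begin

lemma monomial_vec_tab:
  assumes "b \<in> exponents n" "L \<in> legsets n l"
  shows "monomial_vec n c (hook n l) u b (tab n L) \<in> carrier (Delta n c (hook n l))"
    "to_pol n c (monomial_vec n c (hook n l) u b (tab n L)) = mon b (top b L)"
proof -
  have g: "inv_into UNIV (sort_perm n b) permutes {1..n}" by (rule permutes_inv[OF sort_perm_permutes])
  note car = smash_mult_closed[OF x_monomial_carrier smash_carrier_perm[OF g], of b] iota_carrier[OF v_in[OF assms(2)], of c]
  show "monomial_vec n c (hook n l) u b (tab n L) \<in> carrier (Delta n c (hook n l))"
    unfolding monomial_vec_def by (rule Delta_closed(2)[OF car(2,1)])
  show "to_pol n c (monomial_vec n c (hook n l) u b (tab n L)) = mon b (top b L)"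
    unfolding monomial_vec_def const_map.dext_act[OF car(2,1)] const_map.dext_iota[OF v_in[OF assms(2)]]
      rep_mult[OF x_monomial_carrier smash_carrier_perm[OF g]] rep_perm pop_const rep_x_monomial[OF assms(1)] top_def ..
qed

text \<open>\<open>has_coeff_one\<close> only says that some expansion has coefficient
  \<open>1\<close>. Independence of the vectors \<open>top a K\<close> makes the part of the
  expansion at \<open>a\<close> unique.\<close>

lemma has_coeff_one_top:
  assumes a: "a \<in> exponents n" and L: "L \<in> legsets n l"
    and h: "has_coeff_one n c (hook n l) u a (tab n L) w"
    and e: "coef (to_pol n c w) a = scal z * top a L"
  shows "z = 1"
proof -
  obtain F f where F: "finite F" "F \<subseteq> exponents n \<times> std_tableaux (hook n l)" "(a, tab n L) \<in> F" "f (a, tab n L) = 1"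
    and w: "w = finsum (Delta n c (hook n l)) (\<lambda>(b, S). act n c (hook n l) (scal (f (b, S))) (monomial_vec n c (hook n l) u b S)) F"
    using h unfolding has_coeff_one_def by (elim exE conjE) blast
  let ?t = "tab n" and ?g = "\<lambda>(b, S). act n c (hook n l) (scal (f (b, S))) (monomial_vec n c (hook n l) u b S)"
  have tb: "bij_betw ?t (legsets n l) (std_tableaux (hook n l))" by (rule tab_bij[OF l_less])
  have g: "?g x \<in> carrier (Delta n c (hook n l)) \<and> coef (to_pol n c (?g x)) a
      = (if fst x = a then scal (f x) * top a (inv_into (legsets n l) ?t (snd x)) else 0)" if x: "x \<in> F" for x
  proof -
    obtain b S where "x = (b, S)" "b \<in> exponents n" "S \<in> std_tableaux (hook n l)" using x F(2) by (cases x) auto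
    then obtain K where bK: "x = (b, ?t K)" "b \<in> exponents n" "K \<in> legsets n l"
      unfolding std_tableaux_hook[OF l_less] by blast
    have "inv_into (legsets n l) ?t (?t K) = K" using bK tb by (simp add: bij_betw_def)
    then show ?thesis using monomial_vec_tab[OF bK(2,3)] bK
      by (auto simp: Delta_closed smash_carrier_scal to_pol_simps lookup_single when_def)
  qed
  let ?\<beta> = "\<lambda>K. if (a, ?t K) \<in> F then f (a, ?t K) else 0"
  have "coef (to_pol n c w) a = (\<Sum>x\<in>F. coef (to_pol n c (?g x)) a)"
    unfolding w using to_pol_finsum(2)[OF F(1), of ?g n c "hook n l"] g by (simp add: lookup_sum)
  also have "\<dots> = (\<Sum>x\<in>F. if fst x = a then scal (f x) * top a (inv_into (legsets n l) ?t (snd x)) else 0)"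
    using g by (intro sum.cong) auto
  also have "\<dots> = (\<Sum>x\<in>{x \<in> F. fst x = a}. scal (f x) * top a (inv_into (legsets n l) ?t (snd x)))"
    by (rule sum.inter_filter[symmetric]) (rule F(1))
  also have "{x \<in> F. fst x = a} = (\<lambda>K. (a, ?t K)) ` {K \<in> legsets n l. (a, ?t K) \<in> F}"
  proof (intro equalityI subsetI)
    fix x assume "x \<in> {x \<in> F. fst x = a}"
    then obtain S where S: "x = (a, S)" "(a, S) \<in> F" by (cases x) auto
    then have "S \<in> std_tableaux (hook n l)" using F(2) by auto
    then obtain K where "K \<in> legsets n l" "S = ?t K" unfolding std_tableaux_hook[OF l_less] by blast
    then show "x \<in> (\<lambda>K. (a, ?t K)) ` {K \<in> legsets n l. (a, ?t K) \<in> F}" using S by blast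
  qed auto
  also have "(\<Sum>x\<in>\<dots>. scal (f x) * top a (inv_into (legsets n l) ?t (snd x)))
     = (\<Sum>K\<in>{K \<in> legsets n l. (a, ?t K) \<in> F}. scal (f (a, ?t K)) * top a K)"
  proof (subst sum.reindex)
    show "inj_on (\<lambda>K. (a, ?t K)) {K \<in> legsets n l. (a, ?t K) \<in> F}"
      using tb by (auto simp: bij_betw_def inj_on_def)
    show "sum ((\<lambda>x. scal (f x) * top a (inv_into (legsets n l) ?t (snd x))) \<circ> (\<lambda>K. (a, ?t K))) {K \<in> legsets n l. (a, ?t K) \<in> F}
       = (\<Sum>K\<in>{K \<in> legsets n l. (a, ?t K) \<in> F}. scal (f (a, ?t K)) * top a K)"
      using tb by (intro sum.cong) (auto simp: bij_betw_def)
  qed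
  also have "\<dots> = (\<Sum>K\<in>legsets n l. if (a, ?t K) \<in> F then scal (f (a, ?t K)) * top a K else 0)"
    by (rule sum.inter_filter) (rule finite_legsets)
  also have "\<dots> = (\<Sum>K\<in>legsets n l. scal (?\<beta> K) * top a K)" by (rule sum.cong) auto
  finally have b: "coef (to_pol n c w) a = (\<Sum>K\<in>legsets n l. scal (?\<beta> K) * top a K)" .
  have "scal z * top a L = (\<Sum>K\<in>legsets n l. scal (if K = L then z else 0) * top a K)"
  proof -
    have "(\<Sum>K\<in>legsets n l. scal (if K = L then z else 0) * top a K) = (\<Sum>K\<in>legsets n l. if K = L then scal z * top a K else 0)"
      by (rule sum.cong) auto
    then show ?thesis using L finite_legsets by (simp add: sum.delta)
  qed
  then have "(\<Sum>K\<in>legsets n l. scal (?\<beta> K - (if K = L then z else 0)) * top a K) = 0"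
    using b e by (simp add: scal_diff left_diff_distrib sum_subtractf)
  from top_indep[OF this L] show "z = 1" using F(3,4) by simp
qed

text \<open>Every coefficient of the polynomial is expanded in the basis \<open>top b K\<close>; as
  there are finitely many keys, this is an expansion in the vectors
  \<open>monomial_vec\<close>.\<close>

lemma has_coeff_oneI:
  assumes a: "a \<in> exponents n" and L: "L \<in> legsets n l"
    and w: "w \<in> carrier (Delta n c (hook n l))" and e: "coef (to_pol n c w) a = top a L"
  shows "has_coeff_one n c (hook n l) u a (tab n L) w"
proof -
  let ?f = "to_pol n c w" and ?t = "tab n" and ?\<mu> = "hook n l"
  have tb: "bij_betw ?t (legsets n l) (std_tableaux ?\<mu>)" by (rule tab_bij[OF l_less])
  have fp: "?f \<in> pols n (carrier (irrep n ?\<mu>))" by (rule const_map.dext_pols[OF w])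
  have "\<forall>b. \<exists>\<alpha>. coef ?f b = (\<Sum>K\<in>legsets n l. scal (\<alpha> K) * top b K)"
    using top_span[OF coef_pols[OF fp]] by blast
  then obtain \<alpha> where \<alpha>: "\<And>b. coef ?f b = (\<Sum>K\<in>legsets n l. scal (\<alpha> b K) * top b K)" by metis
  have "(\<Sum>K\<in>legsets n l. scal (if K = L then 1 else 0) * top a K) = (\<Sum>K\<in>legsets n l. if K = L then top a K else 0)"
    by (rule sum.cong) auto
  then have "(\<Sum>K\<in>legsets n l. scal (\<alpha> a K - (if K = L then 1 else 0)) * top a K) = 0"
    using \<alpha>[of a] e L finite_legsets by (simp add: scal_diff left_diff_distrib sum_subtractf sum.delta)
  from top_indep[OF this L] have \<alpha>1: "\<alpha> a L = 1" by simp
  let ?h = "\<lambda>(b, S). \<alpha> b (inv_into (legsets n l) ?t S)"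
  let ?F = "Poly_Mapping.keys ?f \<times> std_tableaux ?\<mu>"
  let ?g = "\<lambda>(b, S). act n c ?\<mu> (scal (?h (b, S))) (monomial_vec n c ?\<mu> u b S)"
  have inv: "inv_into (legsets n l) ?t (?t K) = K" if "K \<in> legsets n l" for K
    using that tb by (simp add: bij_betw_def)
  have fin: "finite ?F" unfolding std_tableaux_hook[OF l_less] using finite_legsets by simp
  have ex: "b \<in> exponents n" if "b \<in> Poly_Mapping.keys ?f" for b using fp that by (auto simp: pols_def)
  have g: "?g (b, ?t K) \<in> carrier (Delta n c ?\<mu>)" "to_pol n c (?g (b, ?t K)) = mon b (scal (\<alpha> b K) * top b K)"
    if "b \<in> exponents n" "K \<in> legsets n l" for b K
    using monomial_vec_tab[OF that] inv[OF that(2)] by (simp_all add: Delta_closed smash_carrier_scal to_pol_simps)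
  have gF: "?g x \<in> carrier (Delta n c ?\<mu>)" if x: "x \<in> ?F" for x
  proof -
    obtain b K where "x = (b, ?t K)" "b \<in> Poly_Mapping.keys ?f" "K \<in> legsets n l"
      using x unfolding std_tableaux_hook[OF l_less] by blast
    then show ?thesis using g(1)[OF ex] by blast
  qed
  have "to_pol n c (finsum (Delta n c ?\<mu>) ?g ?F) = (\<Sum>x\<in>?F. to_pol n c (?g x))"
    by (rule to_pol_finsum(2)[OF fin gF])
  also have "\<dots> = (\<Sum>b\<in>Poly_Mapping.keys ?f. \<Sum>S\<in>std_tableaux ?\<mu>. to_pol n c (?g (b, S)))"
    unfolding sum.cartesian_product by (rule sum.cong) auto
  also have "\<dots> = (\<Sum>b\<in>Poly_Mapping.keys ?f. \<Sum>K\<in>legsets n l. to_pol n c (?g (b, ?t K)))"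
    by (intro sum.cong refl sum.reindex_bij_betw[OF tb, symmetric])
  also have "\<dots> = (\<Sum>b\<in>Poly_Mapping.keys ?f. \<Sum>K\<in>legsets n l. mon b (scal (\<alpha> b K) * top b K))"
    using g(2)[OF ex] by (intro sum.cong refl) blast
  also have "\<dots> = (\<Sum>b\<in>Poly_Mapping.keys ?f. mon b (coef ?f b))"
    unfolding \<alpha> additive.sum[OF additive_single] ..
  also have "\<dots> = ?f" by (rule poly_mapping_decomp[symmetric])
  finally have "w = finsum (Delta n c ?\<mu>) ?g ?F"
    using to_pol_finsum(1)[OF fin gF] w by (intro to_pol_eqI[of w n c ?\<mu>]) simp_all
  moreover have "?F \<subseteq> exponents n \<times> std_tableaux ?\<mu>" using ex by auto
  moreover have "a \<in> Poly_Mapping.keys ?f"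
    using e top_independent1[OF L, of 1 a] by (auto simp: in_keys_iff)
  then have "(a, ?t L) \<in> ?F" using tab_std[OF L l_less] by simp
  moreover have "?h (a, ?t L) = 1" using inv[OF L] \<alpha>1 by simp
  ultimately show ?thesis
    unfolding has_coeff_one_def using fin by (intro exI[of _ ?F] exI[of _ ?h] conjI) assumption+
qed

text \<open>Resolves the definite description: the eigenvector \<open>ev\<close> supplies a witness
  through surjectivity of \<open>to_pol\<close>, and its uniqueness transfers through
  injectivity.\<close>

lemma eigenvec_tab:
  assumes a: "a \<in> exponents n" and L: "L \<in> legsets n l"
  shows "eigenvec n c (hook n l) u a (tab n L) \<in> carrier (Delta n c (hook n l))"
    "to_pol n c (eigenvec n c (hook n l) u a (tab n L)) = ev a L"
proof -
  let ?\<mu> = "hook n l"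
  let ?P = "\<lambda>w. w \<in> carrier (Delta n c ?\<mu>)
    \<and> (\<forall>i\<in>{1..n}. act n c ?\<mu> (u_elt c i) w = act n c ?\<mu> (scal (weight n c a (tab n L) i)) w)
    \<and> has_coeff_one n c ?\<mu> u a (tab n L) w"
  have weight: "weight n c a (tab n L) i = wt a L i" if "i \<in> {1..n}" for i
    using box_content_tab[OF L, of "sort_perm n a i"] permutes_in_image[OF sort_perm_permutes[of n a], of i] that
    by (simp add: weight_def del: One_nat_def)
  have eig: "(\<forall>i\<in>{1..n}. act n c ?\<mu> (u_elt c i) w = act n c ?\<mu> (scal (weight n c a (tab n L) i)) w) \<longleftrightarrow> eig (wt a L) (to_pol n c w)"
    if w: "w \<in> carrier (Delta n c ?\<mu>)" for w
  proof -
    have "act n c ?\<mu> (u_elt c i) w = act n c ?\<mu> (scal (weight n c a (tab n L) i)) w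
      \<longleftrightarrow> uop n c i (to_pol n c w) = sop (wt a L i) (to_pol n c w)" if i: "i \<in> {1..n}" for i
    proof -
      have 1: "to_pol n c (act n c ?\<mu> (u_elt c i) w) = uop n c i (to_pol n c w)"
        using const_map.dext_act[OF w rep_u_elt(1)[OF i]] rep_u[OF i] by simp
      have 2: "to_pol n c (act n c ?\<mu> (scal (weight n c a (tab n L) i)) w) = sop (wt a L i) (to_pol n c w)"
        using const_map.dext_act[OF w smash_carrier_scal] weight[OF i] by simp
      show ?thesis
        using to_pol_eqI[OF Delta_closed(2)[OF w rep_u_elt(1)[OF i]] Delta_closed(2)[OF w smash_carrier_scal]] 1 2 by metis
    qed
    then show ?thesis using const_map.dext_pols[OF w] by (simp add: eig_def del: One_nat_def)
  qed
  obtain x where x: "x \<in> carrier (Delta n c ?\<mu>)" "to_pol n c x = ev a L"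
    using to_pol_surj[of "ev a L" n ?\<mu> c] ev(1)[OF a L] by (auto simp: eig_def)
  have "eigenvec n c ?\<mu> u a (tab n L) = x"
    unfolding eigenvec_def
  proof (rule the_equality)
    show "?P x" using x eig[OF x(1)] ev[OF a L] has_coeff_oneI[OF a L x(1)] by (simp del: One_nat_def)
    fix w assume w: "?P w"
    then have e: "eig (wt a L) (to_pol n c w)" using eig by blast
    obtain z where z: "coef (to_pol n c w) a = scal z * top a L" using eig_top(2)[OF a L e] by blast
    then have "z = 1" using has_coeff_one_top[OF a L] w by blast
    then have "to_pol n c w = ev a L" using ev_eqI[OF a L e] z by simp
    then show "w = x" using x w by (intro to_pol_eqI[of w n c ?\<mu>]) simp_all
  qed
  then show "eigenvec n c ?\<mu> u a (tab n L) \<in> carrier (Delta n c ?\<mu>)"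
    "to_pol n c (eigenvec n c ?\<mu> u a (tab n L)) = ev a L" using x by simp_all
qed

end

section \<open>Spaces of homomorphisms\<close>

lemma smult_cls: "cls n c a \<odot>\<^bsub>Delta n c \<mu>\<^esub> x = act n c \<mu> a x"
  by (simp add: act_def)

lemma Hom_space_simps:
  "carrier (Hom_space n c \<nu> \<mu>) = LinearCombinations.module_hom (cherednik n c) (Delta n c \<nu>) (Delta n c \<mu>)
     \<inter> extensional (carrier (Delta n c \<nu>))"
  "\<zero>\<^bsub>Hom_space n c \<nu> \<mu>\<^esub> = (\<lambda>x\<in>carrier (Delta n c \<nu>). \<zero>\<^bsub>Delta n c \<mu>\<^esub>)"
  "\<psi> \<oplus>\<^bsub>Hom_space n c \<nu> \<mu>\<^esub> \<chi> = (\<lambda>x\<in>carrier (Delta n c \<nu>). \<psi> x \<oplus>\<^bsub>Delta n c \<mu>\<^esub> \<chi> x)"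
  "z \<odot>\<^bsub>Hom_space n c \<nu> \<mu>\<^esub> \<psi> = (\<lambda>x\<in>carrier (Delta n c \<nu>). act n c \<mu> (scal z) (\<psi> x))"
  by (simp_all add: Hom_space_def Let_def)

text \<open>The conditions are stated after \<open>to_pol\<close>, so that they become identities
  between polynomials; injectivity of \<open>to_pol\<close> brings them back.\<close>

lemma Hom_spaceI:
  assumes "\<psi> \<in> extensional (carrier (Delta n c \<nu>))"
    and cl: "\<And>x. x \<in> carrier (Delta n c \<nu>) \<Longrightarrow> \<psi> x \<in> carrier (Delta n c \<mu>)"
    and add: "\<And>x y. x \<in> carrier (Delta n c \<nu>) \<Longrightarrow> y \<in> carrier (Delta n c \<nu>) \<Longrightarrow>
      to_pol n c (\<psi> (x \<oplus>\<^bsub>Delta n c \<nu>\<^esub> y)) = to_pol n c (\<psi> x) + to_pol n c (\<psi> y)"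
    and act: "\<And>a x. a \<in> carrier (smash_ring n) \<Longrightarrow> x \<in> carrier (Delta n c \<nu>) \<Longrightarrow>
      to_pol n c (\<psi> (act n c \<nu> a x)) = rep n c a (to_pol n c (\<psi> x))"
  shows "\<psi> \<in> carrier (Hom_space n c \<nu> \<mu>)"
  unfolding Hom_space_simps LinearCombinations.module_hom_def
proof (rule IntI, rule CollectI, intro conjI allI impI ballI)
  show "\<psi> \<in> carrier (Delta n c \<nu>) \<rightarrow> carrier (Delta n c \<mu>)" using cl by blast
  show "\<psi> \<in> extensional (carrier (Delta n c \<nu>))" by fact
next
  fix x y assume "x \<in> carrier (Delta n c \<nu>) \<and> y \<in> carrier (Delta n c \<nu>)"
  then have x: "x \<in> carrier (Delta n c \<nu>)" and y: "y \<in> carrier (Delta n c \<nu>)" by auto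
  show "\<psi> (x \<oplus>\<^bsub>Delta n c \<nu>\<^esub> y) = \<psi> x \<oplus>\<^bsub>Delta n c \<mu>\<^esub> \<psi> y"
    by (rule to_pol_eqI[of _ n c \<mu>]) (simp_all add: x y cl add Delta_closed to_pol_simps)
next
  fix r x assume "r \<in> carrier (cherednik n c) \<and> x \<in> carrier (Delta n c \<nu>)"
  then obtain a where x: "x \<in> carrier (Delta n c \<nu>)" and a: "r = cls n c a" "a \<in> carrier (smash_ring n)"
    by (auto simp: cherednik_carrier)
  show "\<psi> (r \<odot>\<^bsub>Delta n c \<nu>\<^esub> x) = r \<odot>\<^bsub>Delta n c \<mu>\<^esub> \<psi> x"
    unfolding a smult_cls
    by (rule to_pol_eqI[of _ n c \<mu>]) (simp_all add: x a(2) cl act Delta_closed to_pol_simps)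
qed

lemma Hom_spaceD:
  assumes "\<psi> \<in> carrier (Hom_space n c \<nu> \<mu>)" and x: "x \<in> carrier (Delta n c \<nu>)"
  shows "\<psi> x \<in> carrier (Delta n c \<mu>)"
    "y \<in> carrier (Delta n c \<nu>) \<Longrightarrow> to_pol n c (\<psi> (x \<oplus>\<^bsub>Delta n c \<nu>\<^esub> y)) = to_pol n c (\<psi> x) + to_pol n c (\<psi> y)"
    "a \<in> carrier (smash_ring n) \<Longrightarrow> to_pol n c (\<psi> (act n c \<nu> a x)) = rep n c a (to_pol n c (\<psi> x))"
    "\<psi> \<in> extensional (carrier (Delta n c \<nu>))"
proof -
  have h: "\<psi> \<in> LinearCombinations.module_hom (cherednik n c) (Delta n c \<nu>) (Delta n c \<mu>)"
    and e: "\<psi> \<in> extensional (carrier (Delta n c \<nu>))" using assms unfolding Hom_space_simps by auto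
  show "\<psi> \<in> extensional (carrier (Delta n c \<nu>))" by (rule e)
  have cl: "\<psi> x \<in> carrier (Delta n c \<mu>)" if "x \<in> carrier (Delta n c \<nu>)" for x
    using module_hom_closed[OF h] that by blast
  show "\<psi> x \<in> carrier (Delta n c \<mu>)" by (rule cl[OF x])
  show "to_pol n c (\<psi> (x \<oplus>\<^bsub>Delta n c \<nu>\<^esub> y)) = to_pol n c (\<psi> x) + to_pol n c (\<psi> y)" if "y \<in> carrier (Delta n c \<nu>)"
    unfolding LinearCombinations.module_hom_add[OF h x that] by (rule const_map.dext_add[OF cl[OF x] cl[OF that]])
  show "to_pol n c (\<psi> (act n c \<nu> a x)) = rep n c a (to_pol n c (\<psi> x))" if a: "a \<in> carrier (smash_ring n)"
  proof -
    have "cls n c a \<in> carrier (cherednik n c)" using a by (simp add: cherednik_carrier)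
    from module_hom_smult[OF h this x] have "\<psi> (act n c \<nu> a x) = act n c \<mu> a (\<psi> x)" by (simp only: smult_cls)
    then show ?thesis using const_map.dext_act[OF cl[OF x] a] by simp
  qed
qed

lemma Hom_space_eqI:
  assumes "\<psi> \<in> carrier (Hom_space n c \<nu> \<mu>)" "\<chi> \<in> carrier (Hom_space n c \<nu> \<mu>)"
    and "\<And>x. x \<in> carrier (Delta n c \<nu>) \<Longrightarrow> to_pol n c (\<psi> x) = to_pol n c (\<chi> x)"
  shows "\<psi> = \<chi>"
proof (rule extensionalityI)
  show "\<psi> \<in> extensional (carrier (Delta n c \<nu>))" "\<chi> \<in> extensional (carrier (Delta n c \<nu>))"
    using assms unfolding Hom_space_simps by auto
  fix x assume x: "x \<in> carrier (Delta n c \<nu>)"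
  show "\<psi> x = \<chi> x" by (rule to_pol_eqI[OF Hom_spaceD(1)[OF assms(1) x] Hom_spaceD(1)[OF assms(2) x] assms(3)[OF x]])
qed

context
  fixes n :: nat and c :: complex and \<nu> \<mu> :: "nat list"
begin

lemma Hom_zero: "\<zero>\<^bsub>Hom_space n c \<nu> \<mu>\<^esub> \<in> carrier (Hom_space n c \<nu> \<mu>)"
  "x \<in> carrier (Delta n c \<nu>) \<Longrightarrow> to_pol n c (\<zero>\<^bsub>Hom_space n c \<nu> \<mu>\<^esub> x) = 0"
  by (rule Hom_spaceI) (simp_all add: Hom_space_simps Delta_closed to_pol_simps rep_simps)

lemma Hom_add:
  assumes "\<psi> \<in> carrier (Hom_space n c \<nu> \<mu>)" "\<chi> \<in> carrier (Hom_space n c \<nu> \<mu>)"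
  shows "\<psi> \<oplus>\<^bsub>Hom_space n c \<nu> \<mu>\<^esub> \<chi> \<in> carrier (Hom_space n c \<nu> \<mu>)"
    "x \<in> carrier (Delta n c \<nu>) \<Longrightarrow> to_pol n c ((\<psi> \<oplus>\<^bsub>Hom_space n c \<nu> \<mu>\<^esub> \<chi>) x) = to_pol n c (\<psi> x) + to_pol n c (\<chi> x)"
proof -
  note D = Hom_spaceD(1-3)[OF assms(1)] Hom_spaceD(1-3)[OF assms(2)]
  show *: "to_pol n c ((\<psi> \<oplus>\<^bsub>Hom_space n c \<nu> \<mu>\<^esub> \<chi>) x) = to_pol n c (\<psi> x) + to_pol n c (\<chi> x)" if "x \<in> carrier (Delta n c \<nu>)" for x
    using that by (simp add: Hom_space_simps D to_pol_simps)
  show "\<psi> \<oplus>\<^bsub>Hom_space n c \<nu> \<mu>\<^esub> \<chi> \<in> carrier (Hom_space n c \<nu> \<mu>)"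
  proof (rule Hom_spaceI)
    show "\<psi> \<oplus>\<^bsub>Hom_space n c \<nu> \<mu>\<^esub> \<chi> \<in> extensional (carrier (Delta n c \<nu>))" by (simp add: Hom_space_simps)
    show "(\<psi> \<oplus>\<^bsub>Hom_space n c \<nu> \<mu>\<^esub> \<chi>) x \<in> carrier (Delta n c \<mu>)" if "x \<in> carrier (Delta n c \<nu>)" for x
      using that by (simp add: Hom_space_simps D Delta_closed)
  qed (simp_all add: * Delta_closed D rep_simps)
qed

lemma Hom_smult:
  assumes "\<psi> \<in> carrier (Hom_space n c \<nu> \<mu>)"
  shows "z \<odot>\<^bsub>Hom_space n c \<nu> \<mu>\<^esub> \<psi> \<in> carrier (Hom_space n c \<nu> \<mu>)"
    "x \<in> carrier (Delta n c \<nu>) \<Longrightarrow> to_pol n c ((z \<odot>\<^bsub>Hom_space n c \<nu> \<mu>\<^esub> \<psi>) x) = sop z (to_pol n c (\<psi> x))"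
proof -
  note D = Hom_spaceD(1-3)[OF assms]
  show *: "to_pol n c ((z \<odot>\<^bsub>Hom_space n c \<nu> \<mu>\<^esub> \<psi>) x) = sop z (to_pol n c (\<psi> x))" if "x \<in> carrier (Delta n c \<nu>)" for x
    using that by (simp add: Hom_space_simps D to_pol_simps smash_carrier_scal)
  show "z \<odot>\<^bsub>Hom_space n c \<nu> \<mu>\<^esub> \<psi> \<in> carrier (Hom_space n c \<nu> \<mu>)"
  proof (rule Hom_spaceI)
    show "z \<odot>\<^bsub>Hom_space n c \<nu> \<mu>\<^esub> \<psi> \<in> extensional (carrier (Delta n c \<nu>))" by (simp add: Hom_space_simps)
    show "(z \<odot>\<^bsub>Hom_space n c \<nu> \<mu>\<^esub> \<psi>) x \<in> carrier (Delta n c \<mu>)" if "x \<in> carrier (Delta n c \<nu>)" for x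
      using that by (simp add: Hom_space_simps D Delta_closed smash_carrier_scal)
  qed (simp_all add: * Delta_closed D rep_sop sop_simps)
qed

lemma Hom_vectorspace: "vectorspace class_ring (Hom_space n c \<nu> \<mu>)"
proof -
  let ?H = "Hom_space n c \<nu> \<mu>"
  note H = Hom_zero Hom_add Hom_smult
  have neg: "\<exists>\<chi>\<in>carrier ?H. \<psi> \<oplus>\<^bsub>?H\<^esub> \<chi> = \<zero>\<^bsub>?H\<^esub>" if "\<psi> \<in> carrier ?H" for \<psi>
    using that by (intro bexI[of _ "(- 1) \<odot>\<^bsub>?H\<^esub> \<psi>"] Hom_space_eqI[of _ n c \<nu> \<mu>]) (simp_all add: H sop_uminus)
  have comm: "\<psi> \<oplus>\<^bsub>?H\<^esub> \<chi> = \<chi> \<oplus>\<^bsub>?H\<^esub> \<psi>" if "\<psi> \<in> carrier ?H" "\<chi> \<in> carrier ?H" for \<psi> \<chi>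
    using that by (intro Hom_space_eqI[of _ n c \<nu> \<mu>]) (simp_all add: H add.commute)
  have assoc: "\<psi> \<oplus>\<^bsub>?H\<^esub> \<chi> \<oplus>\<^bsub>?H\<^esub> \<xi> = \<psi> \<oplus>\<^bsub>?H\<^esub> (\<chi> \<oplus>\<^bsub>?H\<^esub> \<xi>)" if "\<psi> \<in> carrier ?H" "\<chi> \<in> carrier ?H" "\<xi> \<in> carrier ?H" for \<psi> \<chi> \<xi>
    using that by (intro Hom_space_eqI[of _ n c \<nu> \<mu>]) (simp_all add: H add.assoc)
  have zero: "\<psi> \<oplus>\<^bsub>?H\<^esub> \<zero>\<^bsub>?H\<^esub> = \<psi>" if "\<psi> \<in> carrier ?H" for \<psi>
    using that by (intro Hom_space_eqI[of _ n c \<nu> \<mu>]) (simp_all add: H)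
  have compat: "(a * b) \<odot>\<^bsub>?H\<^esub> \<psi> = a \<odot>\<^bsub>?H\<^esub> (b \<odot>\<^bsub>?H\<^esub> \<psi>)" if "\<psi> \<in> carrier ?H" for a b \<psi>
    using that by (intro Hom_space_eqI[of _ n c \<nu> \<mu>]) (simp_all add: H sop_sop)
  have one: "1 \<odot>\<^bsub>?H\<^esub> \<psi> = \<psi>" if "\<psi> \<in> carrier ?H" for \<psi>
    using that by (intro Hom_space_eqI[of _ n c \<nu> \<mu>]) (simp_all add: H)
  have d1: "(a + b) \<odot>\<^bsub>?H\<^esub> \<psi> = a \<odot>\<^bsub>?H\<^esub> \<psi> \<oplus>\<^bsub>?H\<^esub> b \<odot>\<^bsub>?H\<^esub> \<psi>" if "\<psi> \<in> carrier ?H" for a b \<psi>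
    using that by (intro Hom_space_eqI[of _ n c \<nu> \<mu>]) (simp_all add: H sop_plus)
  have d2: "a \<odot>\<^bsub>?H\<^esub> (\<psi> \<oplus>\<^bsub>?H\<^esub> \<chi>) = a \<odot>\<^bsub>?H\<^esub> \<psi> \<oplus>\<^bsub>?H\<^esub> a \<odot>\<^bsub>?H\<^esub> \<chi>" if "\<psi> \<in> carrier ?H" "\<chi> \<in> carrier ?H" for a \<psi> \<chi>
    using that by (intro Hom_space_eqI[of _ n c \<nu> \<mu>]) (simp_all add: H sop_simps)
  show ?thesis
    by (rule vs_criteria[OF class_field])
      (use H(1,3,5) neg comm assoc zero compat one d1 d2 in simp_all)
qed

lemma Hom_iota_add:
  assumes "\<psi> \<in> carrier (Hom_space n c \<nu> \<mu>)" "v \<in> carrier (irrep n \<nu>)" "w \<in> carrier (irrep n \<nu>)"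
  shows "to_pol n c (\<psi> (iota n c \<nu> (v + w))) = to_pol n c (\<psi> (iota n c \<nu> v)) + to_pol n c (\<psi> (iota n c \<nu> w))"
proof -
  have "iota n c \<nu> (v + w) = iota n c \<nu> v \<oplus>\<^bsub>Delta n c \<nu>\<^esub> iota n c \<nu> w"
    using sn_spaceD(2)[OF sn_space_irrep assms(2,3)] assms(2,3)
    by (intro to_pol_eqI[of _ n c \<nu>]) (simp_all add: iota_carrier Delta_closed to_pol_simps single_add)
  then show ?thesis using Hom_spaceD(2)[OF assms(1)] iota_carrier assms(2,3) by metis
qed

lemma Hom_iota_act:
  assumes "\<psi> \<in> carrier (Hom_space n c \<nu> \<mu>)" "v \<in> carrier (irrep n \<nu>)" "w \<in> carrier (irrep n \<nu>)"
    and "a \<in> carrier (smash_ring n)" "rep n c a (mon (\<lambda>_. 0) v) = mon (\<lambda>_. 0) w"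
  shows "to_pol n c (\<psi> (iota n c \<nu> w)) = rep n c a (to_pol n c (\<psi> (iota n c \<nu> v)))"
proof -
  have "iota n c \<nu> w = act n c \<nu> a (iota n c \<nu> v)"
    using assms by (intro to_pol_eqI[of _ n c \<nu>]) (simp_all add: iota_carrier Delta_closed to_pol_simps)
  then show ?thesis using Hom_spaceD(3)[OF assms(1) iota_carrier[OF assms(2)] assms(4)] by simp
qed

lemma Hom_iota_scal:
  assumes "\<psi> \<in> carrier (Hom_space n c \<nu> \<mu>)" "v \<in> carrier (irrep n \<nu>)"
  shows "to_pol n c (\<psi> (iota n c \<nu> (scal z * v))) = sop z (to_pol n c (\<psi> (iota n c \<nu> v)))"
  using Hom_iota_act[OF assms sn_spaceD(3)[OF sn_space_irrep assms(2), of z] smash_carrier_scal, of z] by simp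

lemma Hom_iota_sum:
  assumes "\<psi> \<in> carrier (Hom_space n c \<nu> \<mu>)" "finite A" "\<And>L. L \<in> A \<Longrightarrow> f L \<in> carrier (irrep n \<nu>)"
  shows "to_pol n c (\<psi> (iota n c \<nu> (\<Sum>L\<in>A. scal (\<alpha> L) * f L))) = (\<Sum>L\<in>A. sop (\<alpha> L) (to_pol n c (\<psi> (iota n c \<nu> (f L)))))"
  using assms(2,3)
proof (induction A)
  case empty
  show ?case using Hom_iota_scal[OF assms(1) sn_spaceD(1)[OF sn_space_irrep], of 0] by simp
next
  case (insert L A)
  have "(\<Sum>L\<in>A. scal (\<alpha> L) * f L) \<in> carrier (irrep n \<nu>)"
    using insert.prems by (intro sn_space_sum[OF sn_space_irrep] sn_spaceD(3)[OF sn_space_irrep]) auto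
  then show ?case
    using insert Hom_iota_add[OF assms(1) sn_spaceD(3)[OF sn_space_irrep, of "f L"]] Hom_iota_scal[OF assms(1), of "f L"] by simp
qed

text \<open>The formal sums are generated by pairs \<open>(cls n c a, v)\<close>, whose class is
  \<open>a\<close> applied to \<open>iota n c \<nu> v\<close>.\<close>

lemma Hom_eq_on_iota:
  assumes "\<psi> \<in> carrier (Hom_space n c \<nu> \<mu>)" "\<chi> \<in> carrier (Hom_space n c \<nu> \<mu>)"
    and e: "\<And>v. v \<in> carrier (irrep n \<nu>) \<Longrightarrow> to_pol n c (\<psi> (iota n c \<nu> v)) = to_pol n c (\<chi> (iota n c \<nu> v))"
  shows "\<psi> = \<chi>"
proof (rule Hom_space_eqI[OF assms(1,2)])
  fix x assume "x \<in> carrier (Delta n c \<nu>)"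
  then obtain f where x: "x = tcls n c \<nu> f" and f: "f \<in> tfree n c \<nu>" by (auto simp: Delta_carrier)
  have tc: "tcls n c \<nu> g \<in> carrier (Delta n c \<nu>)" if "g \<in> tfree n c \<nu>" for g using that by (auto simp: Delta_carrier)
  have step: "to_pol n c (\<xi> (tcls n c \<nu> (g - h))) = to_pol n c (\<xi> (tcls n c \<nu> g)) - to_pol n c (\<xi> (tcls n c \<nu> h))"
    if "\<xi> \<in> carrier (Hom_space n c \<nu> \<mu>)" "g \<in> tfree n c \<nu>" "h \<in> tfree n c \<nu>" for \<xi> g h
    using Hom_spaceD(2)[OF that(1) tc[OF tfree_closed(4)[OF that(2,3)]] tc[OF that(3)]]
      Delta_add[OF tfree_closed(4)[OF that(2,3)] that(3)] by simp
  have "to_pol n c (\<psi> (tcls n c \<nu> f)) = to_pol n c (\<chi> (tcls n c \<nu> f))"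
    using f
  proof (induction rule: tfree_induct)
    case zero
    show ?case using step[OF assms(1) tfree_closed(1,1)] step[OF assms(2) tfree_closed(1,1)] by simp
  next
    case (frag a v)
    then show ?case
      using e[OF frag(2)] Hom_spaceD(3)[OF assms(1) iota_carrier frag(1)] Hom_spaceD(3)[OF assms(2) iota_carrier frag(1)]
      by (simp add: act_iota)
  next
    case (diff f g)
    then show ?case using step[OF assms(1) diff(1,2)] step[OF assms(2) diff(1,2)] by simp
  qed
  then show "to_pol n c (\<psi> x) = to_pol n c (\<chi> x)" by (simp add: x)
qed

end

section \<open>The homomorphism and its uniqueness up to a scalar\<close>

locale hook_delta_pair = D: hook_delta n m l c u + D': hook_delta n m "l - 1" c u'
  for n m l :: nat and c :: complex and u u' :: "nat list list \<Rightarrow> smash" +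
  assumes l_pos: "1 \<le> l"
begin

declare One_nat_def [simp del]

sublocale hook_pair n m l c "carrier (irrep n (hook n l))" "carrier (irrep n (hook n (l - 1)))"
  "\<lambda>L. u (tab n L)" "\<lambda>L. u' (tab n L)"
  by unfold_locales (rule l_pos)

sublocale theta: singular_map n c "hook n l" "carrier (irrep n (hook n (l - 1)))" theta
  by unfold_locales (rule D'.V theta_pols theta_add theta_scal theta_perm yop_theta; assumption)+

abbreviation H where "H \<equiv> Hom_space n c (hook n l) (hook n (l - 1))"

text \<open>The universal property gives a map into polynomials, which \<open>inv_into\<close>
  carries back to the target module. Restriction to the carrier makes it extensional, as membership
  in \<open>Hom_space\<close> demands.\<close>

definition phi :: "std_elt \<Rightarrow> std_elt" where
  "phi = (\<lambda>x\<in>carrier (Delta n c (hook n l)). inv_into (carrier (Delta n c (hook n (l - 1)))) (to_pol n c) (dext n c theta x))"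

lemma phi_closed:
  assumes "x \<in> carrier (Delta n c (hook n l))"
  shows "phi x \<in> carrier (Delta n c (hook n (l - 1)))" "to_pol n c (phi x) = dext n c theta x"
proof -
  have "dext n c theta x \<in> to_pol n c ` carrier (Delta n c (hook n (l - 1)))"
    using to_pol_surj[OF theta.dext_pols[OF assms], of c] by force
  then show "phi x \<in> carrier (Delta n c (hook n (l - 1)))" "to_pol n c (phi x) = dext n c theta x"
    using assms by (simp_all add: phi_def inv_into_into f_inv_into_f)
qed

lemma phi_Hom: "phi \<in> carrier H"
  by (rule Hom_spaceI)
    (simp_all add: phi_closed Delta_closed theta.dext_add theta.dext_act, simp add: phi_def)

lemma phi_iota: "L \<in> legsets n l \<Longrightarrow> to_pol n c (phi (iota n c (hook n l) (u (tab n L)))) = W L"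
  by (simp add: phi_closed iota_carrier D.v_in theta.dext_iota theta_v)

lemma Hom_multiple:
  assumes \<psi>: "\<psi> \<in> carrier H"
  obtains z where "\<psi> = z \<odot>\<^bsub>H\<^esub> phi"
proof -
  let ?\<nu> = "hook n l"
  define f where "f L = to_pol n c (\<psi> (iota n c ?\<nu> (u (tab n L))))" for L
  have io: "iota n c ?\<nu> (u (tab n L)) \<in> carrier (Delta n c ?\<nu>)" if "L \<in> legsets n l" for L
    using D.v_in[OF that] by (rule iota_carrier)
  have "D'.eig (D'.om L) (f L)" if L: "L \<in> legsets n l" for L
  proof -
    have "uop n c i (f L) = sop (D'.om L i) (f L)" if i: "i \<in> {1..n}" for i
    proof -
      have "act n c ?\<nu> (u_elt c i) (iota n c ?\<nu> (u (tab n L))) = act n c ?\<nu> (scal (D'.om L i)) (iota n c ?\<nu> (u (tab n L)))"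
      proof (rule to_pol_eqI[of _ n c ?\<nu>])
        have "uop n c i (mon (\<lambda>_. 0) (u (tab n L))) = sop (D'.om L i) (mon (\<lambda>_. 0) (u (tab n L)))"
          using D.eig_zero[OF L] i by (simp only: D.eig_def)
        then show "to_pol n c (act n c ?\<nu> (u_elt c i) (iota n c ?\<nu> (u (tab n L)))) =
          to_pol n c (act n c ?\<nu> (scal (D'.om L i)) (iota n c ?\<nu> (u (tab n L))))"
          using const_map.dext_act[OF io[OF L] rep_u_elt(1)[OF i]] const_map.dext_act[OF io[OF L] smash_carrier_scal]
            rep_u[OF i] const_map.dext_iota[OF D.v_in[OF L]] by simp
      qed (intro Delta_closed io L rep_u_elt(1) i smash_carrier_scal)+
      then have "rep n c (u_elt c i) (f L) = rep n c (scal (D'.om L i)) (f L)"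
        unfolding f_def Hom_spaceD(3)[OF \<psi> io[OF L] rep_u_elt(1)[OF i], symmetric]
          Hom_spaceD(3)[OF \<psi> io[OF L] smash_carrier_scal, symmetric] by (rule arg_cong)
      then show ?thesis by (simp add: rep_u[OF i])
    qed
    moreover have "f L \<in> pols n (carrier (irrep n (hook n (l - 1))))"
      unfolding f_def by (rule const_map.dext_pols[OF Hom_spaceD(1)[OF \<psi> io[OF L]]])
    ultimately show ?thesis by (simp add: D'.eig_def)
  qed
  then have "\<forall>L. \<exists>z. L \<in> legsets n l \<longrightarrow> f L = sop z (W L)" using W_multiple by metis
  then obtain z where z: "\<And>L. L \<in> legsets n l \<Longrightarrow> f L = sop (z L) (W L)" by metis
  \<comment> \<open>\<open>\<psi>\<close> commutes with \<open>s_j\<close>, so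
    \<open>s_j f L\<close> can be computed from \<open>W_swap\<close> and from
    \<open>D.norm\<close>. The multiples of \<open>W L\<close> cancel, and what is left is a
    multiple of the nonzero \<open>W (leg_swap j L)\<close>.\<close>
  have "z (leg_swap j L) = z L" if L: "L \<in> legsets n l" and j: "j \<in> L" "Suc j \<notin> L" "Suc j \<le> n" for L j
  proof -
    let ?s = "transpose j (Suc j)" and ?L = "leg_swap j L" and ?v = "\<lambda>L. u (tab n L)"
    have L': "?L \<in> legsets n l" by (rule leg_swap_in[OF L j])
    have jn: "j \<in> {1..n}" "Suc j \<in> {1..n}" using L j by (auto simp: legsets_def)
    note V = D.v_in[OF L] D.v_in[OF L'] sn_spaceD(3)[OF sn_space_irrep D.v_in[OF L], of "D'.kap L j"]
    have t: "transp j (Suc j) * ?v L = ?v ?L + scal (D'.kap L j) * ?v L"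
      using D.norm[OF L j] by (simp add: D'.kap_def)
    have "pop ?s (f L) = to_pol n c (\<psi> (iota n c ?\<nu> (transp j (Suc j) * ?v L)))"
      unfolding f_def
      using Hom_iota_act[OF \<psi> V(1) sn_space_transp[OF sn_space_irrep jn V(1)] smash_carrier_transp[OF jn]]
      by (simp add: pop_const transp_def del: pop_mon)
    also have "\<dots> = f ?L + sop (D'.kap L j) (f L)"
      unfolding t f_def Hom_iota_add[OF \<psi> V(2,3)] Hom_iota_scal[OF \<psi> V(1)] ..
    finally have "sop (z L) (pop ?s (W L)) = sop (z ?L) (W ?L) + sop (D'.kap L j) (sop (z L) (W L))"
      unfolding z[OF L] z[OF L'] pop_sop .
    then have "sop (z L - z ?L) (W ?L) = 0"
      unfolding W_swap[OF L j] by (simp add: sop_simps sop_sop sop_minus mult.commute)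
    from W_nonzero[OF L' this] show ?thesis by simp
  qed
  then have zc: "z L = z {2..<l + 2}" if "L \<in> legsets n l" for L
    using legsets_const[of n l z L] that by blast
  let ?z = "z {2..<l + 2}"
  have "\<psi> = ?z \<odot>\<^bsub>H\<^esub> phi"
  proof (rule Hom_eq_on_iota[OF \<psi> Hom_smult(1)[OF phi_Hom]])
    fix v assume "v \<in> carrier (irrep n ?\<nu>)"
    then obtain \<alpha> where v: "v = (\<Sum>L\<in>legsets n l. scal (\<alpha> L) * u (tab n L))" using D.span by blast
    have "to_pol n c ((?z \<odot>\<^bsub>H\<^esub> phi) (iota n c ?\<nu> (u (tab n L)))) = f L" if L: "L \<in> legsets n l" for L
      using Hom_smult(2)[OF phi_Hom io[OF L]] phi_iota[OF L] z[OF L] zc[OF L] by simp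
    then show "to_pol n c (\<psi> (iota n c ?\<nu> v)) = to_pol n c ((?z \<odot>\<^bsub>H\<^esub> phi) (iota n c ?\<nu> v))"
      using Hom_iota_sum[OF \<psi> finite_legsets, of n l "\<lambda>L. u (tab n L)" \<alpha>]
        Hom_iota_sum[OF Hom_smult(1)[OF phi_Hom] finite_legsets, of n l "\<lambda>L. u (tab n L)" ?z \<alpha>]
      by (simp add: v D.v_in f_def)
  qed
  then show thesis by (rule that)
qed

lemma legset_exists: "{2..<l + 2} \<in> legsets n l"
  using D.l_less by (auto simp: legsets_def)

lemma smult_phi_zero: "z \<odot>\<^bsub>H\<^esub> phi = \<zero>\<^bsub>H\<^esub> \<Longrightarrow> z = 0"
proof -
  assume e: "z \<odot>\<^bsub>H\<^esub> phi = \<zero>\<^bsub>H\<^esub>"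
  let ?x = "iota n c (hook n l) (u (tab n {2..<l + 2}))"
  have x: "?x \<in> carrier (Delta n c (hook n l))" by (rule iota_carrier[OF D.v_in[OF legset_exists]])
  have "sop z (W {2..<l + 2}) = 0"
    using Hom_smult(2)[OF phi_Hom x, of z] Hom_zero(2)[OF x, where \<mu> = "hook n (l - 1)"] phi_iota[OF legset_exists] e by simp
  then show "z = 0" by (rule W_nonzero[OF legset_exists])
qed

lemma phi_nonzero: "phi \<noteq> \<zero>\<^bsub>H\<^esub>"
proof
  assume "phi = \<zero>\<^bsub>H\<^esub>"
  moreover have "1 \<odot>\<^bsub>H\<^esub> phi = phi"
    by (rule Hom_space_eqI[OF Hom_smult(1)[OF phi_Hom] phi_Hom]) (simp add: Hom_smult(2)[OF phi_Hom])
  ultimately show False using smult_phi_zero[of 1] by simp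
qed

lemma Hom_basis: "vectorspace.basis class_ring H {phi}"
proof -
  interpret vs: vectorspace class_ring H by (rule Hom_vectorspace)
  have lc: "vs.lincomb a {phi} = a phi \<odot>\<^bsub>H\<^esub> phi" for a
    unfolding vs.lincomb_def using Hom_smult(1)[OF phi_Hom, of "a phi"] by simp
  have sub: "{phi} \<subseteq> carrier H" using phi_Hom by simp
  have "vs.lin_indpt {phi}"
    by (rule vs.finite_lin_indpt2[OF _ sub]) (auto simp: lc dest: smult_phi_zero)
  moreover have "vs.span {phi} = carrier H"
  proof
    show "vs.span {phi} \<subseteq> carrier H" unfolding vs.finite_span[OF _ sub, simplified] using Hom_smult(1)[OF phi_Hom] by (auto simp: lc)
    show "carrier H \<subseteq> vs.span {phi}"
    proof
      fix \<psi> assume "\<psi> \<in> carrier H"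
      then obtain z where "\<psi> = vs.lincomb (\<lambda>_. z) {phi}" unfolding lc by (rule Hom_multiple)
      then show "\<psi> \<in> vs.span {phi}" unfolding vs.span_def
        by (intro CollectI exI[of _ "\<lambda>_. z"] exI[of _ "{phi}"]) simp
    qed
  qed
  ultimately show ?thesis using sub unfolding vs.basis_def by simp
qed

lemma phi_eigenvec:
  assumes "is \<in> legs n l"
  shows "phi (eigenvec n c (hook n l) u (\<lambda>_. 0) (hook_tableau n is)) =
    eigenvec n c (hook n (l - 1)) u' (\<lambda>i. m * e_vec (last is) i) (hook_tableau n (butlast is))"
proof -
  let ?L = "set is"
  note I = legs_set[OF assms]
  have L: "?L \<in> legsets n l" by (rule I(1))
  note E = D.eigenvec_tab[OF D.zero_exponents L]
  note E' = D'.eigenvec_tab[OF Max_in[OF L] legsets_Max(3)[OF L l_pos]]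
  have "eigenvec n c (hook n l) u (\<lambda>_. 0) (tab n ?L) = iota n c (hook n l) (u (tab n ?L))"
    by (rule to_pol_eqI[OF E(1) iota_carrier[OF D.v_in[OF L]]])
      (simp add: E(2) const_map.dext_iota[OF D.v_in[OF L]] D.ev_zero[OF L])
  then have "to_pol n c (phi (eigenvec n c (hook n l) u (\<lambda>_. 0) (tab n ?L))) = W ?L" using phi_iota[OF L] by simp
  also have "\<dots> = to_pol n c (eigenvec n c (hook n (l - 1)) u' (mexp m (Max ?L)) (tab n (?L - {Max ?L})))"
    unfolding E'(2) W_def ..
  finally have "phi (eigenvec n c (hook n l) u (\<lambda>_. 0) (tab n ?L)) =
      eigenvec n c (hook n (l - 1)) u' (mexp m (Max ?L)) (tab n (?L - {Max ?L}))"
    by (rule to_pol_eqI[OF phi_closed(1)[OF E(1)] E'(1)])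
  moreover have "mexp m (Max ?L) = (\<lambda>i. m * e_vec (last is) i)"
    using I(3)[OF l_pos] by (simp add: mexp_def fun_eq_iff)
  ultimately show ?thesis using I(2) I(4)[OF l_pos] by simp
qed

end

theorem proposition5p16:
  fixes m n l :: nat and c :: complex and v v' :: "nat list list \<Rightarrow> smash"
  assumes "0 < m" and "0 < n" and "coprime m n"
    and "c = of_nat m / of_nat n"
    and "l \<in> {1..n - 1}"
    and "hook_basis n c l v"
    and "hook_basis n c (l - 1) v'"
  shows
    "let H = Hom_space n c (hook n l) (hook n (l - 1));
         P = (\<lambda>\<phi>. \<forall>is\<in>legs n l.
                \<phi> (eigenvec n c (hook n l) v (\<lambda>_. 0) (hook_tableau n is)) =
                eigenvec n c (hook n (l - 1)) v' (\<lambda>i. m * e_vec (last is) i)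
                  (hook_tableau n (butlast is)))
     in vectorspace class_ring H \<and> vectorspace.fin_dim class_ring H
        \<and> vectorspace.dim class_ring H = 1
        \<and> (\<exists>\<phi>\<in>carrier H. \<phi> \<noteq> \<zero>\<^bsub>H\<^esub> \<and> P \<phi>
             \<and> (\<forall>\<psi>\<in>carrier H. P \<psi> \<longrightarrow> \<psi> = \<phi>)
             \<and> (\<forall>\<psi>\<in>carrier H. \<psi> \<noteq> \<zero>\<^bsub>H\<^esub> \<longrightarrow> (\<exists>z. z \<noteq> 0 \<and> \<psi> = z \<odot>\<^bsub>H\<^esub> \<phi>)))"
proof -
  have ln: "1 \<le> l" "l < n" "l - 1 < n" using assms(5) by auto
  interpret hook_delta_pair n m l c v v'
    by (intro hook_delta_pair.intro hook_delta.intro hook_delta_axioms.intro hook_delta_pair_axioms.intro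
        hook_rep_of_basis assms(1-4,6,7) ln)
  interpret vs: vectorspace class_ring H by (rule Hom_vectorspace)
  let ?P = "\<lambda>\<phi>. \<forall>is\<in>legs n l. \<phi> (eigenvec n c (hook n l) v (\<lambda>_. 0) (hook_tableau n is)) =
    eigenvec n c (hook n (l - 1)) v' (\<lambda>i. m * e_vec (last is) i) (hook_tableau n (butlast is))"
  have fd: "vs.fin_dim" unfolding vs.fin_dim_def using Hom_basis phi_Hom by (intro exI[of _ "{phi}"]) (auto simp: vs.basis_def)
  have dim: "vs.dim = 1" using vs.dim_basis[OF _ Hom_basis] by simp
  have P: "?P phi" using phi_eigenvec by blast
  \<comment> \<open>A single leg already fixes the scalar \<open>z\<close>, because \<open>W\<close>
    is nonzero there; the lowest leg \<open>{2..<l + 2}\<close> serves, and it exists as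
    \<open>l < n\<close>.\<close>
  have uniq: "\<psi> = phi" if \<psi>: "\<psi> \<in> carrier H" "?P \<psi>" for \<psi>
  proof -
    obtain z where z: "\<psi> = z \<odot>\<^bsub>H\<^esub> phi" using Hom_multiple[OF \<psi>(1)] .
    let ?L = "{2..<l + 2}"
    have "[2..<l + 2] \<in> legs n l" using ln by (auto simp: legs_def simp del: upt_Suc)
    then obtain k where k: "k \<in> legs n l" "set k = ?L" using set_upt by blast
    let ?e = "eigenvec n c (hook n l) v (\<lambda>_. 0) (hook_tableau n k)"
    have e: "?e \<in> carrier (Delta n c (hook n l))" "to_pol n c ?e = mon (\<lambda>_. 0) (v (tab n ?L))"
      using D.eigenvec_tab[OF D.zero_exponents legset_exists] legs_set(2)[OF k(1)] k(2) D.ev_zero[OF legset_exists] by simp_all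
    have "?e = iota n c (hook n l) (v (tab n ?L))"
      by (rule to_pol_eqI[OF e(1) iota_carrier[OF D.v_in[OF legset_exists]]])
        (simp only: e(2) const_map.dext_iota[OF D.v_in[OF legset_exists]])
    then have "to_pol n c (phi ?e) = W ?L" using phi_iota[OF legset_exists] by simp
    moreover have "\<psi> ?e = phi ?e" using P \<psi>(2) k(1) by simp
    then have "sop z (to_pol n c (phi ?e)) = to_pol n c (phi ?e)" using Hom_smult(2)[OF phi_Hom e(1), of z] z by simp
    ultimately have "sop (z - 1) (W ?L) = 0" by (simp add: sop_minus)
    from W_nonzero[OF legset_exists this] have "z = 1" by simp
    then show ?thesis unfolding z
      by (intro Hom_space_eqI[OF Hom_smult(1)[OF phi_Hom] phi_Hom]) (simp add: Hom_smult(2)[OF phi_Hom])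
  qed
  have mult: "\<exists>z. z \<noteq> 0 \<and> \<psi> = z \<odot>\<^bsub>H\<^esub> phi" if \<psi>: "\<psi> \<in> carrier H" "\<psi> \<noteq> \<zero>\<^bsub>H\<^esub>" for \<psi>
  proof -
    obtain z where z: "\<psi> = z \<odot>\<^bsub>H\<^esub> phi" using Hom_multiple[OF \<psi>(1)] .
    have "0 \<odot>\<^bsub>H\<^esub> phi = \<zero>\<^bsub>H\<^esub>"
      by (rule Hom_space_eqI[OF Hom_smult(1)[OF phi_Hom] Hom_zero(1)]) (simp add: Hom_smult(2)[OF phi_Hom] Hom_zero(2))
    then have "z \<noteq> 0" using z \<psi>(2) by metis
    then show ?thesis using z by blast
  qed
  show ?thesis unfolding Let_def
    using Hom_vectorspace fd dim phi_Hom phi_nonzero P uniq mult by (intro conjI bexI[of _ phi]) blast+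
qed

end
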